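(* (i) Let $2<p<\infty$ and let $\Lambda\subset\mathbb R\times\mathbb R$ be a countable set which is not contained in any vertical strip $[-a,a]\times\mathbb R$, $a>0$. Then there exist $g\in L^p(\mathbb R)$ and functionals $g^*_{ts}\in (L^p(\mathbb R))^*$, $(t,s)\in\Lambda$, such that the system $\{(e_s\tau_t g,\,g^*_{ts}):(t,s)\in\Lambda\}$ is an unconditional Schauder frame of $L^p(\mathbb R)$. (ii) Let $2\le p<\infty$, $a>0$, and let $\Lambda\subset[-a,a]\times\mathbb R$ be countable. Then there do not exist $g\in L^p(\mathbb R)$ and functionals $g^*_{ts}\in(L^p(\mathbb R))^*$, $(t,s)\in\Lambda$, such that $\{(e_s\tau_t g,\,g^*_{ts}):(t,s)\in\Lambda\}$ is an unconditional Schauder frame of $L^p(\mathbb R)$.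
   Context: For $t,s\in\mathbb R$ write $(\tau_t g)(x)=g(x-t)$ and $e_s(x)=e^{2\pi i s x}$. If $X$ is a separable Banach space with dual $X^*$, a family $\{(u_n,u_n^* )\}_{n\in N}\subset X\times X^*$ indexed by a countable set $N$ is an unconditional Schauder frame of $X$ if for every $x\in X$ the series $\sum_{n\in N}u_n^*(x)u_n$ converges unconditionally to $x$. *)

theory Defs
  imports "HOL-Analysis.Analysis"
begin

text \<open>L^p(R) (complex valued), represented by Borel measurable functions
  whose p-th power of the modulus is Lebesgue integrable; elements are
  identified only through the L^p seminorm below (a.e. equality).\<close>

definition Lp :: "real \<Rightarrow> (real \<Rightarrow> complex) set" where
  "Lp p = {f. f \<in> borel_measurable lborel \<and>
                integrable lborel (\<lambda>x. norm (f x) powr p)}"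

definition lp_norm :: "real \<Rightarrow> (real \<Rightarrow> complex) \<Rightarrow> real" where
  "lp_norm p f = (\<integral>x. norm (f x) powr p \<partial>lborel) powr (1 / p)"

definition Lp_dual :: "real \<Rightarrow> ((real \<Rightarrow> complex) \<Rightarrow> complex) set" where
  "Lp_dual p = {\<phi>.
     (\<forall>f\<in>Lp p. \<forall>g\<in>Lp p. \<phi> (\<lambda>x. f x + g x) = \<phi> f + \<phi> g) \<and>
     (\<forall>f\<in>Lp p. \<forall>c::complex. \<phi> (\<lambda>x. c * f x) = c * \<phi> f) \<and>
     (\<exists>C. \<forall>f\<in>Lp p. norm (\<phi> f) \<le> C * lp_norm p f)}"

definition transl :: "real \<Rightarrow> (real \<Rightarrow> complex) \<Rightarrow> real \<Rightarrow> complex" where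
  "transl t g = (\<lambda>x. g (x - t))"

definition modul :: "real \<Rightarrow> real \<Rightarrow> complex" where
  "modul s = (\<lambda>x. exp (2 * pi * \<i> * complex_of_real (s * x)))"

definition uncond_schauder_frame ::
  "real \<Rightarrow> 'i set \<Rightarrow> ('i \<Rightarrow> real \<Rightarrow> complex) \<Rightarrow> ('i \<Rightarrow> (real \<Rightarrow> complex) \<Rightarrow> complex) \<Rightarrow> bool"
  where
  "uncond_schauder_frame p N u us \<longleftrightarrow>
     countable N \<and>
     (\<forall>n\<in>N. u n \<in> Lp p \<and> us n \<in> Lp_dual p) \<and>
     (\<forall>x\<in>Lp p. \<forall>\<epsilon>>0. \<exists>F0. finite F0 \<and> F0 \<subseteq> N \<and>
        (\<forall>F. finite F \<and> F0 \<subseteq> F \<and> F \<subseteq> N \<longrightarrow>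
           lp_norm p (\<lambda>y. x y - (\<Sum>n\<in>F. us n x * u n y)) < \<epsilon>))"

end

theory Submission
  imports Defs
begin

text \<open>(i) Only a sequence of points \<open>(t n, s n)\<close> of \<open>\<Lambda>\<close> with rapidly growing \<open>\<bar>t n\<bar>\<close> receives nonzero
  functionals. Let \<open>e j\<close> be the Haar system, an unconditional system of compactly supported functions.
  Attach to \<open>e j\<close> a block of \<open>K j\<close> consecutive points and let \<open>g\<close> be the sum of the inverse
  time-frequency shifts of \<open>\<alpha> j e j\<close> over each block. The average over block \<open>j\<close> of the shifts of \<open>g\<close>,
  divided by \<open>\<alpha> j\<close>, equals \<open>e j\<close> plus an average of \<open>K j\<close> functions with essentially disjoint supports;
  with \<open>\<alpha> j\<close> comparable to \<open>K j powr (-1/p)\<close> this error has norm about \<open>K j powr (2/p - 1)\<close>, which is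
  small since \<open>p > 2\<close>. So the shifts form a small perturbation of an unconditional frame.

  (ii) For fixed \<open>f\<close> let \<open>c n\<close> be its coefficients. Near the origin all shifts \<open>u n\<close> with \<open>t n\<close> in \<open>[-a, a]\<close>
  are bounded below, and unconditionality together with \<open>p \<ge> 2\<close> shows that the sums \<open>A j\<close> of \<open>\<bar>c n\<bar>\<close> over the
  frequency cells \<open>s n \<in> [j, j + 1)\<close> are square summable. On an interval \<open>[M, M + 2]\<close> far out the shifts are
  small: by Bessel's inequality, averaged pairings of \<open>f\<close> with modulated windows there are at most a
  constant times \<open>(\<Sum>j. (A j)\<^sup>2) powr (1/2)\<close> times the \<open>L\<^sup>2\<close> norm of \<open>g\<close> near \<open>[M, M + 2]\<close>. An \<open>f\<close> that decays much
  more slowly than \<open>g\<close> contradicts this.\<close>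

section \<open>The seminorm of \<open>L\<^sup>p\<close>\<close>

text \<open>Part (i) must cope with finite subsets of \<open>\<Lambda>\<close> that cut a block
  anywhere, so the Haar system is needed with all real multipliers in [-1, 1], not only with signs.
  The Bellman function that supplies this is a smooth, cruder relative of Burkholder's (|y| - (p -
  1) |x|) (|x| + |y|)^(p - 1): its concavity holds only for multipliers of size at most some
  \<open>\<tau>\<close>, and linearity in the multiplier restores the rest for a factor 1 /
  \<open>\<tau>\<close>. The parameters are chosen in the order \<open>eps j\<close>,
  \<open>K j\<close>, \<open>\<alpha> j\<close>, \<open>eps (Suc j)\<close>. A new budget is tiny
  against \<open>\<alpha> j\<close>, so later blocks stay negligible after division by
  \<open>\<alpha> j\<close>, while earlier blocks are controlled by disjointness. The perturbed
  coefficients then solve a triangular system: coefficient i feels only the errors of blocks before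
  i. In part (ii) the test function is built from g alone, before its coefficients are looked at, so
  every bound may depend on it.\<close>

lemma LpD:
  assumes "f \<in> Lp p"
  shows "f \<in> borel_measurable borel" "integrable lborel (\<lambda>x. norm (f x) powr p)"
  using assms by (auto simp: Lp_def)

lemma LpI:
  assumes "f \<in> borel_measurable borel" "integrable lborel (\<lambda>x. norm (f x) powr p)"
  shows "f \<in> Lp p"
  using assms by (auto simp: Lp_def)

lemma integrable_indicator_Icc [simp]: "integrable lborel (indicator {c..d::real} :: real \<Rightarrow> real)"
  by (rule integrable_real_indicator) (auto simp: emeasure_lborel_Icc_eq)

lemma lp_norm_nonneg [simp]: "0 \<le> lp_norm p f"
  by (simp add: lp_norm_def)

text \<open>Convexity of the power at a/A and b/B with weights A/(A+B) and B/(A+B). Integrated with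
  A and B bounding the norms of two functions, the right side collapses to (A+B)^p, which is
  Minkowski's inequality.\<close>

lemma powr_convex_combination:
  fixes a b A B p :: real
  assumes "1 \<le> p" "0 \<le> a" "0 \<le> b" "0 < A" "0 < B"
  shows "(a + b) powr p
    \<le> (A + B) powr p * (A / (A + B) * (a powr p / A powr p) + B / (A + B) * (b powr p / B powr p))"
proof -
  have AB: "0 < A + B" using assms by simp
  have conv: "((a + b) / (A + B)) powr p \<le> A / (A + B) * (a / A) powr p + B / (A + B) * (b / B) powr p"
  proof -
    \<comment> \<open>Convexity is applied at positive points; at a = 0 or b = 0 a single weight l
      in [0, 1] remains, and l^p \<le> l suffices.\<close>
    have le: "l powr p \<le> l" if "0 \<le> l" "l \<le> 1" for l :: real
      using that assms powr_mono'[of 1 p l] by simp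
    consider "a = 0" | "b = 0" | "a > 0" "b > 0" using assms by linarith
    then show ?thesis
    proof cases
      case 1
      have "((a + b) / (A + B)) powr p = (B / (A + B)) powr p * (b / B) powr p"
        using 1 assms by (simp flip: powr_mult)
      also have "\<dots> \<le> B / (A + B) * (b / B) powr p"
        by (intro mult_right_mono le) (use assms in auto)
      finally show ?thesis using 1 by simp
    next
      case 2
      have "((a + b) / (A + B)) powr p = (A / (A + B)) powr p * (a / A) powr p"
        using 2 assms by (simp flip: powr_mult)
      also have "\<dots> \<le> A / (A + B) * (a / A) powr p"
        by (intro mult_right_mono le) (use assms in auto)
      finally show ?thesis using 2 by simp
    next
      case 3
      have "(A / (A + B)) *\<^sub>R (a / A) + (B / (A + B)) *\<^sub>R (b / B) = (a + b) / (A + B)"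
        using assms AB by (simp add: add_divide_distrib)
      moreover have "1 - B / (A + B) = A / (A + B)" using AB by (simp add: field_simps)
      moreover have "((1 - B / (A + B)) *\<^sub>R (a / A) + (B / (A + B)) *\<^sub>R (b / B)) powr p
        \<le> (1 - B / (A + B)) * (a / A) powr p + B / (A + B) * (b / B) powr p"
        by (rule convex_onD[OF powr_convex[OF assms(1)]]) (use assms 3 in auto)
      ultimately show ?thesis by simp
    qed
  qed
  have "(a + b) powr p = (A + B) powr p * ((a + b) / (A + B)) powr p"
    using AB assms by (simp add: powr_divide)
  also have "\<dots> \<le> (A + B) powr p * (A / (A + B) * (a / A) powr p + B / (A + B) * (b / B) powr p)"
    by (intro mult_left_mono conv) auto
  finally show ?thesis using assms by (simp add: powr_divide)
qed

lemma Lp_dominated: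
  assumes "f \<in> borel_measurable borel" "g \<in> Lp p" "\<And>x. norm (f x) \<le> norm (g x)" "0 \<le> p"
  shows "f \<in> Lp p" "lp_norm p f \<le> lp_norm p g"
proof -
  have m: "norm (f x) powr p \<le> norm (g x) powr p" for x
    by (intro powr_mono2 assms) auto
  have int: "integrable lborel (\<lambda>x. norm (f x) powr p)"
    by (rule Bochner_Integration.integrable_bound[OF LpD(2)[OF assms(2)]]) (use assms m in auto)
  then show "f \<in> Lp p" using assms by (intro LpI) auto
  have "(\<integral>x. norm (f x) powr p \<partial>lborel) \<le> (\<integral>x. norm (g x) powr p \<partial>lborel)"
    by (intro integral_mono int LpD(2)[OF assms(2)] m)
  then show "lp_norm p f \<le> lp_norm p g"
    unfolding lp_norm_def using assms by (intro powr_mono2) auto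
qed

lemma lp_norm_cong: "(\<And>x. norm (f x) = norm (g x)) \<Longrightarrow> lp_norm p f = lp_norm p g"
  by (simp add: lp_norm_def)

context
  fixes p :: real
  assumes p1: "1 \<le> p"
begin

lemma lp_norm_powr: "lp_norm p f powr p = (\<integral>x. norm (f x) powr p \<partial>lborel)"
  using p1 by (simp add: lp_norm_def powr_powr)

lemma lp_norm_leI:
  assumes "(\<integral>x. norm (f x) powr p \<partial>lborel) \<le> A powr p" "0 \<le> A"
  shows "lp_norm p f \<le> A"
proof -
  have "lp_norm p f \<le> (A powr p) powr (1 / p)"
    unfolding lp_norm_def by (intro powr_mono2) (use assms p1 in auto)
  then show ?thesis using assms p1 by (simp add: powr_powr)
qed

lemma lp_norm_leD:
  assumes "lp_norm p f \<le> A"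
  shows "(\<integral>x. norm (f x) powr p \<partial>lborel) \<le> A powr p"
  using powr_mono2[OF _ _ assms, of p] p1 by (simp add: lp_norm_powr)

lemma Lp_zero [simp]: "(\<lambda>x. 0) \<in> Lp p" "lp_norm p (\<lambda>x. 0) = 0"
  using p1 by (auto simp: Lp_def lp_norm_def)

lemma Lp_cmult: "f \<in> Lp p \<Longrightarrow> (\<lambda>x. c * f x) \<in> Lp p"
  by (auto simp: Lp_def norm_mult powr_mult)

lemma lp_norm_cmult: "lp_norm p (\<lambda>x. c * f x) = norm c * lp_norm p f"
  using p1 by (simp add: lp_norm_def norm_mult powr_mult powr_powr)

lemma Lp_add_bound:
  assumes f: "f \<in> Lp p" and g: "g \<in> Lp p" and A: "lp_norm p f \<le> A" "0 < A" and B: "lp_norm p g \<le> B" "0 < B"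
  shows "(\<lambda>x. f x + g x) \<in> Lp p" "lp_norm p (\<lambda>x. f x + g x) \<le> A + B"
proof -
  note [measurable] = LpD(1)[OF f] LpD(1)[OF g]
  let ?h = "\<lambda>x. (A + B) powr p * (A / (A + B) * (norm (f x) powr p / A powr p) + B / (A + B) * (norm (g x) powr p / B powr p))"
  have le: "norm (f x + g x) powr p \<le> ?h x" for x
    by (rule order.trans[OF powr_mono2[OF _ _ norm_triangle_ineq] powr_convex_combination])
      (use p1 A B in auto)
  have hi: "integrable lborel ?h"
    using LpD(2)[OF f] LpD(2)[OF g] by auto
  have int: "integrable lborel (\<lambda>x. norm (f x + g x) powr p)"
    by (rule Bochner_Integration.integrable_bound[OF hi])
      (use le in \<open>auto intro!: AE_I2 intro: order.trans[OF _ abs_ge_self]\<close>)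
  then show "(\<lambda>x. f x + g x) \<in> Lp p" by (intro LpI) auto
  have "(\<integral>x. norm (f x + g x) powr p \<partial>lborel) \<le> (\<integral>x. ?h x \<partial>lborel)"
    by (intro integral_mono int hi le)
  also have "\<dots> = (A + B) powr p * (A / (A + B) * ((\<integral>x. norm (f x) powr p \<partial>lborel) / A powr p)
      + B / (A + B) * ((\<integral>x. norm (g x) powr p \<partial>lborel) / B powr p))"
    using LpD(2)[OF f] LpD(2)[OF g] by simp
  also have "\<dots> \<le> (A + B) powr p * (A / (A + B) * 1 + B / (A + B) * 1)"
    using lp_norm_leD[OF A(1)] lp_norm_leD[OF B(1)] A B
    by (intro mult_left_mono add_mono) auto
  also have "\<dots> = (A + B) powr p"
    using A B by (simp add: add_divide_distrib[symmetric])
  finally show "lp_norm p (\<lambda>x. f x + g x) \<le> A + B"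
    using A B by (intro lp_norm_leI) auto
qed

lemma Lp_add: "f \<in> Lp p \<Longrightarrow> g \<in> Lp p \<Longrightarrow> (\<lambda>x. f x + g x) \<in> Lp p"
  by (rule Lp_add_bound[of f g "lp_norm p f + 1" "lp_norm p g + 1"]) (auto intro: add_nonneg_pos)

text \<open>\<open>Lp_add_bound\<close> divides by its bounds, so each seminorm, which may vanish,
  is enlarged by e/2 before e tends to 0.\<close>

lemma lp_norm_triangle:
  assumes "f \<in> Lp p" "g \<in> Lp p"
  shows "lp_norm p (\<lambda>x. f x + g x) \<le> lp_norm p f + lp_norm p g"
proof (rule field_le_epsilon)
  fix e :: real assume "0 < e"
  then show "lp_norm p (\<lambda>x. f x + g x) \<le> lp_norm p f + lp_norm p g + e"
    using Lp_add_bound(2)[OF assms, of "lp_norm p f + e/2" "lp_norm p g + e/2"]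
    by (auto simp: add_nonneg_pos)
qed

lemma Lp_diff: "f \<in> Lp p \<Longrightarrow> g \<in> Lp p \<Longrightarrow> (\<lambda>x. f x - g x) \<in> Lp p"
  using Lp_add[of f "\<lambda>x. (-1) * g x"] Lp_cmult[of g "-1"] by simp

lemma lp_norm_minus_commute: "lp_norm p (\<lambda>x. f x - g x) = lp_norm p (\<lambda>x. g x - f x)"
  by (intro lp_norm_cong) (simp add: norm_minus_commute)

lemma lp_norm_triangle_diff:
  assumes "f \<in> Lp p" "g \<in> Lp p"
  shows "lp_norm p (\<lambda>x. f x - g x) \<le> lp_norm p f + lp_norm p g"
  using lp_norm_triangle[OF assms(1) Lp_cmult[OF assms(2), of "-1"]] lp_norm_cmult[of "-1" g] by simp

lemma lp_norm_triangle_sub: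
  assumes "f \<in> Lp p" "g \<in> Lp p"
  shows "lp_norm p f \<le> lp_norm p g + lp_norm p (\<lambda>x. f x - g x)"
  using lp_norm_triangle[OF assms(2) Lp_diff[OF assms]] by simp

lemma Lp_sum: "(\<And>i. i \<in> I \<Longrightarrow> f i \<in> Lp p) \<Longrightarrow> (\<lambda>x. \<Sum>i\<in>I. f i x) \<in> Lp p"
  by (induction I rule: infinite_finite_induct) (auto intro: Lp_add)

lemma lp_norm_sum:
  "(\<And>i. i \<in> I \<Longrightarrow> f i \<in> Lp p) \<Longrightarrow> lp_norm p (\<lambda>x. \<Sum>i\<in>I. f i x) \<le> (\<Sum>i\<in>I. lp_norm p (f i))"
proof (induction I rule: infinite_finite_induct)
  case (insert i I)
  have "lp_norm p (\<lambda>x. f i x + (\<Sum>i\<in>I. f i x)) \<le> lp_norm p (f i) + lp_norm p (\<lambda>x. \<Sum>i\<in>I. f i x)"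
    by (intro lp_norm_triangle Lp_sum insert) (use insert in auto)
  then show ?case using insert by (auto intro: order.trans)
qed auto

lemma Lp_bounded_support:
  assumes "f \<in> borel_measurable borel" "\<And>x. norm (f x) \<le> B" "\<And>x. x \<notin> {c..d} \<Longrightarrow> f x = 0"
  shows "f \<in> Lp p" "c \<le> d \<Longrightarrow> lp_norm p f \<le> B * (d - c) powr (1/p)"
proof -
  have B: "0 \<le> B" using assms(2)[of 0] norm_ge_zero order.trans by blast
  have bd: "norm (f x) powr p \<le> B powr p * indicator {c..d} x" for x
    using assms p1 B by (cases "x \<in> {c..d}") (auto intro!: powr_mono2)
  have hi: "integrable lborel (\<lambda>x. B powr p * indicator {c..d} x)" by simp
  have int: "integrable lborel (\<lambda>x. norm (f x) powr p)"
    by (rule Bochner_Integration.integrable_bound[OF hi]) (use assms bd in auto)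
  then show "f \<in> Lp p" using assms by (intro LpI) auto
  assume "c \<le> d"
  have "(\<integral>x. norm (f x) powr p \<partial>lborel) \<le> (\<integral>x. B powr p * indicator {c..d} x \<partial>lborel)"
    by (intro integral_mono int hi bd)
  also have "\<dots> = (B * (d - c) powr (1/p)) powr p"
    using \<open>c \<le> d\<close> p1 B by (simp add: powr_mult powr_powr)
  finally show "lp_norm p f \<le> B * (d - c) powr (1/p)"
    using B by (intro lp_norm_leI) auto
qed

lemma le_one_plus_powr: "0 \<le> (a::real) \<Longrightarrow> a \<le> 1 + a powr p"
  using p1 powr_mono[of 1 p a] by (cases "a \<le> 1") (auto intro: add_increasing2)

lemma Lp_integrable_on_interval:
  assumes "f \<in> Lp p"
  shows "integrable lborel (\<lambda>x. indicator {c..d} x * f x)"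
proof (rule Bochner_Integration.integrable_bound)
  show "integrable lborel (\<lambda>x. indicator {c..d} x + norm (f x) powr p)"
    using LpD(2)[OF assms] by auto
  show "AE x in lborel. norm (indicator {c..d} x * f x) \<le> norm (indicator {c..d} x + norm (f x) powr p)"
    using le_one_plus_powr[of "norm (f x)" for x] by (auto simp: indicator_def)
qed (use LpD(1)[OF assms] in auto)

text \<open>Scaling \<open>le_one_plus_powr\<close> gives |f| \<le> l + l (|f|/l)^p, and the last
  integral is at most l. Hoelder's constant is replaced by the cruder d - c + 1, good enough for the
  intervals of length at most 1 on which it is applied.\<close>

lemma Lp_L1_bound:
  assumes "f \<in> Lp p" "c \<le> d"
  shows "(\<integral>x. norm (indicator {c..d} x * f x) \<partial>lborel) \<le> (d - c + 1) * lp_norm p f"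
proof -
  note [measurable] = LpD(1)[OF assms(1)]
  have fin: "(\<integral>x. norm (indicator {c..d} x * f x) \<partial>lborel) \<le> (d - c + 1) * l"
    if l: "lp_norm p f \<le> l" "0 < l" for l
  proof -
    have "(\<integral>x. norm (indicator {c..d} x * f x) \<partial>lborel)
        \<le> (\<integral>x. l * indicator {c..d} x + l * (norm (f x) powr p / l powr p) \<partial>lborel)"
    proof (rule integral_mono)
      show "integrable lborel (\<lambda>x. norm (indicator {c..d} x * f x))"
        using Lp_integrable_on_interval[OF assms(1)] by (rule integrable_norm)
      show "integrable lborel (\<lambda>x. l * indicator {c..d} x + l * (norm (f x) powr p / l powr p))"
        using LpD(2)[OF assms(1)] by auto
      fix x
      have "norm (f x) / l \<le> 1 + norm (f x) powr p / l powr p"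
        using le_one_plus_powr[of "norm (f x) / l"] l by (simp add: powr_divide)
      then have "norm (f x) \<le> l + l * (norm (f x) powr p / l powr p)"
        using l by (simp add: field_simps)
      then show "norm (indicator {c..d} x * f x) \<le> l * indicator {c..d} x + l * (norm (f x) powr p / l powr p)"
        using l by (auto simp: indicator_def)
    qed
    also have "\<dots> = l * (d - c) + l * ((\<integral>x. norm (f x) powr p \<partial>lborel) / l powr p)"
      using LpD(2)[OF assms(1)] assms by (subst Bochner_Integration.integral_add) auto
    also have "\<dots> \<le> l * (d - c) + l * 1"
      using lp_norm_leD[OF l(1)] l by (intro add_left_mono mult_left_mono) auto
    finally show ?thesis by (simp add: algebra_simps)
  qed
  show ?thesis
  proof (rule field_le_epsilon)
    fix e :: real assume e: "0 < e"
    have "0 < lp_norm p f + e / (d - c + 1)"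
      using e assms by (intro add_nonneg_pos) auto
    moreover have "(d - c + 1) * (e / (d - c + 1)) = e" using assms by simp
    ultimately show "(\<integral>x. norm (indicator {c..d} x * f x) \<partial>lborel) \<le> (d - c + 1) * lp_norm p f + e"
      using fin[of "lp_norm p f + e / (d - c + 1)"] e assms by (simp only: distrib_left) simp
  qed
qed

lemma gabor_Lp:
  assumes "g \<in> Lp p"
  shows "(\<lambda>x. modul s x * transl t g x) \<in> Lp p"
    "lp_norm p (\<lambda>x. modul s x * transl t g x) = lp_norm p g"
proof -
  note [measurable] = LpD(1)[OF assms]
  have n: "norm (modul s x * transl t g x) = norm (g (-t + 1 * x))" for x
    by (simp add: modul_def transl_def norm_mult)
  have "(\<lambda>x. modul s x * transl t g x) \<in> borel_measurable borel"
    unfolding modul_def transl_def by measurable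
  moreover have "integrable lborel (\<lambda>x. norm (modul s x * transl t g x) powr p)"
    unfolding n by (rule lborel_integrable_real_affine) (use LpD(2)[OF assms] in auto)
  ultimately show "(\<lambda>x. modul s x * transl t g x) \<in> Lp p" by (rule LpI)
  show "lp_norm p (\<lambda>x. modul s x * transl t g x) = lp_norm p g"
    unfolding lp_norm_def n
    by (subst (2) lborel_integral_real_affine[where c = 1 and t = "-t"]) auto
qed

text \<open>At each point at most one summand is nonzero, so p-th powers add. The exponent 1/p, in
  place of the 1 of the triangle inequality, is what keeps both the blocks of the generator and
  their averaged errors small.\<close>

lemma lp_norm_disjoint_sum:
  assumes "finite I" "\<And>i. i \<in> I \<Longrightarrow> f i \<in> Lp p"
    and disj: "\<And>i j x. i \<in> I \<Longrightarrow> j \<in> I \<Longrightarrow> i \<noteq> j \<Longrightarrow> f i x \<noteq> 0 \<Longrightarrow> f j x = 0"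
    and "\<And>i. i \<in> I \<Longrightarrow> lp_norm p (f i) \<le> A" "0 \<le> A"
  shows "lp_norm p (\<lambda>x. \<Sum>i\<in>I. f i x) \<le> real (card I) powr (1/p) * A"
proof -
  have eq: "norm (\<Sum>i\<in>I. f i x) powr p = (\<Sum>i\<in>I. norm (f i x) powr p)" for x
  proof (cases "\<exists>i\<in>I. f i x \<noteq> 0")
    case True
    then obtain i where i: "i \<in> I" "f i x \<noteq> 0" by auto
    have "f j x = 0" if "j \<in> I - {i}" for j using disj[of i j x] that i by auto
    then show ?thesis using i assms(1) p1 by (simp add: sum.remove)
  qed (use p1 in simp)
  have "(\<integral>x. norm (\<Sum>i\<in>I. f i x) powr p \<partial>lborel) = (\<Sum>i\<in>I. \<integral>x. norm (f i x) powr p \<partial>lborel)"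
    unfolding eq by (rule Bochner_Integration.integral_sum) (use assms LpD(2) in auto)
  also have "\<dots> \<le> (\<Sum>i\<in>I. A powr p)"
    by (intro sum_mono lp_norm_leD assms)
  also have "\<dots> = (real (card I) powr (1/p) * A) powr p"
    using assms p1 by (simp add: powr_mult powr_powr)
  finally show ?thesis using assms by (intro lp_norm_leI) auto
qed

text \<open>Fatou's lemma for the p-th powers of the partial sums. Pointwise summability is assumed
  because elements of \<open>Lp\<close> are functions, whose series must have a value at every
  point.\<close>

lemma Lp_suminf:
  fixes f :: "nat \<Rightarrow> real \<Rightarrow> complex"
  assumes f: "\<And>i. f i \<in> Lp p" and s: "\<And>x. summable (\<lambda>i. f i x)"
    and S: "\<And>n. (\<Sum>i<n. lp_norm p (f i)) \<le> S"
  shows "(\<lambda>x. \<Sum>i. f i x) \<in> Lp p" "lp_norm p (\<lambda>x. \<Sum>i. f i x) \<le> S"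
proof -
  have S0: "0 \<le> S" using S[of 0] by simp
  note [measurable] = LpD(1)[OF f]
  let ?P = "\<lambda>n x. \<Sum>i<n. f i x"
  have lim: "(\<lambda>n. ennreal (norm (?P n x) powr p)) \<longlonglongrightarrow> ennreal (norm (\<Sum>i. f i x) powr p)" for x
    using summable_LIMSEQ[OF s[of x]] p1
    by (intro tendsto_ennrealI tendsto_powr2 tendsto_norm tendsto_const) auto
  have "(\<integral>\<^sup>+x. ennreal (norm (\<Sum>i. f i x) powr p) \<partial>lborel)
      = (\<integral>\<^sup>+x. liminf (\<lambda>n. ennreal (norm (?P n x) powr p)) \<partial>lborel)"
    using lim by (intro nn_integral_cong) (metis lim_imp_Liminf sequentially_bot)
  also have "\<dots> \<le> liminf (\<lambda>n. \<integral>\<^sup>+x. ennreal (norm (?P n x) powr p) \<partial>lborel)"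
    by (rule nn_integral_liminf) measurable
  also have "\<dots> \<le> ennreal (S powr p)"
  proof (rule Liminf_le, rule sequentially_bot, rule always_eventually, rule allI)
    fix n
    have P: "?P n \<in> Lp p" by (intro Lp_sum f)
    have "lp_norm p (?P n) \<le> S"
      by (rule order.trans[OF lp_norm_sum S]) (use f in auto)
    then show "(\<integral>\<^sup>+x. ennreal (norm (?P n x) powr p) \<partial>lborel) \<le> ennreal (S powr p)"
      using lp_norm_leD LpD(2)[OF P] by (subst nn_integral_eq_integral) (auto intro: ennreal_leI)
  qed
  finally have fin: "(\<integral>\<^sup>+x. ennreal (norm (\<Sum>i. f i x) powr p) \<partial>lborel) \<le> ennreal (S powr p)" .
  have int: "integrable lborel (\<lambda>x. norm (\<Sum>i. f i x) powr p)"
    by (rule integrableI_bounded) (use fin in \<open>auto intro: le_less_trans\<close>)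
  then show "(\<lambda>x. \<Sum>i. f i x) \<in> Lp p" by (intro LpI) auto
  have "ennreal (\<integral>x. norm (\<Sum>i. f i x) powr p \<partial>lborel) \<le> ennreal (S powr p)"
    using fin int by (subst (asm) nn_integral_eq_integral) auto
  then have "(\<integral>x. norm (\<Sum>i. f i x) powr p \<partial>lborel) \<le> S powr p" by (simp add: ennreal_le_iff)
  then show "lp_norm p (\<lambda>x. \<Sum>i. f i x) \<le> S" using S0 by (rule lp_norm_leI)
qed

end

section \<open>Density of dyadic step functions\<close>

lemma Lp_dominated_convergence:
  fixes f :: "real \<Rightarrow> complex" and F :: "nat \<Rightarrow> real \<Rightarrow> complex"
  assumes p1: "1 \<le> p" and w: "w \<in> Lp p"
    and [measurable]: "\<And>n. F n \<in> borel_measurable borel" "f \<in> borel_measurable borel"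
    and F: "\<And>n x. norm (F n x) \<le> norm (w x)" and f: "\<And>x. norm (f x) \<le> norm (w x)"
    and lim: "AE x in lborel. (\<lambda>n. F n x) \<longlonglongrightarrow> f x"
  shows "(\<lambda>n. lp_norm p (\<lambda>x. f x - F n x)) \<longlonglongrightarrow> 0"
proof -
  have "(\<lambda>n. \<integral>x. norm (f x - F n x) powr p \<partial>lborel) \<longlonglongrightarrow> (\<integral>x. 0 \<partial>(lborel :: real measure))"
  proof (rule integral_dominated_convergence)
    show "integrable lborel (\<lambda>x. norm (2 * w x) powr p)"
      using LpD(2)[OF Lp_cmult[OF p1 w, of 2]] by simp
    show "AE x in lborel. (\<lambda>n. norm (f x - F n x) powr p) \<longlonglongrightarrow> 0"
      using lim
    proof eventually_elim
      case (elim x)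
      have "(\<lambda>n. norm (f x - F n x) powr p) \<longlonglongrightarrow> norm (f x - f x) powr p"
        using elim p1 by (intro tendsto_powr2 tendsto_norm tendsto_diff tendsto_const) auto
      then show ?case using p1 by simp
    qed
    show "AE x in lborel. norm (norm (f x - F n x) powr p) \<le> norm (2 * w x) powr p" for n
    proof (rule AE_I2)
      fix x
      have "norm (f x - F n x) \<le> norm (2 * w x)"
        using norm_triangle_ineq4[of "f x" "F n x"] F[of n x] f[of x] by simp
      then show "norm (norm (f x - F n x) powr p) \<le> norm (2 * w x) powr p"
        using p1 by (auto intro!: powr_mono2)
    qed
  qed auto
  then have "(\<lambda>n. (\<integral>x. norm (f x - F n x) powr p \<partial>lborel) powr (1/p)) \<longlonglongrightarrow> 0 powr (1/p)"
    using p1 by (intro tendsto_powr2 tendsto_const) auto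
  then show ?thesis by (simp add: lp_norm_def)
qed

text \<open>Radial retraction onto the closed disc of radius B. It bounds continuous approximants
  uniformly and does not move limits that already lie in the disc.\<close>

definition clip :: "real \<Rightarrow> complex \<Rightarrow> complex" where
  "clip B z = z / of_real (max 1 (norm z / B))"

lemma norm_clip_le: "0 < B \<Longrightarrow> norm (clip B z) \<le> B"
  by (cases "norm z \<le> B") (auto simp: clip_def norm_divide norm_mult max_def)

lemma clip_id: "0 < B \<Longrightarrow> norm z \<le> B \<Longrightarrow> clip B z = z"
  by (simp add: clip_def max_def)

lemma continuous_clip: "0 < B \<Longrightarrow> continuous_on UNIV (clip B)"
  unfolding clip_def by (intro continuous_intros) auto

definition dyadic :: "nat \<Rightarrow> int \<Rightarrow> real set" where
  "dyadic n q = {of_int q / 2 ^ n ..< (of_int q + 1) / 2 ^ n}"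

lemma dyadic_iff: "x \<in> dyadic n q \<longleftrightarrow> \<lfloor>2 ^ n * x\<rfloor> = q"
  by (auto simp: dyadic_def field_simps floor_eq_iff)

lemma dyadic_sets [measurable]: "dyadic n q \<in> sets borel"
  by (simp add: dyadic_def)

lemma sum_dyadic_steps:
  assumes "finite Q" "\<lfloor>2 ^ n * x\<rfloor> \<in> Q"
  shows "(\<Sum>q\<in>Q. b q * indicator (dyadic n q) x :: complex) = b \<lfloor>2 ^ n * x\<rfloor>"
proof -
  have "(\<Sum>q\<in>Q. b q * indicator (dyadic n q) x) = (\<Sum>q\<in>Q. if q = \<lfloor>2 ^ n * x\<rfloor> then b q else 0)"
    by (rule sum.cong) (auto simp: indicator_def dyadic_iff)
  then show ?thesis using assms by simp
qed

lemma sum_dyadic_steps_outside: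
  assumes "\<lfloor>2 ^ n * x\<rfloor> \<notin> Q"
  shows "(\<Sum>q\<in>Q. b q * indicator (dyadic n q) x :: complex) = 0"
  using assms by (intro sum.neutral) (auto simp: indicator_def dyadic_iff)

text \<open>The step functions sample k at left endpoints; continuity gives pointwise convergence
  and B dominates. The ends -R and R are integers, so the cells of every level tile the interval
  exactly.\<close>

lemma dyadic_approx_continuous:
  fixes k :: "real \<Rightarrow> complex" and R :: nat
  assumes p1: "1 \<le> p" and cont: "continuous_on UNIV k" and B: "\<And>x. norm (k x) \<le> B" and e: "0 < e"
  shows "\<exists>n Q b. finite Q \<and>
    lp_norm p (\<lambda>x. indicator {-real R..<real R} x * k x - (\<Sum>q\<in>Q. b q * indicator (dyadic n q) x)) < e"
proof -
  define I where "I = {-real R..<real R}"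
  define Q where "Q n = {- int R * 2 ^ n ..< int R * 2 ^ n}" for n
  define b where "b n q = k (of_int q / 2 ^ n)" for n q
  define s where "s n x = (\<Sum>q\<in>Q n. b n q * indicator (dyadic n q) x)" for n x
  have I_iff: "x \<in> I \<longleftrightarrow> \<lfloor>2 ^ n * x\<rfloor> \<in> Q n" for x n
  proof -
    have "\<lfloor>2 ^ n * x\<rfloor> \<in> Q n \<longleftrightarrow> - real R * 2 ^ n \<le> 2 ^ n * x \<and> 2 ^ n * x < real R * 2 ^ n"
      unfolding Q_def atLeastLessThan_iff by (simp add: le_floor_iff floor_less_iff)
    also have "\<dots> \<longleftrightarrow> x \<in> I"
    proof -
      have "- real R * 2 ^ n = 2 ^ n * (- real R)" "real R * 2 ^ n = 2 ^ n * real R" by simp_all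
      moreover have "2 ^ n * (- real R) \<le> 2 ^ n * x \<longleftrightarrow> - real R \<le> x" "2 ^ n * x < 2 ^ n * real R \<longleftrightarrow> x < real R"
        by (rule mult_le_cancel_left_pos, simp) (rule mult_less_cancel_left_pos, simp)
      ultimately show ?thesis unfolding I_def atLeastLessThan_iff by (simp only:)
    qed
    finally show ?thesis by simp
  qed
  have s_eq: "s n x = indicator I x * k (of_int \<lfloor>2 ^ n * x\<rfloor> / 2 ^ n)" for n x
  proof (cases "x \<in> I")
    case True
    then show ?thesis using I_iff[of x n] unfolding s_def
      by (subst sum_dyadic_steps) (auto simp: Q_def b_def)
  next
    case False
    then show ?thesis using I_iff[of x n] unfolding s_def
      by (subst sum_dyadic_steps_outside) auto
  qed
  have kb[measurable]: "k \<in> borel_measurable borel" by (rule borel_measurable_continuous_onI[OF cont])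
  have Im[measurable]: "I \<in> sets borel" by (simp add: I_def)
  have B0: "0 \<le> B" using B[of 0] norm_ge_zero order.trans by blast
  have "(\<lambda>n. lp_norm p (\<lambda>x. indicator I x * k x - s n x)) \<longlonglongrightarrow> 0"
  proof (rule Lp_dominated_convergence[OF p1])
    show "(\<lambda>x. indicator I x * complex_of_real B) \<in> Lp p"
      by (rule Lp_bounded_support(1)[OF p1, where B = B and c = "-real R" and d = "real R"])
        (use B0 in \<open>auto simp: I_def indicator_def\<close>)
    show "s n \<in> borel_measurable borel" for n unfolding s_def by measurable
    show "norm (s n x) \<le> norm (indicator I x * complex_of_real B)" for n x
      using B B0 by (auto simp: s_eq indicator_def)
    show "norm (indicator I x * k x) \<le> norm (indicator I x * complex_of_real B)" for x
      using B B0 by (auto simp: indicator_def)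
    show "AE x in lborel. (\<lambda>n. s n x) \<longlonglongrightarrow> indicator I x * k x"
    proof (rule AE_I2)
      fix x :: real
      have "(\<lambda>n. of_int \<lfloor>2 ^ n * x\<rfloor> / 2 ^ n) \<longlonglongrightarrow> x"
      proof (rule real_tendsto_sandwich[of "\<lambda>n. x - 1 / 2 ^ n" _ _ "\<lambda>n. x"])
        show "\<forall>\<^sub>F n in sequentially. x - 1 / 2 ^ n \<le> of_int \<lfloor>2 ^ n * x\<rfloor> / 2 ^ n"
        proof (intro always_eventually allI)
          fix n
          have "x - 1 / 2 ^ n = (2 ^ n * x - 1) / 2 ^ n" by (simp add: field_simps)
          also have "\<dots> \<le> of_int \<lfloor>2 ^ n * x\<rfloor> / 2 ^ n" by (intro divide_right_mono) (linarith, simp)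
          finally show "x - 1 / 2 ^ n \<le> of_int \<lfloor>2 ^ n * x\<rfloor> / 2 ^ n" .
        qed
        show "\<forall>\<^sub>F n in sequentially. of_int \<lfloor>2 ^ n * x\<rfloor> / 2 ^ n \<le> x"
          by (intro always_eventually allI) (simp add: field_simps)
        have "(\<lambda>n. (1/2::real) ^ n) \<longlonglongrightarrow> 0" by (rule LIMSEQ_realpow_zero) auto
        from tendsto_diff[OF tendsto_const this]
          have "(\<lambda>n. x - (1/2::real) ^ n) \<longlonglongrightarrow> x - 0" .
        then show "(\<lambda>n. x - 1 / 2 ^ n) \<longlonglongrightarrow> x" by (simp add: power_one_over)
      qed auto
      moreover have "isCont k x" using cont by (simp add: continuous_on_eq_continuous_at)
      ultimately have "(\<lambda>n. k (of_int \<lfloor>2 ^ n * x\<rfloor> / 2 ^ n)) \<longlonglongrightarrow> k x"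
        by (rule isCont_tendsto_compose[rotated])
      then show "(\<lambda>n. s n x) \<longlonglongrightarrow> indicator I x * k x"
        unfolding s_eq by (intro tendsto_intros)
    qed
  qed auto
  then obtain n where "lp_norm p (\<lambda>x. indicator I x * k x - s n x) < e"
    using e by (metis (no_types, lifting) LIMSEQ_D lp_norm_nonneg abs_of_nonneg diff_zero order_refl real_norm_def)
  then show ?thesis unfolding I_def s_def Q_def by blast
qed

text \<open>Three approximations, each costing e/3: truncation in size and domain, passage to
  clipped continuous functions, dyadic sampling.\<close>

theorem dyadic_step_dense:
  assumes p1: "1 \<le> p" and f: "f \<in> Lp p" and e: "0 < e"
  shows "\<exists>n Q b. finite Q \<and> lp_norm p (\<lambda>x. f x - (\<Sum>q\<in>Q. b q * indicator (dyadic n q) x)) < e"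
proof -
  note [measurable] = LpD(1)[OF f]
  define F where "F n x = (if x \<in> {-real (Suc n)..<real (Suc n)} \<and> norm (f x) \<le> real (Suc n) then f x else 0)" for n x
  have "(\<lambda>n. lp_norm p (\<lambda>x. f x - F n x)) \<longlonglongrightarrow> 0"
  proof (rule Lp_dominated_convergence[OF p1 f])
    show "AE x in lborel. (\<lambda>n. F n x) \<longlonglongrightarrow> f x"
    proof (rule AE_I2)
      fix x
      obtain m where m: "norm (f x) + \<bar>x\<bar> < real m" using reals_Archimedean2 by blast
      have "F n x = f x" if "n \<ge> m" for n
      proof -
        have "real m \<le> real n" using that by simp
        then have "x \<in> {-real (Suc n)..<real (Suc n)}" "norm (f x) \<le> real (Suc n)"
          using m norm_ge_zero[of "f x"] unfolding atLeastLessThan_iff of_nat_Suc by linarith+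
        then show ?thesis by (simp add: F_def)
      qed
      then have "\<forall>\<^sub>F n in sequentially. F n x = f x" by (auto simp: eventually_sequentially)
      then show "(\<lambda>n. F n x) \<longlonglongrightarrow> f x" by (rule tendsto_eventually)
    qed
    show "F n \<in> borel_measurable borel" for n unfolding F_def by measurable
  qed (auto simp: F_def)
  then obtain n where n: "lp_norm p (\<lambda>x. f x - F n x) < e / 3"
    using e by (metis (no_types, lifting) LIMSEQ_D lp_norm_nonneg abs_of_nonneg diff_zero order_refl real_norm_def zero_less_divide_iff zero_less_numeral)
  define R where "R = Suc n"
  define I where "I = {-real R..<real R}"
  have Im[measurable]: "I \<in> sets borel" by (simp add: I_def)
  have Fm[measurable]: "F n \<in> borel_measurable borel" unfolding F_def by measurable
  have FR: "norm (F n x) \<le> real R" "x \<notin> I \<Longrightarrow> F n x = 0" for x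
    by (auto simp: F_def R_def I_def)
  have R0: "0 < real R" by (simp add: R_def)
  have FLp: "F n \<in> Lp p"
    by (rule Lp_dominated[OF _ f]) (use p1 in \<open>auto simp: F_def\<close>)
  \<comment> \<open>Continuity enters here: by its definition \<open>measurable_on\<close> supplies
    continuous functions converging to \<open>F n\<close> off a negligible set.\<close>
  have "F n measurable_on UNIV"
    by (intro lebesgue_measurable_imp_measurable_on measurable_completion) auto
  then obtain N g where N: "negligible N" and g: "\<And>m. continuous_on UNIV (g m)"
    and lim: "\<And>x. x \<notin> N \<Longrightarrow> (\<lambda>m. g m x) \<longlonglongrightarrow> F n x"
    unfolding measurable_on_def by auto
  define k where "k m x = clip R (g m x)" for m x
  have kc: "continuous_on UNIV (k m)" for m
    unfolding k_def using continuous_on_compose2[OF continuous_clip[OF R0] g] by auto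
  have [measurable]: "k m \<in> borel_measurable borel" for m
    by (rule borel_measurable_continuous_onI[OF kc])
  have kR: "norm (k m x) \<le> real R" for m x unfolding k_def by (rule norm_clip_le[OF R0])
  have "(\<lambda>m. lp_norm p (\<lambda>x. F n x - indicator I x * k m x)) \<longlonglongrightarrow> 0"
  proof (rule Lp_dominated_convergence[OF p1])
    show "(\<lambda>x. indicator I x * complex_of_real R) \<in> Lp p"
      by (rule Lp_bounded_support(1)[OF p1, where B = R and c = "-real R" and d = "real R"])
        (auto simp: I_def indicator_def)
    have "N \<in> null_sets lebesgue" using N by (simp add: negligible_iff_null_sets)
    then have ae: "AE x in lborel. x \<notin> N"
      using AE_not_in[of N lebesgue] by (simp add: AE_completion_iff)
    show "AE x in lborel. (\<lambda>m. indicator I x * k m x) \<longlonglongrightarrow> F n x"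
      using ae
    proof eventually_elim
      case (elim x)
      have "isCont (clip R) (F n x)"
        using continuous_clip[OF R0] by (simp add: continuous_on_eq_continuous_at)
      from isCont_tendsto_compose[OF this lim[OF elim]]
      have "(\<lambda>m. k m x) \<longlonglongrightarrow> F n x"
        unfolding k_def clip_id[OF R0 FR(1)] .
      then have "(\<lambda>m. indicator I x * k m x) \<longlonglongrightarrow> indicator I x * F n x"
        by (intro tendsto_intros)
      then show ?case using FR(2)[of x] by (cases "x \<in> I") auto
    qed
    show "norm (indicator I x * k m x) \<le> norm (indicator I x * complex_of_real R)" for m x
      using kR by (auto simp: indicator_def)
    show "norm (F n x) \<le> norm (indicator I x * complex_of_real R)" for x
      using FR[of x] by (cases "x \<in> I") auto
  qed auto
  then obtain m where m: "lp_norm p (\<lambda>x. F n x - indicator I x * k m x) < e / 3"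
    using e by (metis (no_types, lifting) LIMSEQ_D lp_norm_nonneg abs_of_nonneg diff_zero order_refl real_norm_def zero_less_divide_iff zero_less_numeral)
  have "\<exists>l Q b. finite Q \<and> lp_norm p (\<lambda>x. indicator I x * k m x - (\<Sum>q\<in>Q. b q * indicator (dyadic l q) x)) < e / 3"
    unfolding I_def by (rule dyadic_approx_continuous[OF p1 kc kR]) (use e in simp)
  then obtain l Q b where Q: "finite Q"
    and b: "lp_norm p (\<lambda>x. indicator I x * k m x - (\<Sum>q\<in>Q. b q * indicator (dyadic l q) x)) < e / 3"
    by blast
  let ?s = "\<lambda>x. \<Sum>q\<in>Q. b q * indicator (dyadic l q) x"
  have kL: "(\<lambda>x. indicator I x * k m x) \<in> Lp p"
    by (rule Lp_bounded_support(1)[OF p1, where B = R and c = "-real R" and d = "real R"])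
      (use kR in \<open>auto simp: I_def indicator_def\<close>)
  have sL: "?s \<in> Lp p"
  proof (intro Lp_sum[OF p1] Lp_cmult[OF p1])
    show "indicator (dyadic l q) \<in> Lp p" for q
      by (rule Lp_bounded_support(1)[OF p1, where B = 1 and c = "of_int q / 2 ^ l" and d = "(of_int q + 1) / 2 ^ l"])
        (auto simp: dyadic_def indicator_def)
  qed
  have "lp_norm p (\<lambda>x. f x - ?s x) = lp_norm p (\<lambda>x. (f x - F n x) + ((F n x - indicator I x * k m x) + (indicator I x * k m x - ?s x)))"
    by simp
  also have "\<dots> \<le> lp_norm p (\<lambda>x. f x - F n x) + (lp_norm p (\<lambda>x. F n x - indicator I x * k m x) + lp_norm p (\<lambda>x. indicator I x * k m x - ?s x))"
    by (intro order.trans[OF lp_norm_triangle[OF p1]] add_left_mono lp_norm_triangle[OF p1] Lp_add[OF p1] Lp_diff[OF p1] f FLp kL sL)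
  also have "\<dots> < e" using n m b by simp
  finally show ?thesis using Q by blast
qed

section \<open>Unconditional bounds\<close>

context
  fixes p :: real
  assumes p1: "1 \<le> p"
begin

lemma lp_norm_convex:
  assumes "u \<in> Lp p" "v \<in> Lp p" "lp_norm p u \<le> C" "lp_norm p v \<le> C" "0 \<le> a" "a \<le> (1::real)"
  shows "lp_norm p (\<lambda>x. of_real (1 - a) * u x + of_real a * v x) \<le> C"
proof -
  have "lp_norm p (\<lambda>x. of_real (1 - a) * u x + of_real a * v x)
      \<le> (1 - a) * lp_norm p u + a * lp_norm p v"
    using lp_norm_triangle[OF p1 Lp_cmult[OF p1 assms(1)] Lp_cmult[OF p1 assms(2)], of "of_real (1 - a)" "of_real a"] assms
    by (simp add: lp_norm_cmult[OF p1] del: of_real_diff)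
  also have "\<dots> \<le> (1 - a) * C + a * C"
    using assms by (intro add_mono mult_left_mono) auto
  finally show ?thesis by (simp add: algebra_simps)
qed

text \<open>The norm is convex in each coefficient separately, so a coefficient in [0, 1] can be
  moved to 0 or 1, one at a time. The offset y collects the terms whose coefficient has been moved
  to 1.\<close>

lemma lp_norm_fractional_sum_aux:
  assumes "finite F" "\<And>n. n \<in> F \<Longrightarrow> x n \<in> Lp p" "\<And>n. n \<in> F \<Longrightarrow> 0 \<le> a n \<and> a n \<le> (1::real)"
  shows "y \<in> Lp p \<Longrightarrow> (\<And>S. S \<subseteq> F \<Longrightarrow> lp_norm p (\<lambda>z. y z + (\<Sum>n\<in>S. x n z)) \<le> C) \<Longrightarrow>
    lp_norm p (\<lambda>z. y z + (\<Sum>n\<in>F. of_real (a n) * x n z)) \<le> C"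
  using assms
proof (induction F arbitrary: y rule: finite_induct)
  case empty
  show ?case using empty.prems(2)[of "{}"] by simp
next
  case (insert m F)
  let ?s = "\<lambda>z. \<Sum>n\<in>F. of_real (a n) * x n z"
  have xm: "x m \<in> Lp p" and sL: "?s \<in> Lp p"
    using insert.prems by (auto intro!: Lp_sum[OF p1] Lp_cmult[OF p1])
  have 1: "lp_norm p (\<lambda>z. y z + ?s z) \<le> C"
  proof (rule insert.IH)
    show "lp_norm p (\<lambda>z. y z + (\<Sum>n\<in>S. x n z)) \<le> C" if "S \<subseteq> F" for S
      using insert.prems(2)[of S] that by blast
  qed (use insert.prems in auto)
  have 2: "lp_norm p (\<lambda>z. (y z + x m z) + ?s z) \<le> C"
  proof (rule insert.IH)
    fix S assume S: "S \<subseteq> F"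
    then have "m \<notin> S" "finite S" using insert.hyps finite_subset by auto
    then show "lp_norm p (\<lambda>z. y z + x m z + (\<Sum>n\<in>S. x n z)) \<le> C"
      using insert.prems(2)[of "insert m S"] S by (auto simp: add.assoc)
  qed (use insert.prems xm in \<open>auto intro: Lp_add[OF p1]\<close>)
  have "lp_norm p (\<lambda>z. of_real (1 - a m) * (y z + ?s z) + of_real (a m) * ((y z + x m z) + ?s z)) \<le> C"
    by (rule lp_norm_convex[OF _ _ 1 2]) (use insert.prems xm sL in \<open>auto intro!: Lp_add[OF p1]\<close>)
  also have "(\<lambda>z. of_real (1 - a m) * (y z + ?s z) + of_real (a m) * ((y z + x m z) + ?s z))
      = (\<lambda>z. y z + (\<Sum>n\<in>insert m F. of_real (a n) * x n z))"
    using insert.hyps by (auto simp: algebra_simps fun_eq_iff)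
  finally show ?case .
qed

lemma lp_norm_fractional_sum:
  assumes "finite F" "\<And>n. n \<in> F \<Longrightarrow> x n \<in> Lp p" "\<And>n. n \<in> F \<Longrightarrow> 0 \<le> a n \<and> a n \<le> (1::real)"
    and "\<And>S. S \<subseteq> F \<Longrightarrow> lp_norm p (\<lambda>z. \<Sum>n\<in>S. x n z) \<le> C"
  shows "lp_norm p (\<lambda>z. \<Sum>n\<in>F. of_real (a n) * x n z) \<le> C"
  using lp_norm_fractional_sum_aux[OF assms(1-3), where y = "\<lambda>_. 0" and C = C] assms(4) Lp_zero[OF p1]
  by simp

text \<open>The factor 4 counts the positive and negative parts of the real and imaginary parts of
  \<open>\<theta> n\<close>, each a coefficient in [0, 1].\<close>

lemma lp_norm_unimodular_sum:
  assumes F: "finite F" "\<And>n. n \<in> F \<Longrightarrow> x n \<in> Lp p" "\<And>n. n \<in> F \<Longrightarrow> norm (\<theta> n) \<le> 1"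
    and C: "\<And>S. S \<subseteq> F \<Longrightarrow> lp_norm p (\<lambda>z. \<Sum>n\<in>S. x n z) \<le> C"
  shows "lp_norm p (\<lambda>z. \<Sum>n\<in>F. \<theta> n * x n z) \<le> 4 * C"
proof -
  let ?S = "\<lambda>a z. \<Sum>n\<in>F. of_real (a n) * x n z"
  define a b c d where "a n = max 0 (Re (\<theta> n))" and "b n = max 0 (- Re (\<theta> n))"
    and "c n = max 0 (Im (\<theta> n))" and "d n = max 0 (- Im (\<theta> n))" for n
  have bd: "0 \<le> a n \<and> a n \<le> 1" "0 \<le> b n \<and> b n \<le> 1" "0 \<le> c n \<and> c n \<le> 1" "0 \<le> d n \<and> d n \<le> 1" if "n \<in> F" for n
    using F(3)[OF that] abs_Re_le_cmod[of "\<theta> n"] abs_Im_le_cmod[of "\<theta> n"]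
    unfolding a_def b_def c_def d_def by linarith+
  have L: "?S a \<in> Lp p" for a
    by (intro Lp_sum[OF p1] Lp_cmult[OF p1] F)
  have B: "lp_norm p (?S a) \<le> C" "lp_norm p (?S b) \<le> C" "lp_norm p (?S c) \<le> C" "lp_norm p (?S d) \<le> C"
    by (rule lp_norm_fractional_sum[OF F(1,2) bd(1) C], assumption+)
      (rule lp_norm_fractional_sum[OF F(1,2) bd(2) C], assumption+,
       rule lp_norm_fractional_sum[OF F(1,2) bd(3) C], assumption+,
       rule lp_norm_fractional_sum[OF F(1,2) bd(4) C], assumption+)
  have eq: "\<theta> n = of_real (a n) - of_real (b n) + \<i> * (of_real (c n) - of_real (d n))" for n
    by (auto simp: complex_eq_iff a_def b_def c_def d_def max_def)
  have "\<theta> n * x n z = (of_real (a n) * x n z - of_real (b n) * x n z) + \<i> * (of_real (c n) * x n z - of_real (d n) * x n z)" for n z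
    unfolding eq[of n] by (simp only: algebra_simps)
  then have "(\<Sum>n\<in>F. \<theta> n * x n z) = (?S a z - ?S b z) + \<i> * (?S c z - ?S d z)" for z
    by (simp only: sum.distrib sum_subtractf flip: sum_distrib_left)
  then have "lp_norm p (\<lambda>z. \<Sum>n\<in>F. \<theta> n * x n z) = lp_norm p (\<lambda>z. (?S a z - ?S b z) + \<i> * (?S c z - ?S d z))"
    by presburger
  also have "\<dots> \<le> lp_norm p (\<lambda>z. ?S a z - ?S b z) + lp_norm p (\<lambda>z. \<i> * (?S c z - ?S d z))"
    by (intro lp_norm_triangle[OF p1] Lp_cmult[OF p1] Lp_diff[OF p1] L)
  also have "\<dots> = lp_norm p (\<lambda>z. ?S a z - ?S b z) + lp_norm p (\<lambda>z. ?S c z - ?S d z)"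
    by (simp add: lp_norm_cmult[OF p1])
  also have "\<dots> \<le> (lp_norm p (?S a) + lp_norm p (?S b)) + (lp_norm p (?S c) + lp_norm p (?S d))"
    by (intro add_mono lp_norm_triangle_diff[OF p1] L)
  also have "\<dots> \<le> 4 * C" using B by linarith
  finally show ?thesis .
qed

lemma frame_approx:
  assumes fr: "uncond_schauder_frame p N u us" and f: "f \<in> Lp p" and e: "0 < e"
  obtains F0 where "finite F0" "F0 \<subseteq> N"
    "\<And>F. finite F \<Longrightarrow> F0 \<subseteq> F \<Longrightarrow> F \<subseteq> N \<Longrightarrow> lp_norm p (\<lambda>y. f y - (\<Sum>n\<in>F. us n f * u n y)) < e"
proof -
  have "\<forall>x\<in>Lp p. \<forall>\<epsilon>>0. \<exists>F0. finite F0 \<and> F0 \<subseteq> N \<and> (\<forall>F. finite F \<and> F0 \<subseteq> F \<and> F \<subseteq> N \<longrightarrow>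
      lp_norm p (\<lambda>y. x y - (\<Sum>n\<in>F. us n x * u n y)) < \<epsilon>)"
    using fr unfolding uncond_schauder_frame_def by (elim conjE)
  from bspec[OF this f, THEN spec, THEN mp, OF e] obtain F0 where F0: "finite F0" "F0 \<subseteq> N"
    and ap: "\<forall>F. finite F \<and> F0 \<subseteq> F \<and> F \<subseteq> N \<longrightarrow> lp_norm p (\<lambda>y. f y - (\<Sum>n\<in>F. us n f * u n y)) < e"
    by (elim exE conjE)
  show ?thesis
    by (rule that[OF F0]) (rule ap[THEN spec, THEN mp], intro conjI)
qed

text \<open>The sum over S is the sum over the union of S and F0, which lies within 1 of f, minus a
  subsum over the fixed finite set F0.\<close>

lemma frame_partial_sums_bounded:
  assumes fr: "uncond_schauder_frame p N u us" and f: "f \<in> Lp p"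
  obtains C where "\<And>S. finite S \<Longrightarrow> S \<subseteq> N \<Longrightarrow> lp_norm p (\<lambda>y. \<Sum>n\<in>S. us n f * u n y) \<le> C"
proof -
  have u: "u n \<in> Lp p" if "n \<in> N" for n
    using fr that by (auto simp: uncond_schauder_frame_def)
  obtain F0 where F0: "finite F0" "F0 \<subseteq> N" and
    ap: "\<And>F. finite F \<Longrightarrow> F0 \<subseteq> F \<Longrightarrow> F \<subseteq> N \<Longrightarrow> lp_norm p (\<lambda>y. f y - (\<Sum>n\<in>F. us n f * u n y)) < 1"
    by (rule frame_approx[OF fr f zero_less_one], rule that)
  define C where "C = lp_norm p f + 1 + (\<Sum>n\<in>F0. lp_norm p (\<lambda>y. us n f * u n y))"
  have "lp_norm p (\<lambda>y. \<Sum>n\<in>S. us n f * u n y) \<le> C" if S: "finite S" "S \<subseteq> N" for S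
  proof -
    let ?s = "\<lambda>A y. \<Sum>n\<in>A. us n f * u n y"
    have L: "?s A \<in> Lp p" if "A \<subseteq> N" for A
      using that by (intro Lp_sum[OF p1] Lp_cmult[OF p1] u) auto
    have "?s (S \<union> F0) y = ?s S y + ?s (F0 - S) y" for y
      using S F0 by (subst sum.union_disjoint[symmetric]) (auto intro!: sum.cong)
    then have "lp_norm p (?s S) = lp_norm p (\<lambda>y. ?s (S \<union> F0) y - ?s (F0 - S) y)" by simp
    also have "\<dots> \<le> lp_norm p (?s (S \<union> F0)) + lp_norm p (?s (F0 - S))"
      using S F0 by (intro lp_norm_triangle_diff[OF p1] L) auto
    also have "lp_norm p (?s (S \<union> F0)) \<le> lp_norm p f + lp_norm p (\<lambda>y. ?s (S \<union> F0) y - f y)"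
      using S F0 by (intro lp_norm_triangle_sub[OF p1] L f) auto
    also have "lp_norm p (\<lambda>y. ?s (S \<union> F0) y - f y) < 1"
      using ap[of "S \<union> F0"] S F0 by (subst lp_norm_minus_commute[OF p1]) auto
    also have "lp_norm p (?s (F0 - S)) \<le> (\<Sum>n\<in>F0 - S. lp_norm p (\<lambda>y. us n f * u n y))"
      using F0 by (intro lp_norm_sum[OF p1] Lp_cmult[OF p1] u) auto
    also have "\<dots> \<le> (\<Sum>n\<in>F0. lp_norm p (\<lambda>y. us n f * u n y))"
      using F0 by (intro sum_mono2) auto
    finally show ?thesis by (simp add: C_def)
  qed
  then show ?thesis by (rule that)
qed

end

section \<open>Local square integrability\<close>

lemma interval_cauchy_schwarz:
  fixes w :: "real \<Rightarrow> complex"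
  assumes cd: "c \<le> d" and i1: "integrable lborel (\<lambda>x. indicator {c..d} x * w x)"
    and i2: "integrable lborel (\<lambda>x. indicator {c..d} x * (norm (w x))\<^sup>2)"
  shows "(norm (\<integral>x. indicator {c..d} x * w x \<partial>lborel))\<^sup>2 \<le> (d - c) * (\<integral>x. indicator {c..d} x * (norm (w x))\<^sup>2 \<partial>lborel)"
proof -
  let ?I = "\<integral>x. norm (indicator {c..d} x * w x) \<partial>lborel" and ?J = "\<integral>x. indicator {c..d} x * (norm (w x))\<^sup>2 \<partial>lborel"
  have J0: "0 \<le> ?J" by (intro integral_nonneg_AE) auto
  \<comment> \<open>Integration of (|w| - m)^2 \<ge> 0. The best m is the mean
    \<open>?I / (d - c)\<close>, available once the interval is nondegenerate.\<close>
  have quad: "2 * m * ?I \<le> ?J + m\<^sup>2 * (d - c)" for m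
  proof -
    have "2 * m * ?I = (\<integral>x. 2 * m * norm (indicator {c..d} x * w x) \<partial>lborel)" by simp
    also have "\<dots> \<le> (\<integral>x. indicator {c..d} x * (norm (w x))\<^sup>2 + m\<^sup>2 * indicator {c..d} x \<partial>lborel)"
    proof (rule integral_mono)
      show "2 * m * norm (indicator {c..d} x * w x) \<le> indicator {c..d} x * (norm (w x))\<^sup>2 + m\<^sup>2 * indicator {c..d} x" for x
        using sum_squares_bound[of m "norm (w x)"] by (auto simp: indicator_def)
    qed (use i1 i2 in auto)
    also have "\<dots> = ?J + m\<^sup>2 * (d - c)"
      using i2 cd by simp
    finally show ?thesis .
  qed
  have "?I\<^sup>2 \<le> (d - c) * ?J"
  proof (cases "c = d")
    case True
    have "AE x in lborel. indicator {c..d} x * w x = 0"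
      using AE_lborel_singleton[of c] by eventually_elim (auto simp: True)
    then have "?I = (\<integral>x. 0 \<partial>(lborel :: real measure))"
      using i1 by (intro integral_cong_AE) auto
    then show ?thesis using True by simp
  next
    case False
    then have "0 < d - c" using cd by simp
    have "(?I / (d - c))\<^sup>2 * (d - c) = ?I * ?I / (d - c)" "2 * (?I / (d - c)) * ?I = 2 * (?I * ?I / (d - c))"
      using False by (simp_all add: power2_eq_square)
    then have "?I * ?I / (d - c) \<le> ?J" using quad[of "?I / (d - c)"] by linarith
    then show ?thesis using \<open>0 < d - c\<close> by (simp add: pos_divide_le_eq power2_eq_square mult.commute)
  qed
  moreover have "norm (\<integral>x. indicator {c..d} x * w x \<partial>lborel) \<le> ?I"
    by (rule integral_norm_bound)
  ultimately show ?thesis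
    by (meson norm_ge_zero order.trans power_mono)
qed

definition energy :: "real \<Rightarrow> real \<Rightarrow> (real \<Rightarrow> complex) \<Rightarrow> real" where
  "energy c d v = (\<integral>x. indicator {c..d} x * (norm (v x))\<^sup>2 \<partial>lborel)"

lemma energy_nonneg [simp]: "0 \<le> energy c d v"
  unfolding energy_def by (intro integral_nonneg_AE) auto

context
  fixes p :: real
  assumes p2: "2 \<le> p"
begin

text \<open>A small value is charged to the constant, a large one to its p-th power, which uses 2
  \<le> p. With e = 1 this gives local square integrability; a small e makes the constant part
  negligible.\<close>

lemma square_le_powr:
  assumes "0 < e" "0 \<le> (a::real)"
  shows "a\<^sup>2 \<le> e\<^sup>2 + e powr (2 - p) * a powr p"
proof (cases "a \<le> e")
  case True
  then have "a\<^sup>2 \<le> e\<^sup>2" using assms by (intro power_mono) auto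
  then show ?thesis by (auto intro: add_increasing2)
next
  case False
  then have a: "0 < a" "e < a" using assms by auto
  have "a\<^sup>2 = a powr (2 - p) * a powr p"
    using a by (simp add: powr_add[symmetric])
  also have "\<dots> \<le> e powr (2 - p) * a powr p"
    using a assms p2 by (intro mult_right_mono powr_mono2') auto
  finally show ?thesis by (auto intro: add_increasing)
qed

lemma energy_integrable:
  assumes "v \<in> Lp p"
  shows "integrable lborel (\<lambda>x. indicator {c..d} x * (norm (v x))\<^sup>2)"
proof (rule Bochner_Integration.integrable_bound)
  show "integrable lborel (\<lambda>x. indicator {c..d} x + norm (v x) powr p)"
    by (intro Bochner_Integration.integrable_add integrable_indicator_Icc LpD(2)[OF assms])
  show "AE x in lborel. norm (indicator {c..d} x * (norm (v x))\<^sup>2) \<le> norm (indicator {c..d} x + norm (v x) powr p)"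
    using square_le_powr[of 1 "norm (v x)" for x] by (auto simp: indicator_def)
qed (use LpD(1)[OF assms] in auto)

lemma energy_le:
  assumes v: "v \<in> Lp p" and "c \<le> d" "0 < e"
  shows "energy c d v \<le> e\<^sup>2 * (d - c) + e powr (2 - p) * (\<integral>x. indicator {c..d} x * norm (v x) powr p \<partial>lborel)"
proof -
  have i: "integrable lborel (\<lambda>x. indicator {c..d} x * norm (v x) powr p)"
    by (rule Bochner_Integration.integrable_bound[OF LpD(2)[OF v]]) (use LpD(1)[OF v] in \<open>auto simp: indicator_def\<close>)
  have "energy c d v \<le> (\<integral>x. e\<^sup>2 * indicator {c..d} x + e powr (2 - p) * (indicator {c..d} x * norm (v x) powr p) \<partial>lborel)"
    unfolding energy_def
  proof (rule integral_mono[OF energy_integrable[OF v]])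
    show "indicator {c..d} x * (norm (v x))\<^sup>2 \<le> e\<^sup>2 * indicator {c..d} x + e powr (2 - p) * (indicator {c..d} x * norm (v x) powr p)" for x
      using square_le_powr[of e "norm (v x)"] assms by (auto simp: indicator_def)
  qed (use i in auto)
  also have "\<dots> = e\<^sup>2 * (d - c) + e powr (2 - p) * (\<integral>x. indicator {c..d} x * norm (v x) powr p \<partial>lborel)"
    using i assms by simp
  finally show ?thesis .
qed

lemma energy_le_lp_norm:
  assumes v: "v \<in> Lp p" and "c \<le> d" "lp_norm p v \<le> C"
  shows "energy c d v \<le> (d - c) + C powr p"
proof -
  have "(\<integral>x. indicator {c..d} x * norm (v x) powr p \<partial>lborel) \<le> (\<integral>x. norm (v x) powr p \<partial>lborel)"
    by (rule integral_mono[OF Bochner_Integration.integrable_bound[OF LpD(2)[OF v]] LpD(2)[OF v]])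
      (use LpD(1)[OF v] in \<open>auto simp: indicator_def\<close>)
  also have "\<dots> \<le> C powr p" using lp_norm_leD[of p v C] p2 assms by simp
  finally show ?thesis using energy_le[OF v \<open>c \<le> d\<close>, of 1] by simp
qed

lemma energy_parallelogram:
  assumes "u \<in> Lp p" "v \<in> Lp p"
  shows "energy c d (\<lambda>x. u x + v x) + energy c d (\<lambda>x. u x - v x) = 2 * energy c d u + 2 * energy c d v"
proof -
  have p1: "1 \<le> p" using p2 by simp
  note e = energy_integrable
  have "energy c d (\<lambda>x. u x + v x) + energy c d (\<lambda>x. u x - v x)
     = (\<integral>x. indicator {c..d} x * (norm (u x + v x))\<^sup>2 + indicator {c..d} x * (norm (u x - v x))\<^sup>2 \<partial>lborel)"
    unfolding energy_def
    by (rule Bochner_Integration.integral_add[symmetric])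
      (intro e Lp_add[OF p1] Lp_diff[OF p1] assms)+
  also have "\<dots> = (\<integral>x. 2 * (indicator {c..d} x * (norm (u x))\<^sup>2) + 2 * (indicator {c..d} x * (norm (v x))\<^sup>2) \<partial>lborel)"
  proof (rule Bochner_Integration.integral_cong)
    have "(norm (u x + v x))\<^sup>2 + (norm (u x - v x))\<^sup>2 = 2 * (norm (u x))\<^sup>2 + 2 * (norm (v x))\<^sup>2" for x
      unfolding cmod_power2 by (simp add: power2_eq_square algebra_simps)
    then show "indicator {c..d} x * (norm (u x + v x))\<^sup>2 + indicator {c..d} x * (norm (u x - v x))\<^sup>2
        = 2 * (indicator {c..d} x * (norm (u x))\<^sup>2) + 2 * (indicator {c..d} x * (norm (v x))\<^sup>2)" for x
      by (auto simp: indicator_def)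
  qed simp
  also have "\<dots> = 2 * energy c d u + 2 * energy c d v"
    unfolding energy_def using e[OF assms(1)] e[OF assms(2)] by simp
  finally show ?thesis .
qed

text \<open>In place of an average over random signs, the signs are fixed one by one: by the
  parallelogram law one of u + v and u - v has at least the energy of u plus that of v.\<close>

lemma exists_signs_energy:
  assumes "finite J" "\<And>j. j \<in> J \<Longrightarrow> D j \<in> Lp p"
  shows "\<exists>\<epsilon>. (\<forall>j. \<epsilon> j \<in> {1, -1 :: real}) \<and>
    (\<Sum>j\<in>J. energy c d (D j)) \<le> energy c d (\<lambda>x. \<Sum>j\<in>J. of_real (\<epsilon> j) * D j x)"
  using assms
proof (induction J rule: finite_induct)
  case empty
  show ?case by (rule exI[of _ "\<lambda>_. 1"]) simp
next
  case (insert m J)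
  have p1: "1 \<le> p" using p2 by simp
  obtain \<epsilon> where \<epsilon>: "\<forall>j. \<epsilon> j \<in> {1, -1 :: real}"
    "(\<Sum>j\<in>J. energy c d (D j)) \<le> energy c d (\<lambda>x. \<Sum>j\<in>J. of_real (\<epsilon> j) * D j x)"
    using insert by auto
  let ?s = "\<lambda>x. \<Sum>j\<in>J. of_real (\<epsilon> j) * D j x"
  have sL: "?s \<in> Lp p" by (intro Lp_sum[OF p1] Lp_cmult[OF p1] insert.prems) auto
  have eq: "(\<Sum>j\<in>insert m J. of_real ((\<epsilon>(m := t)) j) * D j x) = of_real t * D m x + ?s x" for t x
    using insert.hyps by (auto intro!: sum.cong)
  have neg: "energy c d (\<lambda>x. - D m x + ?s x) = energy c d (\<lambda>x. D m x - ?s x)"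
  proof -
    have "norm (- D m x + ?s x) = norm (D m x - ?s x)" for x
      using norm_minus_commute[of "?s x" "D m x"] by simp
    then show ?thesis by (simp add: energy_def)
  qed
  have "energy c d (D m) + energy c d ?s \<le> energy c d (\<lambda>x. D m x + ?s x) \<or>
    energy c d (D m) + energy c d ?s \<le> energy c d (\<lambda>x. D m x - ?s x)"
    using energy_parallelogram[OF insert.prems sL, of m c d] by auto
  then obtain t where t: "t \<in> {1, -1 :: real}"
    "energy c d (D m) + energy c d ?s \<le> energy c d (\<lambda>x. of_real t * D m x + ?s x)"
  proof (elim disjE)
    assume "energy c d (D m) + energy c d ?s \<le> energy c d (\<lambda>x. D m x + ?s x)"
    then show ?thesis by (intro that[of 1]) auto
  next
    assume "energy c d (D m) + energy c d ?s \<le> energy c d (\<lambda>x. D m x - ?s x)"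
    then show ?thesis using neg by (intro that[of "-1"]) auto
  qed
  show ?case
    by (rule exI[of _ "\<epsilon>(m := t)"], subst eq) (use t \<epsilon> insert.hyps in auto)
qed

end

section \<open>Frames in a vertical strip\<close>

abbreviation gabor :: "(real \<Rightarrow> complex) \<Rightarrow> real \<times> real \<Rightarrow> real \<Rightarrow> complex" where
  "gabor g \<equiv> (\<lambda>(t, s) x. modul s x * transl t g x)"

lemma norm_modul [simp]: "norm (modul s x) = 1"
  by (simp add: modul_def)

lemma modul_add: "modul (s + r) x = modul s x * modul r x"
  by (simp add: modul_def algebra_simps flip: exp_add)

lemma modul_shift: "modul s (x + y) = modul s x * modul s y"
  by (simp add: modul_def algebra_simps flip: exp_add)

lemma modul_cnj: "cnj (modul s x) = modul (- s) x"
  by (simp add: modul_def exp_cnj)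

lemma modul_0 [simp]: "modul 0 x = 1"
  by (simp add: modul_def)

lemma modul_measurable [measurable]: "modul s \<in> borel_measurable borel"
  unfolding modul_def by measurable

lemma cnj_measurable [measurable]: "cnj \<in> borel_measurable borel"
  by (intro borel_measurable_continuous_onI continuous_intros)

subsection \<open>Bessel's inequality on unit intervals\<close>

lemma integral_modul_unit:
  fixes k :: int
  shows "(\<integral>x. indicator {c..c+1} x * modul (of_int k) x \<partial>lborel) = (if k = 0 then 1 else 0)"
proof (cases "k = 0")
  case True
  then show ?thesis
    using integral_complex_of_real[of lborel "indicator {c..c+1}"] by (simp add: of_real_indicator)
next
  case False
  define z where "z = 2 * pi * \<i> * of_int k"
  have z: "z \<noteq> 0" using False by (simp add: z_def)
  have m: "modul (of_int k) x = exp (z * of_real x)" for x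
    by (simp add: modul_def z_def algebra_simps)
  have "(\<integral>x. indicator {c..c+1} x *\<^sub>R modul (of_int k) x \<partial>lborel) = exp (z * of_real (c+1)) / z - exp (z * of_real c) / z"
  proof (rule integral_FTC_Icc)
    show "((\<lambda>x. exp (z * complex_of_real x) / z) has_vector_derivative modul (of_int k) x) (at x within {c..c + 1})" for x
    proof -
      have "((\<lambda>w. exp (z * w) / z) has_field_derivative exp (z * of_real x)) (at (of_real x))"
        using z by (auto intro!: derivative_eq_intros)
      from has_vector_derivative_real_field[OF this] show ?thesis unfolding m .
    qed
    show "continuous_on {c..c+1} (modul (of_int k))"
      unfolding modul_def by (intro continuous_intros)
  qed simp
  also have "exp (z * of_real (c+1)) = exp (z * of_real c)"
  proof -
    have "exp (z * of_real (c+1)) = exp (z * of_real c) * exp z" by (simp add: algebra_simps flip: exp_add)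
    also have "exp z = 1" using exp_integer_2pi[of "of_int k"] by (simp add: z_def algebra_simps)
    finally show ?thesis by simp
  qed
  finally show ?thesis using False by (simp add: scaleR_conv_of_real of_real_indicator)
qed

lemma bessel_unit_interval:
  fixes w :: "real \<Rightarrow> complex" and J :: "int set"
  assumes J: "finite J" and [measurable]: "w \<in> borel_measurable borel"
    and i2: "integrable lborel (\<lambda>x. indicator {c..c+1} x * (norm (w x))\<^sup>2)"
  shows "(\<Sum>j\<in>J. (norm (\<integral>x. indicator {c..c+1} x * (modul (of_int j) x * w x) \<partial>lborel))\<^sup>2) \<le> energy c (c+1) w"
proof -
  define I :: "real \<Rightarrow> complex" where "I = indicator {c..c+1}"
  have I[measurable]: "I \<in> borel_measurable borel" by (simp add: I_def)
  have Isq: "I x * I x = I x" for x by (simp add: I_def indicator_def)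
  define e where "e j = modul (of_int j)" for j :: int
  have e[measurable]: "e j \<in> borel_measurable borel" and en: "norm (e j x) = 1" for j x
    by (auto simp: e_def)
  define a where "a j = (\<integral>x. I x * (e j x * w x) \<partial>lborel)" for j
  \<comment> \<open>The coefficients pair w with \<open>e j\<close> itself, so the projection runs
    over the conjugates of the \<open>e j\<close>. Bessel's inequality is then nonnegativity of the
    energy of w - S.\<close>
  define S where "S x = (\<Sum>j\<in>J. a j * cnj (e j x))" for x
  have iw: "integrable lborel (\<lambda>x. I x * (e j x * w x))" for j
  proof (rule Bochner_Integration.integrable_bound)
    show "integrable lborel (\<lambda>x. indicator {c..c+1} x + indicator {c..c+1} x * (norm (w x))\<^sup>2)"
      using i2 by (intro Bochner_Integration.integrable_add) auto
    have "a \<le> 1 + a\<^sup>2" for a :: real using sum_squares_bound[of a 1] by (simp add: power2_eq_square) (smt (verit) zero_le_square)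
    then show "AE x in lborel. norm (I x * (e j x * w x)) \<le> norm (indicator {c..c+1} x + indicator {c..c+1} x * (norm (w x))\<^sup>2)"
      by (auto simp: I_def indicator_def norm_mult en)
  qed measurable
  have iww: "integrable lborel (\<lambda>x. I x * (w x * cnj (w x)))"
  proof -
    have "integrable lborel (\<lambda>x. complex_of_real (indicator {c..c+1} x * (norm (w x))\<^sup>2))"
      using i2 by (rule integrable_of_real)
    also have "(\<lambda>x. complex_of_real (indicator {c..c+1} x * (norm (w x))\<^sup>2)) = (\<lambda>x. I x * (w x * cnj (w x)))"
      by (simp add: I_def indicator_def fun_eq_iff flip: complex_norm_square)
    finally show ?thesis .
  qed
  have icw: "integrable lborel (\<lambda>x. I x * (cnj (e j x) * cnj (w x)))" 
    "(\<integral>x. I x * (cnj (e j x) * cnj (w x)) \<partial>lborel) = cnj (a j)" for j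
  proof -
    have eq: "(\<lambda>x. I x * (cnj (e j x) * cnj (w x))) = (\<lambda>x. cnj (I x * (e j x * w x)))"
      by (auto simp: I_def indicator_def)
    show "integrable lborel (\<lambda>x. I x * (cnj (e j x) * cnj (w x)))"
      unfolding eq by (rule integrable_bounded_linear[OF bounded_linear_cnj iw])
    show "(\<integral>x. I x * (cnj (e j x) * cnj (w x)) \<partial>lborel) = cnj (a j)"
      unfolding eq a_def by (rule Bochner_Integration.integral_cnj)
  qed
  have ee: "cnj (e j x) * e k x = modul (of_int (k - j)) x" for j k x
    unfolding e_def by (simp add: modul_cnj flip: modul_add)
  have iee: "integrable lborel (\<lambda>x. I x * (cnj (e j x) * e k x))" for j k
    by (rule Bochner_Integration.integrable_bound[OF integrable_indicator_Icc[of c "c+1"]])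
      (measurable, auto simp: I_def indicator_def norm_mult en)
  have vee: "(\<integral>x. I x * (cnj (e j x) * e k x) \<partial>lborel) = (if j = k then 1 else 0)" for j k
    unfolding ee I_def by (subst integral_modul_unit) auto
  have expand: "I x * ((w x - S x) * cnj (w x - S x))
    = I x * (w x * cnj (w x)) - (\<Sum>j\<in>J. a j * (I x * (cnj (e j x) * cnj (w x))))
      - (\<Sum>j\<in>J. cnj (a j) * (I x * (e j x * w x)))
      + (\<Sum>j\<in>J. \<Sum>k\<in>J. (a j * cnj (a k)) * (I x * (cnj (e j x) * e k x)))" for x
  proof -
    have 1: "(\<Sum>j\<in>J. a j * (I x * (cnj (e j x) * cnj (w x)))) = I x * (S x * cnj (w x))"
      unfolding S_def sum_distrib_left sum_distrib_right by (intro sum.cong refl) (simp add: mult_ac)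
    have 2: "(\<Sum>j\<in>J. cnj (a j) * (I x * (e j x * w x))) = I x * (w x * cnj (S x))"
      unfolding S_def cnj_sum sum_distrib_left sum_distrib_right by (intro sum.cong refl) (simp add: mult_ac)
    have 3: "(\<Sum>j\<in>J. \<Sum>k\<in>J. (a j * cnj (a k)) * (I x * (cnj (e j x) * e k x))) = I x * (S x * cnj (S x))"
    proof -
      have "S x * cnj (S x) = (\<Sum>j\<in>J. \<Sum>k\<in>J. (a j * cnj (e j x)) * (cnj (a k) * e k x))"
        unfolding S_def by (simp add: sum_product)
      then show ?thesis by (simp add: sum_distrib_left mult_ac)
    qed
    show ?thesis unfolding 1 2 3 by (simp add: algebra_simps)
  qed
  have "(\<integral>x. I x * ((w x - S x) * cnj (w x - S x)) \<partial>lborel)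
    = (\<integral>x. I x * (w x * cnj (w x)) \<partial>lborel) - (\<Sum>j\<in>J. a j * cnj (a j)) - (\<Sum>j\<in>J. cnj (a j) * a j)
      + (\<Sum>j\<in>J. \<Sum>k\<in>J. (a j * cnj (a k)) * (if j = k then 1 else 0))"
  proof -
    have i: "integrable lborel (\<lambda>x. \<Sum>j\<in>J. a j * (I x * (cnj (e j x) * cnj (w x))))"
      "integrable lborel (\<lambda>x. \<Sum>j\<in>J. cnj (a j) * (I x * (e j x * w x)))"
      "integrable lborel (\<lambda>x. \<Sum>j\<in>J. \<Sum>k\<in>J. (a j * cnj (a k)) * (I x * (cnj (e j x) * e k x)))"
      by (intro Bochner_Integration.integrable_sum integrable_mult_right icw iw iee)+
    have v: "(\<integral>x. (\<Sum>j\<in>J. a j * (I x * (cnj (e j x) * cnj (w x)))) \<partial>lborel) = (\<Sum>j\<in>J. a j * cnj (a j))"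
      "(\<integral>x. (\<Sum>j\<in>J. cnj (a j) * (I x * (e j x * w x))) \<partial>lborel) = (\<Sum>j\<in>J. cnj (a j) * a j)"
      "(\<integral>x. (\<Sum>j\<in>J. \<Sum>k\<in>J. (a j * cnj (a k)) * (I x * (cnj (e j x) * e k x))) \<partial>lborel)
        = (\<Sum>j\<in>J. \<Sum>k\<in>J. (a j * cnj (a k)) * (if j = k then 1 else 0))"
      by (subst Bochner_Integration.integral_sum, intro integrable_mult_right icw iw Bochner_Integration.integrable_sum iee,
          simp only: integral_mult_right_zero icw(2) a_def)
        (subst Bochner_Integration.integral_sum, intro integrable_mult_right icw iw Bochner_Integration.integrable_sum iee,
          simp only: integral_mult_right_zero icw(2) a_def,
         subst Bochner_Integration.integral_sum, intro integrable_mult_right icw iw Bochner_Integration.integrable_sum iee,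
          intro sum.cong refl, subst Bochner_Integration.integral_sum, intro integrable_mult_right iee,
          simp only: integral_mult_right_zero vee)
    show ?thesis
      unfolding expand
      by (subst Bochner_Integration.integral_add, intro Bochner_Integration.integrable_diff iww i, rule i,
          subst Bochner_Integration.integral_diff, intro Bochner_Integration.integrable_diff iww i, rule i,
          subst Bochner_Integration.integral_diff, rule iww, rule i, simp only: v)
  qed
  also have "\<dots> = (\<integral>x. I x * (w x * cnj (w x)) \<partial>lborel) - (\<Sum>j\<in>J. a j * cnj (a j))"
    using J by (simp add: if_distrib sum.delta mult.commute cong: if_cong)
  finally have key: "(\<integral>x. I x * ((w x - S x) * cnj (w x - S x)) \<partial>lborel)
    = (\<integral>x. I x * (w x * cnj (w x)) \<partial>lborel) - (\<Sum>j\<in>J. a j * cnj (a j))" .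
  have sq: "(\<integral>x. I x * (v x * cnj (v x)) \<partial>lborel) = of_real (energy c (c+1) v)" for v
    unfolding energy_def I_def
    by (subst integral_complex_of_real[symmetric])
      (rule Bochner_Integration.integral_cong, simp_all add: indicator_def flip: complex_norm_square)
  have "(\<Sum>j\<in>J. a j * cnj (a j)) = of_real (\<Sum>j\<in>J. (norm (a j))\<^sup>2)"
    by (simp flip: complex_norm_square)
  with key have "complex_of_real (energy c (c+1) (\<lambda>x. w x - S x)) = of_real (energy c (c+1) w - (\<Sum>j\<in>J. (norm (a j))\<^sup>2))"
    using sq[of "\<lambda>x. w x - S x"] sq[of w] by simp
  then have "energy c (c+1) (\<lambda>x. w x - S x) = energy c (c+1) w - (\<Sum>j\<in>J. (norm (a j))\<^sup>2)"
    by (simp only: of_real_eq_iff)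
  then have "(\<Sum>j\<in>J. (norm (a j))\<^sup>2) \<le> energy c (c+1) w"
    using energy_nonneg[of c "c+1" "\<lambda>x. w x - S x"] by linarith
  then show ?thesis by (simp add: a_def I_def e_def)
qed

subsection \<open>Pairings with intervals\<close>

lemma indicator_dyadic_AE:
  "AE x in lborel. indicator {c..d} x * (indicator (dyadic n q) x :: complex)
    = indicator {max c (of_int q / 2 ^ n)..min d ((of_int q + 1) / 2 ^ n)} x"
  using AE_lborel_singleton[of "(of_int q + 1) / 2 ^ n"]
  by eventually_elim (auto simp: dyadic_def indicator_def)

text \<open>A function orthogonal to all intervals is orthogonal to all dyadic step functions, and
  on a bounded interval these approximate its own conjugate. Density is used at exponent 2, where
  local square integrability places the function.\<close>

lemma zero_of_interval_integrals:
  assumes p2: "2 \<le> p" and \<phi>: "\<phi> \<in> Lp p"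
    and zero: "\<And>c d. (\<integral>x. indicator {c..d} x * \<phi> x \<partial>lborel) = 0"
  shows "lp_norm p \<phi> = 0"
proof -
  have p1: "1 \<le> p" using p2 by simp
  note [measurable] = LpD(1)[OF \<phi>]
  have E0: "energy (- L) L \<phi> = 0" for L
  proof -
    define \<psi> where "\<psi> x = indicator {-L..L} x * \<phi> x" for x
    have [measurable]: "\<psi> \<in> borel_measurable borel" unfolding \<psi>_def by measurable
    have \<psi>sq: "(norm (\<psi> x))\<^sup>2 = indicator {-L..L} x * (norm (\<phi> x))\<^sup>2" for x
      by (simp add: \<psi>_def indicator_def)
    have i\<psi>: "integrable lborel \<psi>"
      unfolding \<psi>_def by (rule Lp_integrable_on_interval[OF p1 \<phi>])
    have isq: "integrable lborel (\<lambda>x. (norm (\<psi> x))\<^sup>2)"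
      unfolding \<psi>sq by (rule energy_integrable[OF p2 \<phi>])
    have \<psi>L2: "(\<lambda>x. cnj (\<psi> x)) \<in> Lp 2"
      by (rule LpI, measurable) (use isq in \<open>auto simp: powr_numeral\<close>)
    have bd: "energy (-L) L \<phi> \<le> e\<^sup>2" if e: "0 < e" for e
    proof -
      obtain n Q b where Q: "finite Q"
        and s: "lp_norm 2 (\<lambda>x. cnj (\<psi> x) - (\<Sum>q\<in>Q. b q * indicator (dyadic n q) x)) < e"
        using dyadic_step_dense[OF _ \<psi>L2 e] by auto
      define s where "s x = (\<Sum>q\<in>Q. b q * indicator (dyadic n q) x)" for x
      have [measurable]: "s \<in> borel_measurable borel" unfolding s_def by measurable
      have sL: "s \<in> Lp 2" unfolding s_def
      proof (intro Lp_sum Lp_cmult)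
        show "indicator (dyadic n q) \<in> Lp 2" for q
          by (rule Lp_bounded_support(1)[where B = 1 and c = "of_int q / 2 ^ n" and d = "(of_int q + 1) / 2 ^ n"])
            (auto simp: dyadic_def indicator_def)
      qed auto
      have iq: "integrable lborel (\<lambda>x. b q * (\<psi> x * indicator (dyadic n q) x))" for q
        by (intro integrable_mult_right, rule Bochner_Integration.integrable_bound[OF i\<psi>]) (auto simp: indicator_def)
      have vq: "(\<integral>x. \<psi> x * indicator (dyadic n q) x \<partial>lborel) = 0" for q
      proof -
        have "(\<integral>x. \<psi> x * indicator (dyadic n q) x \<partial>lborel)
            = (\<integral>x. indicator {max (-L) (of_int q / 2 ^ n)..min L ((of_int q + 1) / 2 ^ n)} x * \<phi> x \<partial>lborel)"
        proof (rule integral_cong_AE)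
          show "AE x in lborel. \<psi> x * indicator (dyadic n q) x
              = indicator {max (-L) (of_int q / 2 ^ n)..min L ((of_int q + 1) / 2 ^ n)} x * \<phi> x"
            using indicator_dyadic_AE[of "-L" L n q]
            by eventually_elim (simp add: \<psi>_def mult_ac)
        qed measurable
        then show ?thesis using zero by simp
      qed
      have \<psi>s: "integrable lborel (\<lambda>x. \<psi> x * s x)" "(\<integral>x. \<psi> x * s x \<partial>lborel) = 0"
      proof -
        have eq: "\<psi> x * s x = (\<Sum>q\<in>Q. b q * (\<psi> x * indicator (dyadic n q) x))" for x
          unfolding s_def sum_distrib_left by (intro sum.cong refl) simp
        show "integrable lborel (\<lambda>x. \<psi> x * s x)"
          unfolding eq by (intro Bochner_Integration.integrable_sum iq)
        show "(\<integral>x. \<psi> x * s x \<partial>lborel) = 0"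
          unfolding eq by (subst Bochner_Integration.integral_sum[OF iq]) (simp only: integral_mult_right_zero vq, simp)
      qed
      have idiff: "integrable lborel (\<lambda>x. (norm (cnj (\<psi> x) - s x))\<^sup>2)"
        using LpD(2)[OF Lp_diff[OF _ \<psi>L2 sL]] by (simp add: powr_numeral)
      have i\<psi>\<psi>: "integrable lborel (\<lambda>x. \<psi> x * cnj (\<psi> x))"
        using integrable_of_real[OF isq, where 'a = complex] unfolding complex_norm_square .
      have "complex_of_real (energy (-L) L \<phi>) = (\<integral>x. \<psi> x * cnj (\<psi> x) \<partial>lborel)"
        unfolding energy_def \<psi>sq[symmetric]
        by (subst integral_complex_of_real[symmetric]) (simp only: complex_norm_square)
      also have "\<dots> = (\<integral>x. \<psi> x * cnj (\<psi> x) - \<psi> x * s x \<partial>lborel)"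
        unfolding Bochner_Integration.integral_diff[OF i\<psi>\<psi> \<psi>s(1)] \<psi>s(2) by simp
      also have "\<dots> = (\<integral>x. \<psi> x * (cnj (\<psi> x) - s x) \<partial>lborel)" by (simp only: right_diff_distrib)
      finally have "norm (complex_of_real (energy (-L) L \<phi>)) = norm (\<integral>x. \<psi> x * (cnj (\<psi> x) - s x) \<partial>lborel)"
        by (rule arg_cong)
      then have "energy (-L) L \<phi> = norm (\<integral>x. \<psi> x * (cnj (\<psi> x) - s x) \<partial>lborel)"
        using energy_nonneg[of "-L" L \<phi>] by (simp only: norm_of_real abs_of_nonneg)
      also have "\<dots> \<le> (\<integral>x. norm (\<psi> x * (cnj (\<psi> x) - s x)) \<partial>lborel)" by (rule integral_norm_bound)
      \<comment> \<open>Splitting the product this way returns half of the energy to the left side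
        and leaves at most e^2.\<close>
      also have "\<dots> \<le> (\<integral>x. (norm (\<psi> x))\<^sup>2 / 2 + (norm (cnj (\<psi> x) - s x))\<^sup>2 / 2 \<partial>lborel)"
      proof (rule integral_mono)
        show "integrable lborel (\<lambda>x. norm (\<psi> x * (cnj (\<psi> x) - s x)))"
          unfolding right_diff_distrib by (intro integrable_norm Bochner_Integration.integrable_diff i\<psi>\<psi> \<psi>s)
        show "norm (\<psi> x * (cnj (\<psi> x) - s x)) \<le> (norm (\<psi> x))\<^sup>2 / 2 + (norm (cnj (\<psi> x) - s x))\<^sup>2 / 2" for x
          using sum_squares_bound[of "norm (\<psi> x)" "norm (cnj (\<psi> x) - s x)"] by (simp add: norm_mult)
      qed (use isq idiff in auto)
      also have "\<dots> = energy (-L) L \<phi> / 2 + (\<integral>x. (norm (cnj (\<psi> x) - s x))\<^sup>2 \<partial>lborel) / 2"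
        unfolding energy_def \<psi>sq[symmetric] using isq idiff by simp
      also have "(\<integral>x. (norm (cnj (\<psi> x) - s x))\<^sup>2 \<partial>lborel) \<le> e\<^sup>2"
        using lp_norm_leD[of 2 "\<lambda>x. cnj (\<psi> x) - s x" e] s e by (simp add: s_def powr_numeral)
      finally show ?thesis by simp
    qed
    show ?thesis
    proof (rule antisym[OF field_le_epsilon])
      fix e :: real assume "0 < e"
      then show "energy (-L) L \<phi> \<le> 0 + e" using bd[of "sqrt e"] by simp
    qed simp
  qed
  have "AE x in lborel. x \<in> {-real n..real n} \<longrightarrow> \<phi> x = 0" for n :: nat
  proof -
    have "AE x in lborel. indicator {-real n..real n} x * (norm (\<phi> x))\<^sup>2 = 0"
      using E0[of "real n"] integral_nonneg_eq_0_iff_AE[OF energy_integrable[OF p2 \<phi>, of "-real n" "real n"]]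
      unfolding energy_def by auto
    then show ?thesis by eventually_elim (auto simp: indicator_def split: if_splits)
  qed
  then have "AE x in lborel. \<forall>n::nat. x \<in> {-real n..real n} \<longrightarrow> \<phi> x = 0" unfolding AE_all_countable by blast
  then have "AE x in lborel. \<phi> x = 0"
  proof eventually_elim
    case (elim x)
    obtain n :: nat where "\<bar>x\<bar> < real n" using reals_Archimedean2 by blast
    then have "x \<in> {-real n..real n}" by auto
    with elim show ?case by blast
  qed
  then have "AE x in lborel. norm (\<phi> x) powr p = 0"
    by eventually_elim (use p2 in simp)
  then have "(\<integral>x. norm (\<phi> x) powr p \<partial>lborel) = 0"
    by (rule integral_eq_zero_AE)
  then show ?thesis using p2 by (simp add: lp_norm_def)
qed

definition interval_pairing :: "(real \<Rightarrow> complex) \<Rightarrow> real \<Rightarrow> real \<Rightarrow> real \<Rightarrow> real \<Rightarrow> complex" where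
  "interval_pairing g c d t s = (\<integral>x. indicator {c..d} x * (modul s x * transl t g x) \<partial>lborel)"

text \<open>Moves the parameters from g to the indicator and the exponential, so that dominated
  convergence yields continuity in (t, s).\<close>

lemma interval_pairing_shift:
  "interval_pairing g c d t s = (\<integral>y. indicator {c..d} (y + t) * (modul s (y + t) * g y) \<partial>lborel)"
  unfolding interval_pairing_def transl_def
  by (subst lborel_integral_real_affine[where c = 1 and t = t]) (auto simp: add.commute)

lemma interval_pairing_continuous:
  assumes p1: "1 \<le> p" and g: "g \<in> Lp p"
  shows "continuous_on UNIV (\<lambda>z. interval_pairing g c d (fst z) (snd z))"
proof (rule continuous_on_sequentiallyI)
  fix u :: "nat \<Rightarrow> real \<times> real" and z
  assume u: "u \<longlonglongrightarrow> z"
  note [measurable] = LpD(1)[OF g]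
  have u1: "(\<lambda>n. fst (u n)) \<longlonglongrightarrow> fst z" and u2: "(\<lambda>n. snd (u n)) \<longlonglongrightarrow> snd z"
    using u by (auto intro: tendsto_fst tendsto_snd)
  from convergent_imp_Bseq[OF convergentI[OF u1]] obtain b where b: "\<And>n. \<bar>fst (u n)\<bar> \<le> b"
    unfolding Bseq_def by auto
  show "(\<lambda>n. interval_pairing g c d (fst (u n)) (snd (u n))) \<longlonglongrightarrow> interval_pairing g c d (fst z) (snd z)"
    unfolding interval_pairing_shift
  proof (rule integral_dominated_convergence)
    show "integrable lborel (\<lambda>y. norm (indicator {c - b..d + b} y * g y))"
      by (rule integrable_norm[OF Lp_integrable_on_interval[OF p1 g]])
    show "AE y in lborel. (\<lambda>n. indicator {c..d} (y + fst (u n)) * (modul (snd (u n)) (y + fst (u n)) * g y))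
        \<longlonglongrightarrow> indicator {c..d} (y + fst z) * (modul (snd z) (y + fst z) * g y)"
      using AE_lborel_singleton[of "c - fst z"] AE_lborel_singleton[of "d - fst z"]
    proof eventually_elim
      case (elim y)
      have lim: "(\<lambda>n. y + fst (u n)) \<longlonglongrightarrow> y + fst z" by (intro tendsto_intros u1)
      have "(\<lambda>n. indicator {c..d} (y + fst (u n)) :: complex) \<longlonglongrightarrow> indicator {c..d} (y + fst z)"
      proof (rule tendsto_eventually)
        consider "y + fst z < c" | "d < y + fst z" | "c < y + fst z" "y + fst z < d" using elim by force
        then show "\<forall>\<^sub>F n in sequentially. (indicator {c..d} (y + fst (u n)) :: complex) = indicator {c..d} (y + fst z)"
        proof cases
          case 1
          from order_tendstoD(2)[OF lim this] show ?thesis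
            by eventually_elim (use 1 in auto)
        next
          case 2
          from order_tendstoD(1)[OF lim this] show ?thesis
            by eventually_elim (use 2 in auto)
        next
          case 3
          from order_tendstoD(1)[OF lim 3(1)] order_tendstoD(2)[OF lim 3(2)] show ?thesis
            by eventually_elim (use 3 in auto)
        qed
      qed
      moreover have "(\<lambda>n. modul (snd (u n)) (y + fst (u n))) \<longlonglongrightarrow> modul (snd z) (y + fst z)"
        unfolding modul_def by (intro tendsto_intros u1 u2)
      ultimately show ?case by (intro tendsto_intros)
    qed
    show "AE y in lborel. norm (indicator {c..d} (y + fst (u n)) * (modul (snd (u n)) (y + fst (u n)) * g y))
        \<le> norm (indicator {c - b..d + b} y * g y)" for n
      using b[of n] by (intro AE_I2) (auto simp: indicator_def norm_mult)
  qed measurable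
qed

text \<open>Compactness of [-a, a] x [0, 1]: every shift of the nonzero g pairs nontrivially with
  some interval, and by continuity the same interval serves nearby parameters. Frequencies in [0, 1]
  suffice because integer parts are modulated away later.\<close>

lemma finite_pairing_cover:
  assumes p2: "2 \<le> p" and g: "g \<in> Lp p" "lp_norm p g \<noteq> 0"
  shows "\<exists>H \<delta>. finite H \<and> 0 < \<delta> \<and>
    (\<forall>t\<in>{-a..a}. \<forall>r\<in>{0..1}. \<exists>h\<in>H. \<delta> \<le> norm (interval_pairing g (fst h) (snd h) t r))"
proof -
  have p1: "1 \<le> p" using p2 by simp
  have ex: "\<exists>h. interval_pairing g (fst h) (snd h) t r \<noteq> 0" for t r
  proof (rule ccontr)
    assume "\<not> ?thesis"
    then have "interval_pairing g c d t r = 0" for c d by (metis fst_conv snd_conv)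
    then have "lp_norm p (\<lambda>x. modul r x * transl t g x) = 0"
      using gabor_Lp[OF p1 g(1)] by (intro zero_of_interval_integrals p2) (auto simp: interval_pairing_def)
    then show False using g gabor_Lp(2)[OF p1 g(1)] by simp
  qed
  define h where "h z = (SOME h. interval_pairing g (fst h) (snd h) (fst z) (snd z) \<noteq> 0)" for z :: "real \<times> real"
  define P where "P z w = norm (interval_pairing g (fst (h z)) (snd (h z)) (fst w) (snd w))" for z w
  have Pz: "0 < P z z" for z
    using someI_ex[OF ex[of "fst z" "snd z"]] by (simp add: P_def h_def)
  have cont: "continuous_on UNIV (P z)" for z
    unfolding P_def by (intro continuous_on_norm interval_pairing_continuous[OF p1 g(1)])
  define U where "U z = {w. P z z / 2 < P z w}" for z
  have "compact ({-a..a} \<times> {0..1::real})" by (intro compact_Times compact_Icc)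
  moreover have "open (U z)" for z
    unfolding U_def by (intro open_Collect_less continuous_on_const cont)
  moreover have "w \<in> U w" for w using Pz[of w] by (simp add: U_def)
  then have "({-a..a} \<times> {0..1}) \<subseteq> (\<Union>z\<in>UNIV. U z)" by blast
  ultimately obtain Z where Z: "finite Z" "({-a..a} \<times> {0..1}) \<subseteq> (\<Union>z\<in>Z. U z)"
    by (metis compactE_image)
  define \<delta> where "\<delta> = Min (insert 1 ((\<lambda>z. P z z / 2) ` Z))"
  have "0 < \<delta>" using Z Pz by (auto simp: \<delta>_def)
  moreover have "\<exists>k\<in>h ` Z. \<delta> \<le> norm (interval_pairing g (fst k) (snd k) t r)" if tr: "t \<in> {-a..a}" "r \<in> {0..1}" for t r
  proof -
    have "(t, r) \<in> {-a..a} \<times> {0..1}" using tr by simp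
    then obtain z where z: "z \<in> Z" "(t, r) \<in> U z" using Z(2) by blast
    have "\<delta> \<le> P z z / 2" unfolding \<delta>_def using Z z by (intro Min_le) auto
    then show ?thesis using z by (intro bexI[of _ "h z"]) (auto simp: U_def P_def)
  qed
  ultimately show ?thesis using Z by (intro exI[of _ "h ` Z"] exI[of _ \<delta>]) auto
qed

subsection \<open>Coefficients are square summable over frequency cells\<close>

text \<open>Within a cell the coefficients are rotated so that they add up coherently against the interval
  pairing; across cells random signs make the local energies add up.\<close>

lemma coefficient_l2_bound:
  assumes p2: "2 \<le> p" and g: "g \<in> Lp p" and f: "f \<in> Lp p" and \<delta>: "0 < \<delta>"
    and fr: "uncond_schauder_frame p \<Lambda> (gabor g) us"
  obtains B where "0 \<le> B" "\<And>F. finite F \<Longrightarrow> F \<subseteq> \<Lambda> \<Longrightarrow>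
      (\<And>n. n \<in> F \<Longrightarrow> \<delta> \<le> norm (interval_pairing g c d (fst n) (frac (snd n)))) \<Longrightarrow>
      (\<Sum>j\<in>(\<lambda>n. \<lfloor>snd n\<rfloor>) ` F. (\<Sum>n | n \<in> F \<and> \<lfloor>snd n\<rfloor> = j. norm (us n f))\<^sup>2) \<le> B"
proof -
  have p1: "1 \<le> p" using p2 by simp
  obtain C where C: "\<And>S. finite S \<Longrightarrow> S \<subseteq> \<Lambda> \<Longrightarrow> lp_norm p (\<lambda>y. \<Sum>n\<in>S. us n f * gabor g n y) \<le> C"
    by (rule frame_partial_sums_bounded[OF p1 fr f], rule that)
  \<comment> \<open>Cauchy-Schwarz on [c, d] contributes one factor |d - c|,
    \<open>energy_le_lp_norm\<close> at the bound 4 * C the next, and the lower bound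
    \<open>\<delta>\<close> enters squared. Absolute values cover an empty interval.\<close>
  define B where "B = \<bar>d - c\<bar> * (\<bar>d - c\<bar> + (4 * C) powr p) / \<delta>\<^sup>2"
  have main: "(\<Sum>j\<in>(\<lambda>n. \<lfloor>snd n\<rfloor>) ` F. (\<Sum>n | n \<in> F \<and> \<lfloor>snd n\<rfloor> = j. norm (us n f))\<^sup>2) \<le> B"
    if F: "finite F" "F \<subseteq> \<Lambda>" and P: "\<And>n. n \<in> F \<Longrightarrow> \<delta> \<le> norm (interval_pairing g c d (fst n) (frac (snd n)))" for F
  proof (cases "c \<le> d")
    case False
    have "F = {}"
    proof (rule ccontr)
      assume "F \<noteq> {}"
      then obtain n where "n \<in> F" by auto
      from P[OF this] \<delta> False show False by (simp add: interval_pairing_def)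
    qed
    then show ?thesis by (simp add: B_def)
  next
    case cd: True
    define J where "J = (\<lambda>n. \<lfloor>snd n\<rfloor>) ` F"
    define Fj where "Fj j = {n \<in> F. \<lfloor>snd n\<rfloor> = j}" for j
    have J: "finite J" and Fj: "finite (Fj j)" "Fj j \<subseteq> F" for j
      using F by (auto simp: J_def Fj_def)
    define P where "P n = interval_pairing g c d (fst n) (frac (snd n))" for n
    \<comment> \<open>Conjugate phases make each product of coefficient and pairing nonnegative, so
      pairing the sum over a cell produces the sum of the moduli.\<close>
    define \<theta> where "\<theta> n = cnj (sgn (us n f * P n))" for n
    have \<theta>1: "norm (\<theta> n) \<le> 1" for n by (simp add: \<theta>_def norm_sgn)
    have \<theta>P: "\<theta> n * (us n f * P n) = of_real (norm (us n f) * norm (P n))" for n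
    proof -
      have "cnj (sgn z) * z = of_real (norm z)" for z :: complex
      proof (cases "z = 0")
        case False
        have "cnj (sgn z) * z = (z * cnj z) / of_real (norm z)" by (simp add: sgn_eq mult.commute)
        also have "\<dots> = of_real (norm z)"
          using False by (simp add: power2_eq_square flip: complex_norm_square)
        finally show ?thesis .
      qed simp
      then show ?thesis by (simp add: \<theta>_def norm_mult)
    qed
    have u: "gabor g n \<in> Lp p" for n
      using gabor_Lp(1)[OF p1 g] by (cases n) simp
    define D where "D j x = (\<Sum>n\<in>Fj j. \<theta> n * (us n f * gabor g n x))" for j x
    have DL: "D j \<in> Lp p" for j
      unfolding D_def by (intro Lp_sum[OF p1] Lp_cmult[OF p1] u)
    have lower: "(\<delta> * (\<Sum>n\<in>Fj j. norm (us n f)))\<^sup>2 \<le> (d - c) * energy c d (D j)" for j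
    proof -
      \<comment> \<open>Modulation by -j leaves the energy unchanged and reduces the frequencies of
        the cell to their fractional parts, where the lower bound \<open>\<delta>\<close> is
        known.\<close>
      let ?w = "\<lambda>x. modul (- of_int j) x * D j x"
      have wL: "?w \<in> Lp p"
        by (rule Lp_dominated(1)[OF _ DL]) (use LpD(1)[OF DL] p1 in \<open>auto simp: norm_mult\<close>)
      have ig: "integrable lborel (\<lambda>x. (\<theta> n * us n f) * (indicator {c..d} x * gabor g (fst n, s) x))" for n s
        by (intro integrable_mult_right Lp_integrable_on_interval[OF p1] u)
      have "indicator {c..d} x * ?w x
          = (\<Sum>n\<in>Fj j. (\<theta> n * us n f) * (indicator {c..d} x * gabor g (fst n, frac (snd n)) x))" for x
        unfolding D_def sum_distrib_left
      proof (rule sum.cong[OF refl])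
        fix n assume "n \<in> Fj j"
        then have s: "snd n = of_int j + frac (snd n)" by (auto simp: Fj_def frac_def)
        have "gabor g n x = modul (snd n) x * transl (fst n) g x" by (cases n) simp
        also have "\<dots> = modul (of_int j) x * modul (frac (snd n)) x * transl (fst n) g x"
          by (subst s) (simp add: modul_add)
        finally have "modul (- of_int j) x * gabor g n x = (modul (- of_int j) x * modul (of_int j) x) * modul (frac (snd n)) x * transl (fst n) g x"
          by (simp add: mult_ac)
        also have "modul (- of_int j) x * modul (of_int j) x = 1" by (simp flip: modul_add)
        finally have m: "modul (- of_int j) x * gabor g n x = gabor g (fst n, frac (snd n)) x" by simp
        show "indicator {c..d} x * (modul (- of_int j) x * (\<theta> n * (us n f * gabor g n x))) =
          \<theta> n * us n f * (indicator {c..d} x * gabor g (fst n, frac (snd n)) x)"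
          unfolding m[symmetric] by (simp only: mult_ac)
      qed
      then have "(\<integral>x. indicator {c..d} x * ?w x \<partial>lborel)
          = (\<Sum>n\<in>Fj j. \<integral>x. (\<theta> n * us n f) * (indicator {c..d} x * gabor g (fst n, frac (snd n)) x) \<partial>lborel)"
        by (simp only: Bochner_Integration.integral_sum[OF ig])
      also have "\<dots> = (\<Sum>n\<in>Fj j. (\<theta> n * us n f) * P n)"
        by (simp only: integral_mult_right_zero P_def interval_pairing_def split)
      also have "\<dots> = of_real (\<Sum>n\<in>Fj j. norm (us n f) * norm (P n))"
        unfolding of_real_sum using \<theta>P by (intro sum.cong refl) (simp only: mult.assoc)
      finally have eq: "norm (\<integral>x. indicator {c..d} x * ?w x \<partial>lborel) = (\<Sum>n\<in>Fj j. norm (us n f) * norm (P n))"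
        by (simp only: norm_of_real) (intro abs_of_nonneg sum_nonneg, simp)
      have "\<delta> * (\<Sum>n\<in>Fj j. norm (us n f)) \<le> (\<Sum>n\<in>Fj j. norm (us n f) * norm (P n))"
        unfolding sum_distrib_left
      proof (rule sum_mono)
        fix n assume "n \<in> Fj j"
        then have "\<delta> \<le> norm (P n)" using P by (simp add: P_def Fj_def)
        then show "\<delta> * norm (us n f) \<le> norm (us n f) * norm (P n)"
          by (subst mult.commute) (rule mult_left_mono, simp_all)
      qed
      then have "(\<delta> * (\<Sum>n\<in>Fj j. norm (us n f)))\<^sup>2 \<le> (norm (\<integral>x. indicator {c..d} x * ?w x \<partial>lborel))\<^sup>2"
        unfolding eq using \<delta> by (intro power_mono) (auto intro!: mult_nonneg_nonneg sum_nonneg)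
      also have "\<dots> \<le> (d - c) * energy c d ?w"
        unfolding energy_def by (rule interval_cauchy_schwarz[OF cd Lp_integrable_on_interval[OF p1 wL] energy_integrable[OF p2 wL]])
      also have "energy c d ?w = energy c d (D j)"
        by (simp add: energy_def norm_mult)
      finally show ?thesis .
    qed
    obtain \<epsilon> where \<epsilon>0: "\<forall>j. \<epsilon> j \<in> {1, -1 :: real}"
      and \<epsilon>2: "(\<Sum>j\<in>J. energy c d (D j)) \<le> energy c d (\<lambda>x. \<Sum>j\<in>J. of_real (\<epsilon> j) * D j x)"
      using exists_signs_energy[where D = D, OF p2 J DL, of c d] by (elim exE conjE)
    note \<epsilon> = spec[OF \<epsilon>0] \<epsilon>2
    have eq: "(\<Sum>j\<in>J. of_real (\<epsilon> j) * D j x) = (\<Sum>n\<in>F. (of_real (\<epsilon> \<lfloor>snd n\<rfloor>) * \<theta> n) * (us n f * gabor g n x))" for x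
    proof -
      have "(\<Sum>j\<in>J. of_real (\<epsilon> j) * D j x) = (\<Sum>j\<in>J. \<Sum>n\<in>Fj j. (of_real (\<epsilon> \<lfloor>snd n\<rfloor>) * \<theta> n) * (us n f * gabor g n x))"
        unfolding D_def sum_distrib_left by (intro sum.cong refl) (auto simp: Fj_def mult.assoc)
      also have "\<dots> = (\<Sum>n\<in>F. (of_real (\<epsilon> \<lfloor>snd n\<rfloor>) * \<theta> n) * (us n f * gabor g n x))"
        unfolding Fj_def by (rule sum.group[OF F(1) J]) (simp add: J_def)
      finally show ?thesis .
    qed
    have "lp_norm p (\<lambda>x. \<Sum>n\<in>F. (of_real (\<epsilon> \<lfloor>snd n\<rfloor>) * \<theta> n) * (us n f * gabor g n x)) \<le> 4 * C"
    proof (rule lp_norm_unimodular_sum[OF p1 F(1)])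
      show "(\<lambda>x. us n f * gabor g n x) \<in> Lp p" for n by (intro Lp_cmult[OF p1] u)
      show "norm (of_real (\<epsilon> \<lfloor>snd n\<rfloor>) * \<theta> n) \<le> 1" for n
        using \<epsilon>(1)[of "\<lfloor>snd n\<rfloor>"] \<theta>1[of n] by (auto simp: norm_mult)
      show "lp_norm p (\<lambda>x. \<Sum>n\<in>S. us n f * gabor g n x) \<le> C" if "S \<subseteq> F" for S
        using C[of S] that F finite_subset by auto
    qed
    then have "energy c d (\<lambda>x. \<Sum>j\<in>J. of_real (\<epsilon> j) * D j x) \<le> (d - c) + (4 * C) powr p"
      unfolding eq by (intro energy_le_lp_norm[OF p2 _ cd] Lp_sum[OF p1] Lp_cmult[OF p1] u)
    with \<epsilon>(2) have E: "(\<Sum>j\<in>J. energy c d (D j)) \<le> (d - c) + (4 * C) powr p" by simp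
    have "\<delta>\<^sup>2 * (\<Sum>j\<in>J. (\<Sum>n\<in>Fj j. norm (us n f))\<^sup>2) = (\<Sum>j\<in>J. (\<delta> * (\<Sum>n\<in>Fj j. norm (us n f)))\<^sup>2)"
      by (simp only: power_mult_distrib flip: sum_distrib_left)
    also have "\<dots> \<le> (\<Sum>j\<in>J. (d - c) * energy c d (D j))" by (intro sum_mono lower)
    also have "\<dots> \<le> (d - c) * ((d - c) + (4 * C) powr p)"
      unfolding sum_distrib_left[symmetric] using E cd by (intro mult_left_mono) auto
    finally show ?thesis using \<delta> cd by (simp add: B_def J_def Fj_def pos_le_divide_eq mult.commute)
  qed
  show ?thesis
    by (rule that[of B], simp add: B_def) (rule main)
qed

subsection \<open>Averaging over modulated windows\<close>

lemma Re_modul: "Re (modul s x) = cos (2 * pi * (s * x))"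
proof -
  have "modul s x = exp (\<i> * complex_of_real (2 * pi * (s * x)))" by (simp add: modul_def mult_ac)
  also have "\<dots> = cis (2 * pi * (s * x))" by (simp only: cis_conv_exp)
  finally show ?thesis by simp
qed

lemma energy_tail:
  assumes p2: "2 \<le> p" and g: "g \<in> Lp p" and a: "0 < a" and e: "0 < e"
  obtains M :: nat where "energy (real M - a) (real M + 2 + a) g < e"
proof -
  \<comment> \<open>Makes the constant part of \<open>energy_le\<close>, on an interval of length 2
    + 2a, equal to e/2; the other part is a tail of an integrable function.\<close>
  define l where "l = sqrt (e / (4 * (1 + a)))"
  have l: "0 < l" "l\<^sup>2 * (2 + 2 * a) = e / 2" using e a by (auto simp: l_def field_simps)
  have "(\<lambda>M. \<integral>x. indicator {real M - a..real M + 2 + a} x * norm (g x) powr p \<partial>lborel) \<longlonglongrightarrow> (\<integral>x. 0 \<partial>(lborel :: real measure))"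
  proof (rule integral_dominated_convergence)
    show "integrable lborel (\<lambda>x. norm (g x) powr p)" by (rule LpD(2)[OF g])
    show "AE x in lborel. (\<lambda>M. indicator {real M - a..real M + 2 + a} x * norm (g x) powr p) \<longlonglongrightarrow> 0"
    proof (rule AE_I2, rule tendsto_eventually)
      fix x
      obtain m :: nat where m: "x + a < real m" using reals_Archimedean2 by blast
      show "\<forall>\<^sub>F M in sequentially. indicator {real M - a..real M + 2 + a} x * norm (g x) powr p = 0"
        using eventually_ge_at_top[of m]
      proof eventually_elim
        case (elim M)
        then have "real m \<le> real M" by simp
        with m show ?case by simp
      qed
    qed
  qed (use LpD(1)[OF g] in \<open>auto simp: indicator_def\<close>)
  then have "(\<lambda>M. l powr (2 - p) * (\<integral>x. indicator {real M - a..real M + 2 + a} x * norm (g x) powr p \<partial>lborel)) \<longlonglongrightarrow> l powr (2 - p) * 0"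
    by (intro tendsto_intros) simp
  then have "\<forall>\<^sub>F M in sequentially. l powr (2 - p) * (\<integral>x. indicator {real M - a..real M + 2 + a} x * norm (g x) powr p \<partial>lborel) < e / 2"
    by (rule order_tendstoD) (use e in simp)
  then obtain M where M: "l powr (2 - p) * (\<integral>x. indicator {real M - a..real M + 2 + a} x * norm (g x) powr p \<partial>lborel) < e / 2"
    by (auto simp: eventually_sequentially)
  have "energy (real M - a) (real M + 2 + a) g \<le> l\<^sup>2 * ((real M + 2 + a) - (real M - a))
      + l powr (2 - p) * (\<integral>x. indicator {real M - a..real M + 2 + a} x * norm (g x) powr p \<partial>lborel)"
    by (rule energy_le[OF p2 g _ l(1)]) (use a in simp)
  also have "(real M + 2 + a) - (real M - a) = 2 + 2 * a" by simp
  finally have "energy (real M - a) (real M + 2 + a) g < e" using M l(2) by linarith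
  then show ?thesis by (rule that)
qed

text \<open>Test functions depending on parameters \<open>(\<sigma>, r)\<close> are used because time-frequency shifts merely translate
  the parameters; integrating over them replaces the supremum over a frequency cell and over \<open>[-a, a]\<close>
  by one integral over a fixed box.\<close>

definition window :: "(real \<Rightarrow> complex) \<Rightarrow> real \<Rightarrow> real \<times> real \<Rightarrow> complex" where
  "window g M z = (\<integral>y. indicator {M + snd z..M + snd z + 1} y * (modul (fst z) y * g y) \<partial>lborel)"

lemma window_measurable:
  assumes [measurable]: "g \<in> borel_measurable borel"
  shows "window g M \<in> borel_measurable borel"
proof -
  have "(\<lambda>z. \<integral>y. (if M + snd z \<le> y \<and> y \<le> M + snd z + 1 then modul (fst z) y * g y else 0) \<partial>lborel) \<in> borel_measurable (borel \<Otimes>\<^sub>M borel)"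
    unfolding modul_def by measurable
  also have "(\<lambda>z. \<integral>y. (if M + snd z \<le> y \<and> y \<le> M + snd z + 1 then modul (fst z) y * g y else 0) \<partial>lborel) = window g M"
    unfolding window_def by (intro ext Bochner_Integration.integral_cong) (auto simp: indicator_def)
  finally show ?thesis by (simp add: borel_prod)
qed

lemma window_shift:
  "norm (\<integral>x. indicator {M + r..M + r + 1} x * (modul \<sigma> (x - M) * gabor g (t, s) x) \<partial>lborel)
    = norm (window g M (s + \<sigma>, r - t))"
proof -
  have "(\<integral>x. indicator {M + r..M + r + 1} x * (modul \<sigma> (x - M) * gabor g (t, s) x) \<partial>lborel)
      = (\<integral>y. indicator {M + r..M + r + 1} (t + y) * (modul \<sigma> (t + y - M) * gabor g (t, s) (t + y)) \<partial>lborel)"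
    by (subst lborel_integral_real_affine[where c = 1 and t = t]) auto
  also have "\<dots> = (\<integral>y. (modul \<sigma> (t - M) * modul s t) * (indicator {M + (r - t)..M + (r - t) + 1} y * (modul (s + \<sigma>) y * g y)) \<partial>lborel)"
  proof (rule Bochner_Integration.integral_cong[OF refl])
    fix y
    have "modul \<sigma> (t + y - M) = modul \<sigma> (t - M) * modul \<sigma> y" using modul_shift[of \<sigma> "t - M" y] by (simp add: algebra_simps)
    moreover have "modul s (t + y) = modul s t * modul s y" by (rule modul_shift)
    moreover have "(indicator {M + r..M + r + 1} (t + y) :: complex) = indicator {M + (r - t)..M + (r - t) + 1} y"
      by (auto simp: indicator_def)
    ultimately show "indicator {M + r..M + r + 1} (t + y) * (modul \<sigma> (t + y - M) * gabor g (t, s) (t + y))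
       = (modul \<sigma> (t - M) * modul s t) * (indicator {M + (r - t)..M + (r - t) + 1} y * (modul (s + \<sigma>) y * g y))"
      by (simp add: transl_def modul_add)
  qed
  finally show ?thesis by (simp add: window_def norm_mult)
qed

text \<open>For fixed \<open>\<sigma>\<close> and r the frequencies j + \<open>\<sigma>\<close>
  differ by integers, so Bessel's inequality on the unit interval at M + r applies to g modulated by
  \<open>\<sigma>\<close>; Cauchy-Schwarz over j finishes.\<close>

lemma window_bessel:
  assumes p2: "2 \<le> p" and g: "g \<in> Lp p" and J: "finite J" and A: "\<And>j. j \<in> J \<Longrightarrow> 0 \<le> A j"
    and r: "c \<le> M + r" "M + r + 1 \<le> d"
  shows "(\<Sum>j\<in>J. A j * norm (window g M (of_int j + \<sigma>, r))) \<le> sqrt (\<Sum>j\<in>J. (A j)\<^sup>2) * sqrt (energy c d g)"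
proof -
  have p1: "1 \<le> p" using p2 by simp
  let ?w = "\<lambda>y. modul \<sigma> y * g y"
  have wL: "?w \<in> Lp p"
    by (rule Lp_dominated(1)[OF _ g]) (use LpD(1)[OF g] p1 in \<open>auto simp: norm_mult\<close>)
  have "(\<Sum>j\<in>J. (norm (window g M (of_int j + \<sigma>, r)))\<^sup>2) \<le> energy (M + r) (M + r + 1) ?w"
    using bessel_unit_interval[OF J LpD(1)[OF wL] energy_integrable[OF p2 wL], of "M + r"]
    by (simp add: window_def modul_add mult.assoc)
  also have "\<dots> \<le> energy c d g"
    unfolding energy_def
    by (rule integral_mono[OF _ energy_integrable[OF p2 g]])
      (use energy_integrable[OF p2 wL] r in \<open>auto simp: indicator_def norm_mult\<close>)
  finally have E: "(\<Sum>j\<in>J. (norm (window g M (of_int j + \<sigma>, r)))\<^sup>2) \<le> energy c d g" .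
  have "(\<Sum>j\<in>J. A j * norm (window g M (of_int j + \<sigma>, r))) \<le> sqrt ((\<Sum>j\<in>J. (A j)\<^sup>2) * (\<Sum>j\<in>J. (norm (window g M (of_int j + \<sigma>, r)))\<^sup>2))"
    by (rule real_le_rsqrt[OF Cauchy_Schwarz_ineq_sum])
  also have "\<dots> \<le> sqrt ((\<Sum>j\<in>J. (A j)\<^sup>2) * energy c d g)"
    by (intro real_sqrt_le_mono mult_left_mono E sum_nonneg) auto
  finally show ?thesis by (simp add: real_sqrt_mult)
qed


lemma cos_ge_half: "\<bar>y\<bar> \<le> pi / 3 \<Longrightarrow> 1 / 2 \<le> cos y"
  using cos_monotone_0_pi_le[of "\<bar>y\<bar>" "pi / 3"] pi_gt_zero by (simp add: cos_60)

theorem strip_no_gabor_frame: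
  assumes p2: "2 \<le> p" and a: "0 < a" and strip: "\<Lambda> \<subseteq> {-a..a} \<times> UNIV" and g: "g \<in> Lp p"
  shows "\<not> uncond_schauder_frame p \<Lambda> (gabor g) us"
proof
  assume fr: "uncond_schauder_frame p \<Lambda> (gabor g) us"
  have p1: "1 \<le> p" using p2 by simp
  note gm[measurable] = LpD(1)[OF g]
  have u: "gabor g n \<in> Lp p" "lp_norm p (gabor g n) = lp_norm p g" for n
    using gabor_Lp[OF p1 g] by (cases n, simp)+
  have g0: "lp_norm p g \<noteq> 0"
  proof
    assume z: "lp_norm p g = 0"
    define e :: "real \<Rightarrow> complex" where "e = indicator {0..1}"
    have eL: "e \<in> Lp p"
      by (rule Lp_bounded_support(1)[OF p1, where B = 1 and c = 0 and d = 1]) (auto simp: e_def indicator_def)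
    have "norm (e x) powr p = indicator {0..1} x" for x using p1 by (auto simp: e_def indicator_def)
    then have e1: "lp_norm p e = 1" by (simp add: lp_norm_def)
    obtain F0 where F0: "finite F0" "F0 \<subseteq> \<Lambda>"
      and ap: "\<And>F. finite F \<Longrightarrow> F0 \<subseteq> F \<Longrightarrow> F \<subseteq> \<Lambda> \<Longrightarrow> lp_norm p (\<lambda>y. e y - (\<Sum>n\<in>F. us n e * gabor g n y)) < 1/2"
      by (rule frame_approx[OF p1 fr eL, of "1/2"], simp, rule that)
    have SL: "(\<lambda>y. \<Sum>n\<in>F0. us n e * gabor g n y) \<in> Lp p"
      by (intro Lp_sum[OF p1] Lp_cmult[OF p1] u)
    have "lp_norm p (\<lambda>y. \<Sum>n\<in>F0. us n e * gabor g n y) \<le> (\<Sum>n\<in>F0. lp_norm p (\<lambda>y. us n e * gabor g n y))"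
      by (intro lp_norm_sum[OF p1] Lp_cmult[OF p1] u)
    also have "\<dots> = 0"
      by (intro sum.neutral ballI) (simp only: lp_norm_cmult[OF p1] u(2) z mult_zero_right)
    finally show False
      using lp_norm_triangle_sub[OF p1 eL SL] ap[OF F0(1) order_refl F0(2)] e1 by simp
  qed
  obtain H \<delta> where H: "finite H" and \<delta>: "0 < \<delta>"
    and cov: "\<forall>t\<in>{-a..a}. \<forall>r\<in>{0..1}. \<exists>h\<in>H. \<delta> \<le> norm (interval_pairing g (fst h) (snd h) t r)"
    using finite_pairing_cover[OF p2 g g0, of a] by (elim exE conjE)
  \<comment> \<open>Energy below 16^-k means a local L^2 norm below 4^-k, which loses against the
    height 2^-k given to f on [M k, M k + 2]. The places M k may coincide, as all terms of f are
    nonnegative.\<close>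
  have "\<exists>M::nat. energy (real M - a) (real M + 2 + a) g < (1/16) ^ k" for k :: nat
    using energy_tail[OF p2 g a, of "(1/16) ^ k"] by (metis zero_less_divide_1_iff zero_less_numeral zero_less_power)
  then obtain M :: "nat \<Rightarrow> nat" where M: "\<And>k. energy (real (M k) - a) (real (M k) + 2 + a) g < (1/16) ^ k"
    by metis
  define fk :: "nat \<Rightarrow> real \<Rightarrow> complex" where "fk k x = of_real ((1/2) ^ k * indicator {real (M k)..real (M k) + 2} x)" for k x
  define fre where "fre x = (\<Sum>k. (1/2) ^ k * indicator {real (M k)..real (M k) + 2} x :: real)" for x
  define f where "f x = (\<Sum>k. fk k x)" for x
  have bdk: "norm ((1/2) ^ k * indicator {real (M k)..real (M k) + 2} x :: real) \<le> (1/2) ^ k" for k x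
    by (auto simp: indicator_def)
  have sumr: "summable (\<lambda>k. (1/2) ^ k * indicator {real (M k)..real (M k) + 2} x :: real)" for x
    by (rule summable_comparison_test'[OF summable_geometric[of "1/2::real"]]) (use bdk in auto)
  have f_fre: "f x = of_real (fre x)" for x
    unfolding f_def fre_def fk_def by (rule suminf_of_real[OF sumr, symmetric])
  have fkL: "fk k \<in> Lp p" "lp_norm p (fk k) \<le> (1/2) ^ k * 2 powr (1/p)" for k
  proof -
    have 1: "fk k \<in> borel_measurable borel" unfolding fk_def by measurable
    have 2: "norm (fk k x) \<le> (1/2) ^ k" for x using bdk[of k x] by (simp only: fk_def norm_of_real real_norm_def)
    have 3: "x \<notin> {real (M k)..real (M k) + 2} \<Longrightarrow> fk k x = 0" for x by (simp add: fk_def)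
    show "fk k \<in> Lp p" "lp_norm p (fk k) \<le> (1/2) ^ k * 2 powr (1/p)"
      using Lp_bounded_support[where c = "real (M k)" and d = "real (M k) + 2", OF p1 1 2 3] by simp_all
  qed
  have fL: "f \<in> Lp p"
    unfolding f_def
  proof (rule Lp_suminf(1)[OF p1 fkL(1)])
    show "summable (\<lambda>k. fk k x)" for x
      unfolding fk_def by (rule summable_of_real[OF sumr])
    have "(\<Sum>k<n. lp_norm p (fk k)) \<le> (\<Sum>k<n. (1/2) ^ k * 2 powr (1/p))" for n
      by (intro sum_mono fkL)
    also have "(\<Sum>k<n. (1/2) ^ k * 2 powr (1/p)) \<le> 2 * 2 powr (1/p)" for n
    proof -
      have "(\<Sum>k<n. (1/2::real) ^ k) \<le> (\<Sum>k. (1/2) ^ k)"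
        by (rule sum_le_suminf[OF summable_geometric]) auto
      then have "(\<Sum>k<n. (1/2::real) ^ k) \<le> 2" by (simp add: suminf_geometric)
      then show ?thesis unfolding sum_distrib_right[symmetric] by (intro mult_right_mono) auto
    qed
    finally show "(\<Sum>k<n. lp_norm p (fk k)) \<le> 2 * 2 powr (1/p)" for n .
  qed
  have fre_lower: "(1/2) ^ k \<le> fre x" if "x \<in> {real (M k)..real (M k) + 2}" for k x
  proof -
    define h :: "nat \<Rightarrow> real" where "h j = (1/2) ^ j * indicator {real (M j)..real (M j) + 2} x" for j
    have "sum h {k} \<le> suminf h"
      by (rule sum_le_suminf) (use sumr[of x] in \<open>auto simp: h_def[abs_def]\<close>)
    moreover have "suminf h = fre x" unfolding h_def[abs_def] fre_def ..
    moreover have "h k = (1/2) ^ k" using that by (simp add: h_def)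
    ultimately show ?thesis by simp
  qed
  have "\<exists>B. 0 \<le> B \<and> (\<forall>F. finite F \<longrightarrow> F \<subseteq> \<Lambda> \<longrightarrow>
      (\<forall>n\<in>F. \<delta> \<le> norm (interval_pairing g (fst h) (snd h) (fst n) (frac (snd n)))) \<longrightarrow>
      (\<Sum>j\<in>(\<lambda>n. \<lfloor>snd n\<rfloor>) ` F. (\<Sum>n | n \<in> F \<and> \<lfloor>snd n\<rfloor> = j. norm (us n f))\<^sup>2) \<le> B)" for h
  proof (rule coefficient_l2_bound[OF p2 g fL \<delta> \<open>uncond_schauder_frame p \<Lambda> (gabor g) us\<close>, of "fst h" "snd h"])
    fix B assume B: "0 \<le> B" "\<And>F. finite F \<Longrightarrow> F \<subseteq> \<Lambda> \<Longrightarrow>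
      (\<And>n. n \<in> F \<Longrightarrow> \<delta> \<le> norm (interval_pairing g (fst h) (snd h) (fst n) (frac (snd n)))) \<Longrightarrow>
      (\<Sum>j\<in>(\<lambda>n. \<lfloor>snd n\<rfloor>) ` F. (\<Sum>n | n \<in> F \<and> \<lfloor>snd n\<rfloor> = j. norm (us n f))\<^sup>2) \<le> B"
    show ?thesis by (rule exI[of _ B], intro conjI B(1) allI impI, rule B(2)) auto
  qed
  then obtain B where BB: "\<forall>h. 0 \<le> B h \<and> (\<forall>F. finite F \<longrightarrow> F \<subseteq> \<Lambda> \<longrightarrow>
      (\<forall>n\<in>F. \<delta> \<le> norm (interval_pairing g (fst h) (snd h) (fst n) (frac (snd n)))) \<longrightarrow>
      (\<Sum>j\<in>(\<lambda>n. \<lfloor>snd n\<rfloor>) ` F. (\<Sum>n | n \<in> F \<and> \<lfloor>snd n\<rfloor> = j. norm (us n f))\<^sup>2) \<le> B h)"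
    by (rule exE[OF choice[OF allI]])
  have B0: "\<And>h. 0 \<le> B h" by (rule BB[THEN spec, THEN conjunct1])
  note B = BB[THEN spec, THEN conjunct2, THEN spec, THEN mp, THEN mp, THEN mp]
  \<comment> \<open>Each point is charged to one test interval that detects it, so the square roots
    of the finitely many cell bounds add up.\<close>
  define K where "K = (\<Sum>h\<in>H. sqrt (B h))"
  \<comment> \<open>For \<open>\<sigma>\<close> \<le> 1/16 and 0 \<le> x - m \<le> 2 the phase is at
    most pi/4, which keeps its cosine above 1/2. \<open>Z1\<close> contains every translate of
    \<open>Z0\<close> by (frac s, -t) with |t| \<le> a.\<close>
  define Z0 :: "(real \<times> real) set" where "Z0 = {0..1/16} \<times> {0..1}"
  define Z1 :: "(real \<times> real) set" where "Z1 = {0..2} \<times> {-a..1+a}"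
  have Z01: "Z0 \<in> sets borel" "Z1 \<in> sets borel"
    unfolding Z0_def Z1_def by (intro borel_closed closed_Times closed_atLeastAtMost)+
  have mZ0: "emeasure lborel Z0 = ennreal (1/16)"
    unfolding Z0_def lborel_prod[symmetric]
    by (subst lborel.emeasure_pair_measure_Times) (auto simp flip: ennreal_mult)
  have mZ1: "emeasure lborel Z1 = ennreal (2 * (1 + 2 * a))"
  proof -
    have "emeasure lborel {0..2::real} = ennreal 2" "emeasure lborel {-a..1 + a} = ennreal (1 + 2 * a)"
      using a by (simp_all add: algebra_simps)
    then have "emeasure lborel Z1 = ennreal 2 * ennreal (1 + 2 * a)"
      unfolding Z1_def lborel_prod[symmetric] by (subst lborel.emeasure_pair_measure_Times) auto
    also have "\<dots> = ennreal (2 * (1 + 2 * a))" using a by (intro ennreal_mult[symmetric]) auto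
    finally show ?thesis .
  qed
  \<comment> \<open>The lower bound \<open>(1/2) ^ k / 4\<close> is integrated over
    \<open>Z0\<close>, of measure 1/16, and compared with the upper bound integrated over
    \<open>Z1\<close>, of measure 2 (1 + 2a).\<close>
  have main: "(1/2) ^ k / 64 \<le> K * (1/4) ^ k * (2 * (1 + 2 * a))" for k
  proof -
    define m where "m = real (M k)"
    define E where "E = energy (m - a) (m + 2 + a) g"
    \<comment> \<open>The error 2^-k / 8 is doubled by \<open>Lp_L1_bound\<close> on a unit
      interval; it then takes half of the bound 2^-k / 2 for the pairing with f and leaves 2^-k /
      4.\<close>
    obtain F where F: "finite F" "F \<subseteq> \<Lambda>"
      and ap: "\<And>F'. finite F' \<Longrightarrow> F \<subseteq> F' \<Longrightarrow> F' \<subseteq> \<Lambda> \<Longrightarrow> lp_norm p (\<lambda>y. f y - (\<Sum>n\<in>F'. us n f * gabor g n y)) < (1/2) ^ k / 8"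
      by (rule frame_approx[OF p1 \<open>uncond_schauder_frame p \<Lambda> (gabor g) us\<close> fL, of "(1/2) ^ k / 8"], simp, rule that)
    define v where "v y = f y - (\<Sum>n\<in>F. us n f * gabor g n y)" for y
    have SL: "(\<lambda>y. \<Sum>n\<in>F. us n f * gabor g n y) \<in> Lp p"
      by (intro Lp_sum[OF p1] Lp_cmult[OF p1] u)
    have vL: "v \<in> Lp p" unfolding v_def by (intro Lp_diff[OF p1] fL SL)
    have vn: "lp_norm p v \<le> (1/2) ^ k / 8"
      using ap[OF F(1) order_refl F(2)] by (simp add: v_def[abs_def])
    have lower: "(1/2) ^ k / 4 \<le> (\<Sum>n\<in>F. norm (us n f) * norm (window g m (snd n + fst z, snd z - fst n)))"
      if z: "z \<in> Z0" for z
    proof -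
      define \<sigma> r where "\<sigma> = fst z" and "r = snd z"
      have zr: "0 \<le> \<sigma>" "\<sigma> \<le> 1/16" "0 \<le> r" "r \<le> 1" using z by (auto simp: Z0_def \<sigma>_def r_def)
      define X where "X w = (\<integral>x. indicator {m + r..m + r + 1} x * (modul \<sigma> (x - m) * w x) \<partial>lborel)" for w
      have mm[measurable]: "(\<lambda>x. modul \<sigma> (x - m)) \<in> borel_measurable borel" unfolding modul_def by measurable
      have iX: "integrable lborel (\<lambda>x. indicator {m + r..m + r + 1} x * (modul \<sigma> (x - m) * w x))" if "w \<in> Lp p" for w
      proof -
        have "(\<lambda>x. modul \<sigma> (x - m) * w x) \<in> Lp p"
          by (rule Lp_dominated(1)[OF _ that]) (use LpD(1)[OF that] p1 in \<open>auto simp: norm_mult\<close>)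
        from Lp_integrable_on_interval[OF p1 this] show ?thesis .
      qed
      have Xf: "(1/2) ^ k / 2 \<le> Re (X f)"
      proof -
        have "(1/2::real) ^ k / 2 = (\<integral>x. (1/2) ^ k / 2 * indicator {m + r..m + r + 1} x \<partial>lborel)" by simp
        also have "\<dots> \<le> (\<integral>x. Re (indicator {m + r..m + r + 1} x * (modul \<sigma> (x - m) * f x)) \<partial>lborel)"
        proof (rule integral_mono)
          show "integrable lborel (\<lambda>x. Re (indicator {m + r..m + r + 1} x * (modul \<sigma> (x - m) * f x)))"
            using iX[OF fL] by (rule integrable_Re)
          fix x
          show "(1/2) ^ k / 2 * indicator {m + r..m + r + 1} x \<le> Re (indicator {m + r..m + r + 1} x * (modul \<sigma> (x - m) * f x))"
          proof (cases "x \<in> {m + r..m + r + 1}")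
            case True
            have x: "0 \<le> x - m" "x - m \<le> 2" using True zr by auto
            have "\<sigma> * (x - m) \<le> 1/16 * 2" using zr x by (intro mult_mono) auto
            moreover have "0 \<le> \<sigma> * (x - m)" using zr x by simp
            ultimately have "\<bar>2 * pi * (\<sigma> * (x - m))\<bar> \<le> pi / 3"
              using mult_left_mono[of "\<sigma> * (x - m)" "1/8" "2 * pi"] by simp
            then have c: "1 / 2 \<le> Re (modul \<sigma> (x - m))" unfolding Re_modul by (rule cos_ge_half)
            have fx: "(1/2) ^ k \<le> fre x" using fre_lower[of x k] x by (simp add: m_def)
            have "(1/2) * (1/2) ^ k \<le> Re (modul \<sigma> (x - m)) * fre x"
              using c fx by (intro mult_mono) auto
            then show ?thesis using True by (simp add: f_fre)
          qed simp
        qed simp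
        also have "\<dots> = Re (X f)" unfolding X_def by (rule integral_Re[OF iX[OF fL]])
        finally show ?thesis .
      qed
      have "norm (X v) \<le> (\<integral>x. norm (indicator {m + r..m + r + 1} x * (modul \<sigma> (x - m) * v x)) \<partial>lborel)"
        unfolding X_def by (rule integral_norm_bound)
      also have "\<dots> = (\<integral>x. norm (indicator {m + r..m + r + 1} x * v x) \<partial>lborel)" by (simp add: norm_mult)
      also have "\<dots> \<le> ((m + r + 1) - (m + r) + 1) * lp_norm p v" by (rule Lp_L1_bound[OF p1 vL]) simp
      finally have Xv: "norm (X v) \<le> (1/2) ^ k / 4" using vn by simp
      have "X f - X v = (\<integral>x. indicator {m + r..m + r + 1} x * (modul \<sigma> (x - m) * f x)
          - indicator {m + r..m + r + 1} x * (modul \<sigma> (x - m) * v x) \<partial>lborel)"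
        unfolding X_def by (rule Bochner_Integration.integral_diff[OF iX[OF fL] iX[OF vL], symmetric])
      also have "\<dots> = (\<integral>x. (\<Sum>n\<in>F. us n f * (indicator {m + r..m + r + 1} x * (modul \<sigma> (x - m) * gabor g n x))) \<partial>lborel)"
      proof (rule Bochner_Integration.integral_cong[OF refl])
        fix x
        have "indicator {m + r..m + r + 1} x * (modul \<sigma> (x - m) * f x) - indicator {m + r..m + r + 1} x * (modul \<sigma> (x - m) * v x)
          = indicator {m + r..m + r + 1} x * (modul \<sigma> (x - m) * (\<Sum>n\<in>F. us n f * gabor g n x))"
          by (simp only: v_def right_diff_distrib) simp
        also have "\<dots> = (\<Sum>n\<in>F. us n f * (indicator {m + r..m + r + 1} x * (modul \<sigma> (x - m) * gabor g n x)))"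
          unfolding sum_distrib_left by (intro sum.cong refl) (simp only: mult_ac)
        finally show "indicator {m + r..m + r + 1} x * (modul \<sigma> (x - m) * f x) - indicator {m + r..m + r + 1} x * (modul \<sigma> (x - m) * v x)
          = (\<Sum>n\<in>F. us n f * (indicator {m + r..m + r + 1} x * (modul \<sigma> (x - m) * gabor g n x)))" .
      qed
      also have "\<dots> = (\<Sum>n\<in>F. us n f * X (gabor g n))"
        unfolding X_def
        by (subst Bochner_Integration.integral_sum, intro integrable_mult_right iX u) (simp only: integral_mult_right_zero)
      finally have "Re (X f) - Re (X v) \<le> norm (\<Sum>n\<in>F. us n f * X (gabor g n))"
        by (metis complex_Re_le_cmod minus_complex.simps(1))
      also have "\<dots> \<le> (\<Sum>n\<in>F. norm (us n f * X (gabor g n)))" by (rule norm_sum)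
      also have "\<dots> = (\<Sum>n\<in>F. norm (us n f) * norm (window g m (snd n + fst z, snd z - fst n)))"
      proof (rule sum.cong[OF refl])
        fix n
        show "norm (us n f * X (gabor g n)) = norm (us n f) * norm (window g m (snd n + fst z, snd z - fst n))"
          using window_shift[of m r \<sigma> g "fst n" "snd n"] by (cases n) (simp add: norm_mult X_def \<sigma>_def r_def)
      qed
      finally show ?thesis using Xf Xv complex_Re_le_cmod[of "X v"] by linarith
    qed
    have upper: "(\<Sum>n\<in>F. norm (us n f) * norm (window g m (of_int \<lfloor>snd n\<rfloor> + fst z, snd z))) \<le> K * sqrt E"
      if z: "z \<in> Z1" for z
    proof -
      define W where "W j = norm (window g m (of_int j + fst z, snd z))" for j :: int
      have "\<exists>h\<in>H. \<delta> \<le> norm (interval_pairing g (fst h) (snd h) (fst n) (frac (snd n)))" if "n \<in> F" for n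
      proof -
        have "fst n \<in> {-a..a}" using that F strip by auto
        moreover have "frac (snd n) \<in> {0..1}" using frac_lt_1[of "snd n"] by (simp add: less_imp_le)
        ultimately show ?thesis using cov by blast
      qed
      then have "\<forall>n\<in>F. \<exists>h. h \<in> H \<and> \<delta> \<le> norm (interval_pairing g (fst h) (snd h) (fst n) (frac (snd n)))" by blast
      then obtain c where c': "\<forall>n\<in>F. c n \<in> H \<and> \<delta> \<le> norm (interval_pairing g (fst (c n)) (snd (c n)) (fst n) (frac (snd n)))"
        by (rule exE[OF bchoice])
      have c: "c n \<in> H" "\<delta> \<le> norm (interval_pairing g (fst (c n)) (snd (c n)) (fst n) (frac (snd n)))" if "n \<in> F" for n
        using bspec[OF c' that] by simp_all
      have "(\<Sum>n\<in>F. norm (us n f) * W \<lfloor>snd n\<rfloor>) = (\<Sum>h\<in>H. \<Sum>n | n \<in> F \<and> c n = h. norm (us n f) * W \<lfloor>snd n\<rfloor>)"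
        by (rule sum.group[symmetric, OF F(1) H]) (use c in auto)
      also have "\<dots> \<le> (\<Sum>h\<in>H. sqrt (B h) * sqrt E)"
      proof (rule sum_mono)
        fix h assume "h \<in> H"
        define Fh where "Fh = {n \<in> F. c n = h}"
        define J where "J = (\<lambda>n. \<lfloor>snd n\<rfloor>) ` Fh"
        define A where "A j = (\<Sum>n | n \<in> Fh \<and> \<lfloor>snd n\<rfloor> = j. norm (us n f))" for j
        have Fh: "finite Fh" "Fh \<subseteq> \<Lambda>" "finite J" using F by (auto simp: Fh_def J_def)
        have "(\<Sum>n\<in>Fh. norm (us n f) * W \<lfloor>snd n\<rfloor>) = (\<Sum>j\<in>J. \<Sum>n | n \<in> Fh \<and> \<lfloor>snd n\<rfloor> = j. norm (us n f) * W \<lfloor>snd n\<rfloor>)"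
          by (rule sum.group[symmetric, OF Fh(1,3)]) (simp add: J_def)
        also have "\<dots> = (\<Sum>j\<in>J. A j * W j)"
          unfolding A_def sum_distrib_right by (intro sum.cong refl) auto
        also have "\<dots> \<le> sqrt (\<Sum>j\<in>J. (A j)\<^sup>2) * sqrt E"
          unfolding W_def E_def
          by (rule window_bessel[OF p2 g Fh(3)]) (use z a in \<open>auto simp: A_def Z1_def intro!: sum_nonneg\<close>)
        also have "\<dots> \<le> sqrt (B h) * sqrt E"
        proof (intro mult_right_mono real_sqrt_le_mono)
          show "(\<Sum>j\<in>J. (A j)\<^sup>2) \<le> B h"
            unfolding J_def A_def by (rule B[OF Fh(1,2)]) (use c(2) in \<open>auto simp: Fh_def\<close>)
        qed (simp add: E_def)
        finally show "(\<Sum>n | n \<in> F \<and> c n = h. norm (us n f) * W \<lfloor>snd n\<rfloor>) \<le> sqrt (B h) * sqrt E"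
          by (simp add: Fh_def)
      qed
      also have "\<dots> = K * sqrt E" by (simp add: K_def sum_distrib_right)
      finally show ?thesis by (simp add: W_def)
    qed
    note wm[measurable] = window_measurable[OF gm, of m]
    note Z01[measurable]
    \<comment> \<open>Translation by (frac s, -t) replaces the frequency s by its integer part and
      removes t, so all points of a cell meet the same window. Translation invariance allows this at
      the price of the larger box \<open>Z1\<close>.\<close>
    have sh: "(\<integral>\<^sup>+z. indicator Z0 z * ennreal (norm (window g m (snd n + fst z, snd z - fst n))) \<partial>lborel)
        \<le> (\<integral>\<^sup>+z. indicator Z1 z * ennreal (norm (window g m (of_int \<lfloor>snd n\<rfloor> + fst z, snd z))) \<partial>lborel)"
      if n: "n \<in> F" for n
    proof -
      have t: "fst n \<in> {-a..a}" using that F strip by auto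
      define w where "w = (frac (snd n), - fst n)"
      define q where "q z = indicator Z1 z * ennreal (norm (window g m (of_int \<lfloor>snd n\<rfloor> + fst z, snd z)))" for z
      have qm: "q \<in> borel_measurable borel"
      proof -
        have "(\<lambda>z. (of_int \<lfloor>snd n\<rfloor> + fst z, snd z) :: real \<times> real) \<in> borel_measurable borel"
          by (intro borel_measurable_continuous_onI continuous_intros)
        from measurable_compose[OF this wm] show ?thesis unfolding q_def by measurable
      qed
      have "(\<integral>\<^sup>+z. indicator Z0 z * ennreal (norm (window g m (snd n + fst z, snd z - fst n))) \<partial>lborel)
          \<le> (\<integral>\<^sup>+z. q (w + z) \<partial>lborel)"
      proof (rule nn_integral_mono)
        fix z :: "real \<times> real"
        have "window g m (of_int \<lfloor>snd n\<rfloor> + fst (w + z), snd (w + z)) = window g m (snd n + fst z, snd z - fst n)"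
          by (simp add: w_def frac_def)
        moreover have "z \<in> Z0 \<Longrightarrow> w + z \<in> Z1"
          using t frac_lt_1[of "snd n"] frac_ge_0[of "snd n"] by (auto simp: Z0_def Z1_def w_def)
        ultimately show "indicator Z0 z * ennreal (norm (window g m (snd n + fst z, snd z - fst n))) \<le> q (w + z)"
          by (auto simp: q_def indicator_def)
      qed
      also have "\<dots> = (\<integral>\<^sup>+z. q z \<partial>distr lborel borel ((+) w))"
        using qm by (subst nn_integral_distr) auto
      also have "distr lborel borel ((+) w) = lborel" by (rule lborel_distr_plus)
      finally show ?thesis by (simp add: q_def)
    qed
    have "ennreal ((1/2) ^ k / 4 * (1/16)) = (\<integral>\<^sup>+z. ennreal ((1/2) ^ k / 4) * indicator Z0 z \<partial>lborel)"
      using mZ0 by (subst nn_integral_cmult_indicator) (auto simp flip: ennreal_mult)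
    also have "\<dots> \<le> (\<integral>\<^sup>+z. (\<Sum>n\<in>F. ennreal (norm (us n f)) * (indicator Z0 z * ennreal (norm (window g m (snd n + fst z, snd z - fst n))))) \<partial>lborel)"
    proof (rule nn_integral_mono)
      fix z :: "real \<times> real"
      show "ennreal ((1/2) ^ k / 4) * indicator Z0 z \<le> (\<Sum>n\<in>F. ennreal (norm (us n f)) * (indicator Z0 z * ennreal (norm (window g m (snd n + fst z, snd z - fst n)))))"
      proof (cases "z \<in> Z0")
        case True
        have "ennreal ((1/2) ^ k / 4) \<le> ennreal (\<Sum>n\<in>F. norm (us n f) * norm (window g m (snd n + fst z, snd z - fst n)))"
          by (rule ennreal_leI[OF lower[OF True]])
        then show ?thesis using True by (simp add: sum_ennreal[symmetric] ennreal_mult)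
      qed simp
    qed
    also have "\<dots> = (\<Sum>n\<in>F. ennreal (norm (us n f)) * (\<integral>\<^sup>+z. indicator Z0 z * ennreal (norm (window g m (snd n + fst z, snd z - fst n))) \<partial>lborel))"
      (is "?lhs = ?rhs")
    proof -
      have "(\<lambda>z. (snd n + fst z, snd z - fst n) :: real \<times> real) \<in> borel_measurable borel" for n :: "real \<times> real"
        by (intro borel_measurable_continuous_onI continuous_intros)
      from measurable_compose[OF this wm] have [measurable]: "(\<lambda>z. window g m (snd n + fst z, snd z - fst n)) \<in> borel_measurable borel" for n .
      have "?lhs = (\<Sum>n\<in>F. \<integral>\<^sup>+z. ennreal (norm (us n f)) * (indicator Z0 z * ennreal (norm (window g m (snd n + fst z, snd z - fst n)))) \<partial>lborel)"
        by (rule nn_integral_sum) measurable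
      also have "\<dots> = ?rhs"
        by (intro sum.cong refl nn_integral_cmult) measurable
      finally show ?thesis .
    qed
    also have "\<dots> \<le> (\<Sum>n\<in>F. ennreal (norm (us n f)) * (\<integral>\<^sup>+z. indicator Z1 z * ennreal (norm (window g m (of_int \<lfloor>snd n\<rfloor> + fst z, snd z))) \<partial>lborel))"
      by (intro sum_mono mult_left_mono sh) auto
    also have "\<dots> = (\<integral>\<^sup>+z. (\<Sum>n\<in>F. ennreal (norm (us n f)) * (indicator Z1 z * ennreal (norm (window g m (of_int \<lfloor>snd n\<rfloor> + fst z, snd z))))) \<partial>lborel)"
      (is "?lhs = ?rhs")
    proof -
      have "(\<lambda>z. (of_int \<lfloor>snd n\<rfloor> + fst z, snd z) :: real \<times> real) \<in> borel_measurable borel" for n :: "real \<times> real"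
        by (intro borel_measurable_continuous_onI continuous_intros)
      from measurable_compose[OF this wm] have [measurable]: "(\<lambda>z. window g m (of_int \<lfloor>snd n\<rfloor> + fst z, snd z)) \<in> borel_measurable borel" for n :: "real \<times> real" .
      have "?rhs = (\<Sum>n\<in>F. \<integral>\<^sup>+z. ennreal (norm (us n f)) * (indicator Z1 z * ennreal (norm (window g m (of_int \<lfloor>snd n\<rfloor> + fst z, snd z)))) \<partial>lborel)"
        by (rule nn_integral_sum) measurable
      also have "\<dots> = ?lhs"
        by (intro sum.cong refl nn_integral_cmult) measurable
      finally show ?thesis by (rule sym)
    qed
    also have "\<dots> \<le> (\<integral>\<^sup>+z. ennreal (K * sqrt E) * indicator Z1 z \<partial>lborel)"
    proof (rule nn_integral_mono)
      fix z :: "real \<times> real"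
      show "(\<Sum>n\<in>F. ennreal (norm (us n f)) * (indicator Z1 z * ennreal (norm (window g m (of_int \<lfloor>snd n\<rfloor> + fst z, snd z)))))
        \<le> ennreal (K * sqrt E) * indicator Z1 z"
      proof (cases "z \<in> Z1")
        case True
        from ennreal_leI[OF upper[OF True]] show ?thesis
          using True by (simp add: sum_ennreal[symmetric] ennreal_mult)
      qed simp
    qed
    also have "\<dots> = ennreal (K * sqrt E * (2 * (1 + 2 * a)))"
      using mZ1 a B0 by (subst nn_integral_cmult_indicator) (auto simp: K_def E_def ennreal_mult sum_nonneg)
    finally have "(1/2) ^ k / 4 * (1/16) \<le> K * sqrt E * (2 * (1 + 2 * a))"
      using a B0 by (subst (asm) ennreal_le_iff) (auto simp: K_def E_def intro!: mult_nonneg_nonneg sum_nonneg)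
    also have "\<dots> \<le> K * (1/4) ^ k * (2 * (1 + 2 * a))"
    proof -
      have "sqrt E \<le> sqrt ((1/16) ^ k)" using M[of k] by (simp add: E_def m_def)
      also have "(1/16::real) ^ k = ((1/4) ^ k)\<^sup>2" by (simp add: power2_eq_square flip: power_mult_distrib)
      finally have "sqrt E \<le> (1/4) ^ k" by simp
      then show ?thesis using a B0 by (intro mult_right_mono mult_left_mono) (auto simp: K_def intro!: sum_nonneg)
    qed
    finally show ?thesis by simp
  qed
  obtain k :: nat where k: "K * (2 * (1 + 2 * a)) * 64 < 2 ^ k"
    using real_arch_pow[of 2] by force
  have "(1/2::real) ^ k = (1/4) ^ k * 2 ^ k" by (simp flip: power_mult_distrib)
  then have "(1/4) ^ k * 2 ^ k \<le> 64 * (K * (1/4) ^ k * (2 * (1 + 2 * a)))"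
    using main[of k] by linarith
  also have "\<dots> = (1/4) ^ k * (K * (2 * (1 + 2 * a)) * 64)" by (simp only: mult_ac)
  finally have "2 ^ k \<le> K * (2 * (1 + 2 * a)) * 64"
    by (rule mult_left_le_imp_le) simp
  with k show False by simp
qed

section \<open>A Bellman function\<close>

text \<open>The function \<open>bell k x y\<close> below, with \<open>p = 2 k + 2\<close>, is concave along \<open>(x + t a, y + t \<theta> a)\<close> for small \<open>\<theta>\<close> and
  dominates \<open>\<bar>y\<bar>\<^sup>p / 2 - C \<bar>x\<bar>\<^sup>p\<close>; following it through the dyadic tree bounds Haar multipliers. Here \<open>X, Y, A\<close>
  are the squared norms of \<open>x, y, a\<close> and \<open>\<alpha>, \<gamma>\<close> the inner products of \<open>x, y\<close> with \<open>a\<close>.\<close>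

lemma bell_second_derivative_sign:
  fixes k \<theta> A X Y \<alpha> \<gamma> :: real
  assumes k: "0 \<le> k" and \<theta>: "\<bar>\<theta>\<bar> \<le> 1 / (1 + 40 * k + 40 * k\<^sup>2)"
    and A: "0 \<le> A" and X: "0 \<le> X" and Y: "0 \<le> Y" and \<alpha>: "\<alpha>\<^sup>2 \<le> A * X" and \<gamma>: "\<gamma>\<^sup>2 \<le> A * Y"
  defines "\<beta> \<equiv> 4 * k + 4" and "\<rho> \<equiv> X + Y" and "w \<equiv> \<alpha> + \<theta> * \<gamma>"
  shows "k * (2 * (k - 1) * w\<^sup>2 + (1 + \<theta>\<^sup>2) * A * \<rho>) * (Y - \<beta> * X)
    + 4 * k * \<rho> * w * (\<theta> * \<gamma> - \<beta> * \<alpha>) + \<rho>\<^sup>2 * A * (\<theta>\<^sup>2 - \<beta>) \<le> 0"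
proof -
  \<comment> \<open>The \<theta>-terms are perturbations of order \<open>\<tau>\<close>. In
    \<open>coef\<close> the value \<open>\<beta>\<close> = 4k + 4 has to dominate 5/2 k plus their
    total.\<close>
  define \<tau> where "\<tau> = 1 / (1 + 40 * k + 40 * k\<^sup>2)"
  have den: "1 \<le> 1 + 40 * k + 40 * k\<^sup>2" using k by simp
  have \<tau>: "0 < \<tau>" "\<tau> \<le> 1" "\<bar>\<theta>\<bar> \<le> \<tau>" "\<tau> * (1 + 40 * k + 40 * k\<^sup>2) = 1"
    using den \<theta> by (auto simp: \<tau>_def)
  have \<beta>: "0 < \<beta>" "1 \<le> \<beta>" using k by (auto simp: \<beta>_def)
  have \<rho>: "0 \<le> \<rho>" "X \<le> \<rho>" "Y \<le> \<rho>" using X Y by (auto simp: \<rho>_def)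
  have A\<rho>: "0 \<le> A * \<rho>" using A \<rho> by simp
  have \<theta>2: "\<theta>\<^sup>2 \<le> \<tau>" "\<theta>\<^sup>2 \<le> 1"
  proof -
    have "\<theta>\<^sup>2 = \<bar>\<theta>\<bar> * \<bar>\<theta>\<bar>" by (simp add: power2_eq_square)
    also have "\<dots> \<le> \<tau> * 1" by (rule mult_mono) (use \<tau> in auto)
    finally show "\<theta>\<^sup>2 \<le> \<tau>" by simp
    then show "\<theta>\<^sup>2 \<le> 1" using \<tau> by simp
  qed
  have \<alpha>\<gamma>: "2 * \<bar>\<alpha> * \<gamma>\<bar> \<le> A * \<rho>"
  proof -
    have "2 * (\<bar>\<alpha>\<bar> * \<bar>\<gamma>\<bar>) \<le> \<alpha>\<^sup>2 + \<gamma>\<^sup>2" using sum_squares_bound[of "\<bar>\<alpha>\<bar>" "\<bar>\<gamma>\<bar>"] by simp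
    also have "\<dots> \<le> A * \<rho>" using \<alpha> \<gamma> by (simp add: \<rho>_def distrib_left)
    finally show ?thesis by (simp add: abs_mult)
  qed
  have \<theta>\<alpha>\<gamma>: "2 * \<bar>\<theta> * (\<alpha> * \<gamma>)\<bar> \<le> \<tau> * (A * \<rho>)"
  proof -
    have "2 * \<bar>\<theta> * (\<alpha> * \<gamma>)\<bar> = \<bar>\<theta>\<bar> * (2 * \<bar>\<alpha> * \<gamma>\<bar>)" by (simp add: abs_mult)
    also have "\<dots> \<le> \<tau> * (A * \<rho>)" by (rule mult_mono) (use \<tau> \<alpha>\<gamma> in auto)
    finally show ?thesis .
  qed
  have \<theta>\<gamma>: "\<theta>\<^sup>2 * \<gamma>\<^sup>2 \<le> \<tau> * (A * \<rho>)"
  proof -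
    have "\<gamma>\<^sup>2 \<le> A * \<rho>" using \<gamma> A X by (simp add: \<rho>_def distrib_left add_increasing)
    then show ?thesis by (intro mult_mono[of "\<theta>\<^sup>2" \<tau>]) (use \<theta>2 \<tau> in auto)
  qed
  have w2: "w\<^sup>2 \<le> \<alpha>\<^sup>2 + 2 * \<tau> * (A * \<rho>)"
  proof -
    have "w\<^sup>2 = \<alpha>\<^sup>2 + 2 * (\<theta> * (\<alpha> * \<gamma>)) + \<theta>\<^sup>2 * \<gamma>\<^sup>2" by (simp add: w_def power2_eq_square algebra_simps)
    then show ?thesis using \<theta>\<alpha>\<gamma> \<theta>\<gamma> by linarith
  qed
  \<comment> \<open>The good term -\<beta> \<alpha>^2 is kept exactly, since it must later absorb a
    term of \<open>first\<close>; the rest carries \<open>\<theta>\<close> and is estimated by size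
    only.\<close>
  have cross: "w * (\<theta> * \<gamma> - \<beta> * \<alpha>) \<le> - \<beta> * \<alpha>\<^sup>2 + \<tau> * (1 + \<beta>) * (A * \<rho>)"
  proof -
    have "w * (\<theta> * \<gamma> - \<beta> * \<alpha>) = \<theta> * (\<alpha> * \<gamma>) - \<beta> * \<alpha>\<^sup>2 + \<theta>\<^sup>2 * \<gamma>\<^sup>2 - \<beta> * (\<theta> * (\<alpha> * \<gamma>))"
      by (simp add: w_def power2_eq_square algebra_simps)
    moreover have "\<beta> * (- (\<theta> * (\<alpha> * \<gamma>))) \<le> \<beta> * (\<tau> * (A * \<rho>) / 2)"
      using \<theta>\<alpha>\<gamma> \<beta> by (intro mult_left_mono) auto
    moreover have "\<tau> * (A * \<rho>) / 2 \<le> \<beta> * (\<tau> * (A * \<rho>) / 2)"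
      using \<beta> \<tau> A\<rho> mult_right_mono[of 1 \<beta> "\<tau> * (A * \<rho>) / 2"] by simp
    ultimately have "w * (\<theta> * \<gamma> - \<beta> * \<alpha>) \<le> - (\<beta> * \<alpha>\<^sup>2) + \<tau> * (A * \<rho>) + 2 * (\<beta> * (\<tau> * (A * \<rho>) / 2))"
      using \<theta>\<alpha>\<gamma> \<theta>\<gamma> by linarith
    then show ?thesis by (simp add: algebra_simps)
  qed
  define B where "B = 2 * (k - 1) * w\<^sup>2 + (1 + \<theta>\<^sup>2) * A * \<rho>"
  have eqB: "B = 2 * (k * w\<^sup>2) - 2 * w\<^sup>2 + (1 + \<theta>\<^sup>2) * (A * \<rho>)" by (simp add: B_def algebra_simps)
  define N where "N = Y - \<beta> * X"
  have crossk: "4 * k * \<rho> * w * (\<theta> * \<gamma> - \<beta> * \<alpha>) \<le> 4 * k * \<rho> * (- \<beta> * \<alpha>\<^sup>2 + \<tau> * (1 + \<beta>) * (A * \<rho>))"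
    using mult_left_mono[OF cross, of "4 * k * \<rho>"] k \<rho> by (simp add: mult.assoc)
  have last: "\<rho>\<^sup>2 * A * (\<theta>\<^sup>2 - \<beta>) \<le> \<rho>\<^sup>2 * A * (\<tau> - \<beta>)"
    using \<theta>2 A by (intro mult_left_mono) auto
  have \<rho>A: "0 \<le> A * \<rho>\<^sup>2" using A by simp
  \<comment> \<open>If N \<ge> 0, then X is at most \<rho> / (1 + \<beta>), which controls k w^2 and
    bounds B. If N < 0, only the part -2 w^2 of B hurts, and the \<alpha>^2-term it leaves is
    absorbed by the cross term.\<close>
  have first: "k * B * N \<le> 4 * k * \<beta> * \<rho> * \<alpha>\<^sup>2 + A * \<rho>\<^sup>2 * (5 / 2 * k + 4 * k\<^sup>2 * \<tau> + 4 * k * \<tau> * \<beta>)"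
  proof (cases "0 \<le> N")
    case True
    have NX: "(1 + \<beta>) * X \<le> \<rho>" using True by (simp add: N_def \<rho>_def algebra_simps)
    have b1: "B \<le> 2 * k * w\<^sup>2 + 2 * (A * \<rho>)"
    proof -
      have "(1 + \<theta>\<^sup>2) * (A * \<rho>) \<le> 2 * (A * \<rho>)" using \<theta>2 A\<rho> by (intro mult_right_mono) auto
      then show ?thesis using zero_le_power2[of w] eqB by linarith
    qed
    have b2: "2 * k * w\<^sup>2 \<le> 2 * k * (\<alpha>\<^sup>2 + 2 * \<tau> * (A * \<rho>))" using k w2 by (intro mult_left_mono) auto
    have b3: "2 * k * (\<alpha>\<^sup>2 + 2 * \<tau> * (A * \<rho>)) \<le> 2 * k * (A * X + 2 * \<tau> * (A * \<rho>))"
      using k \<alpha> by (intro mult_left_mono add_right_mono) auto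
    have b4: "2 * k * (A * X + 2 * \<tau> * (A * \<rho>)) = A * (2 * k * X) + 4 * k * \<tau> * (A * \<rho>)" by (simp add: algebra_simps)
    have B1: "B \<le> A * (2 * k * X) + 4 * k * \<tau> * (A * \<rho>) + 2 * (A * \<rho>)" using b1 b2 b3 b4 by linarith
    have "4 * k * X \<le> (1 + \<beta>) * X" using X k by (intro mult_right_mono) (auto simp: \<beta>_def)
    then have "2 * k * X \<le> \<rho> / 2" using NX by linarith
    then have "A * (2 * k * X) \<le> A * (\<rho> / 2)" using A by (rule mult_left_mono)
    with B1 have "B \<le> A * (\<rho> / 2) + 4 * k * \<tau> * (A * \<rho>) + 2 * (A * \<rho>)" by linarith
    also have "\<dots> = A * \<rho> * (5 / 2 + 4 * k * \<tau>)" by (simp add: algebra_simps)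
    finally have B: "B \<le> A * \<rho> * (5 / 2 + 4 * k * \<tau>)" .
    have "k * B * N \<le> k * (A * \<rho> * (5 / 2 + 4 * k * \<tau>)) * N"
      using B k True by (intro mult_right_mono mult_left_mono) auto
    also have "\<dots> \<le> k * (A * \<rho> * (5 / 2 + 4 * k * \<tau>)) * \<rho>"
    proof (intro mult_left_mono mult_nonneg_nonneg)
      show "N \<le> \<rho>" using X Y \<beta> by (simp add: N_def \<rho>_def) (smt (verit) mult_nonneg_nonneg)
    qed (use k A \<rho> \<tau> in auto)
    also have "\<dots> = A * \<rho>\<^sup>2 * (5 / 2 * k + 4 * k\<^sup>2 * \<tau>)" by (simp add: algebra_simps power2_eq_square)
    also have "\<dots> \<le> A * \<rho>\<^sup>2 * (5 / 2 * k + 4 * k\<^sup>2 * \<tau> + 4 * k * \<tau> * \<beta>)"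
      using \<rho>A k \<tau> \<beta> by (intro mult_left_mono) auto
    also have "\<dots> \<le> 4 * k * \<beta> * \<rho> * \<alpha>\<^sup>2 + \<dots>" using k \<beta> \<rho> by simp
    finally show ?thesis .
  next
    case False
    have B: "- B \<le> 2 * \<alpha>\<^sup>2 + 4 * \<tau> * (A * \<rho>)"
    proof -
      have "- B \<le> 2 * w\<^sup>2"
      proof -
        have "0 \<le> (1 + \<theta>\<^sup>2) * (A * \<rho>)" "0 \<le> k * w\<^sup>2" using A\<rho> k by simp_all
        then show ?thesis using eqB by linarith
      qed
      then show ?thesis using w2 by linarith
    qed
    have N: "- N \<le> \<beta> * \<rho>" "0 \<le> - N"
    proof -
      have "\<beta> * X \<le> \<beta> * \<rho>" using \<beta> \<rho> by simp
      then show "- N \<le> \<beta> * \<rho>" "0 \<le> - N" using Y False by (auto simp: N_def)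
    qed
    have "k * B * N = k * ((- B) * (- N))" by simp
    also have "\<dots> \<le> k * ((2 * \<alpha>\<^sup>2 + 4 * \<tau> * (A * \<rho>)) * (\<beta> * \<rho>))"
      using N B k A\<rho> \<tau> by (intro mult_left_mono[OF order.trans[OF mult_right_mono mult_left_mono]]) auto
    also have "\<dots> = 2 * k * \<beta> * \<rho> * \<alpha>\<^sup>2 + A * \<rho>\<^sup>2 * (4 * k * \<tau> * \<beta>)" by (simp add: algebra_simps power2_eq_square)
    also have "\<dots> \<le> 4 * k * \<beta> * \<rho> * \<alpha>\<^sup>2 + A * \<rho>\<^sup>2 * (5 / 2 * k + 4 * k\<^sup>2 * \<tau> + 4 * k * \<tau> * \<beta>)"
      using \<rho>A k \<tau> \<beta> \<rho> by (intro add_mono mult_left_mono mult_right_mono) auto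
    finally show ?thesis .
  qed
  \<comment> \<open>The multiples of \<open>\<tau>\<close> collect to 1 + 36 k + 36 k^2, which is
    the origin of the denominator in the bound on \<open>\<theta>\<close>: together they contribute
    at most 1, and 5/2 k + 1 \<le> \<open>\<beta>\<close>.\<close>
  have coef: "5 / 2 * k + 4 * k\<^sup>2 * \<tau> + 4 * k * \<tau> * \<beta> + 4 * k * \<tau> * (1 + \<beta>) + \<tau> - \<beta> \<le> 0"
  proof -
    have "4 * k\<^sup>2 * \<tau> + 4 * k * \<tau> * \<beta> + 4 * k * \<tau> * (1 + \<beta>) + \<tau> = \<tau> * (1 + 36 * k + 36 * k\<^sup>2)"
      by (simp add: \<beta>_def algebra_simps power2_eq_square)
    also have "\<dots> \<le> \<tau> * (1 + 40 * k + 40 * k\<^sup>2)" using \<tau> k by (intro mult_left_mono) auto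
    finally show ?thesis using \<tau>(4) k by (simp add: \<beta>_def)
  qed
  have "k * B * N + 4 * k * \<rho> * w * (\<theta> * \<gamma> - \<beta> * \<alpha>) + \<rho>\<^sup>2 * A * (\<theta>\<^sup>2 - \<beta>)
    \<le> (4 * k * \<beta> * \<rho> * \<alpha>\<^sup>2 + A * \<rho>\<^sup>2 * (5 / 2 * k + 4 * k\<^sup>2 * \<tau> + 4 * k * \<tau> * \<beta>))
      + 4 * k * \<rho> * (- \<beta> * \<alpha>\<^sup>2 + \<tau> * (1 + \<beta>) * (A * \<rho>)) + \<rho>\<^sup>2 * A * (\<tau> - \<beta>)"
    by (intro add_mono first crossk last)
  also have "\<dots> = A * \<rho>\<^sup>2 * (5 / 2 * k + 4 * k\<^sup>2 * \<tau> + 4 * k * \<tau> * \<beta> + 4 * k * \<tau> * (1 + \<beta>) + \<tau> - \<beta>)"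
    by (simp add: algebra_simps power2_eq_square)
  also have "\<dots> \<le> 0" using \<rho>A coef by (rule mult_nonneg_nonpos)
  finally show ?thesis by (simp add: B_def N_def)
qed

text \<open>Along a line both squared norms are quadratic in t, and \<open>pos\<close> keeps their
  sum positive so that the real power is smooth. The second derivative is 2 \<rho>^(k - 2) times the
  expression of \<open>bell_second_derivative_sign\<close>.\<close>

lemma bell_line_concave:
  fixes k \<theta> A X Y \<alpha> \<gamma> :: real
  assumes k: "0 \<le> k" and \<theta>: "\<bar>\<theta>\<bar> \<le> 1 / (1 + 40 * k + 40 * k\<^sup>2)"
    and A: "0 \<le> A" and \<alpha>: "\<alpha>\<^sup>2 \<le> A * X" and \<gamma>: "\<gamma>\<^sup>2 \<le> A * Y"
    and X: "\<And>t. 0 \<le> X + 2 * t * \<alpha> + t\<^sup>2 * A" and Y: "\<And>t. 0 \<le> Y + 2 * t * (\<theta> * \<gamma>) + t\<^sup>2 * (\<theta>\<^sup>2 * A)"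
    and pos: "\<And>t. 0 < (X + 2 * t * \<alpha> + t\<^sup>2 * A) + (Y + 2 * t * (\<theta> * \<gamma>) + t\<^sup>2 * (\<theta>\<^sup>2 * A))"
  defines "f \<equiv> \<lambda>t. ((X + 2 * t * \<alpha> + t\<^sup>2 * A) + (Y + 2 * t * (\<theta> * \<gamma>) + t\<^sup>2 * (\<theta>\<^sup>2 * A))) powr k
    * ((Y + 2 * t * (\<theta> * \<gamma>) + t\<^sup>2 * (\<theta>\<^sup>2 * A)) - (4 * k + 4) * (X + 2 * t * \<alpha> + t\<^sup>2 * A))"
  shows "f t + f (- t) \<le> 2 * f 0"
proof -
  define \<beta> where "\<beta> = 4 * k + 4"
  define x y \<rho> w N N' where "x t = X + 2 * t * \<alpha> + t\<^sup>2 * A" and "y t = Y + 2 * t * (\<theta> * \<gamma>) + t\<^sup>2 * (\<theta>\<^sup>2 * A)"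
    and "\<rho> t = x t + y t" and "w t = (\<alpha> + t * A) + \<theta> * (\<gamma> + t * (\<theta> * A))" and "N t = y t - \<beta> * x t"
    and "N' t = \<theta> * (\<gamma> + t * (\<theta> * A)) - \<beta> * (\<alpha> + t * A)" for t
  have f: "f t = \<rho> t powr k * N t" for t
    by (simp add: f_def \<rho>_def N_def x_def y_def \<beta>_def)
  have \<rho>pos: "0 < \<rho> t" for t using pos[of t] by (simp add: \<rho>_def x_def y_def)
  have d\<rho>: "(\<rho> has_real_derivative 2 * w t) (at t)" for t
    unfolding \<rho>_def[abs_def] x_def[abs_def] y_def[abs_def] w_def
    by (auto intro!: derivative_eq_intros simp: algebra_simps power2_eq_square)
  have dN: "(N has_real_derivative 2 * N' t) (at t)" for t
    unfolding N_def[abs_def] x_def[abs_def] y_def[abs_def] N'_def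
    by (auto intro!: derivative_eq_intros simp: algebra_simps power2_eq_square)
  have dw: "(w has_real_derivative (1 + \<theta>\<^sup>2) * A) (at t)" for t
    unfolding w_def[abs_def]
    by (auto intro!: derivative_eq_intros simp: algebra_simps power2_eq_square)
  have dN': "(N' has_real_derivative (\<theta>\<^sup>2 - \<beta>) * A) (at t)" for t
    unfolding N'_def[abs_def]
    by (auto intro!: derivative_eq_intros simp: algebra_simps power2_eq_square)
  have dp: "((\<lambda>t. \<rho> t powr c) has_real_derivative c * \<rho> t powr (c - 1) * (2 * w t)) (at t)" for c t
    using DERIV_fun_powr[OF d\<rho>[of t] \<rho>pos[of t], of c] by simp
  define f1 where "f1 t = k * \<rho> t powr (k - 1) * (2 * w t) * N t + \<rho> t powr k * (2 * N' t)" for t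
  define f2 where "f2 t = 2 * \<rho> t powr (k - 2) * (k * (2 * (k - 1) * (w t)\<^sup>2 + (1 + \<theta>\<^sup>2) * A * \<rho> t) * N t
      + 4 * k * \<rho> t * w t * N' t + (\<rho> t)\<^sup>2 * A * (\<theta>\<^sup>2 - \<beta>))" for t
  have "(f has_real_derivative f1 t) (at t)" for t
    unfolding f[abs_def] f1_def
    by (rule derivative_eq_intros dp dN refl)+ (simp add: algebra_simps)
  moreover have "(f1 has_real_derivative f2 t) (at t)" for t
  proof -
    have e: "\<rho> t powr (k - 1) = \<rho> t powr (k - 2) * \<rho> t" "\<rho> t powr k = \<rho> t powr (k - 2) * (\<rho> t)\<^sup>2"
      using \<rho>pos[of t] by (simp_all add: powr_diff powr_numeral power2_eq_square field_simps)
    have "k - 1 - 1 = k - 2" by simp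
    then show ?thesis
      unfolding f1_def[abs_def] f2_def
      by - ((rule derivative_eq_intros dp dN dN' dw refl)+, simp only: e, simp add: algebra_simps power2_eq_square)
  qed
  moreover have "f2 t \<le> 0" for t
  proof -
    have "(\<alpha> + t * A)\<^sup>2 \<le> A * x t" using \<alpha> by (simp add: x_def power2_eq_square algebra_simps)
    moreover have "(\<gamma> + t * (\<theta> * A))\<^sup>2 \<le> A * y t" using \<gamma> by (simp add: y_def power2_eq_square algebra_simps)
    moreover have "0 \<le> x t" "0 \<le> y t" using X[of t] Y[of t] by (auto simp: x_def y_def)
    ultimately show ?thesis
      using bell_second_derivative_sign[OF k \<theta> A, of "x t" "y t" "\<alpha> + t * A" "\<gamma> + t * (\<theta> * A)"]
      unfolding f2_def \<rho>_def w_def N_def N'_def \<beta>_def by (intro mult_nonneg_nonpos) auto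
  qed
  ultimately have "concave_on UNIV f" by (intro f''_le0_imp_concave[of UNIV f f1 f2]) auto
  then have "convex_on UNIV (\<lambda>t. - f t)" by (simp add: concave_on_def)
  from convex_onD[OF this, of "1/2" t "-t"] show ?thesis by simp
qed

definition bell :: "real \<Rightarrow> complex \<Rightarrow> complex \<Rightarrow> real" where
  "bell k x y = ((norm x)\<^sup>2 + (norm y)\<^sup>2) powr k * ((norm y)\<^sup>2 - (4 * k + 4) * (norm x)\<^sup>2)"

lemma square_powr: "(z\<^sup>2) powr k * z\<^sup>2 = \<bar>z\<bar> powr (2 * k + 2)" for z :: real
proof (cases "z = 0")
  case False
  then have "z\<^sup>2 = \<bar>z\<bar> powr 2" by (simp add: powr_numeral)
  then show ?thesis by (simp only: powr_powr flip: powr_add)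
qed simp

text \<open>If the line misses the origin, \<open>bell_line_concave\<close> applies. If x and y
  vanish at a common parameter, \<open>bell\<close> on the line is c |u|^(2k + 2) with c \<le> 0,
  concave because the power is convex.\<close>

lemma bell_concave:
  fixes \<theta> :: real
  assumes k: "0 \<le> k" and \<theta>: "\<bar>\<theta>\<bar> \<le> 1 / (1 + 40 * k + 40 * k\<^sup>2)"
  shows "bell k (x + a) (y + of_real \<theta> * a) + bell k (x - a) (y - of_real \<theta> * a) \<le> 2 * bell k x y"
proof -
  have nx: "(norm (x + of_real t * a))\<^sup>2 = (norm x)\<^sup>2 + 2 * t * (x \<bullet> a) + t\<^sup>2 * (norm a)\<^sup>2" for t x
    unfolding power2_norm_eq_inner scaleR_conv_of_real[symmetric]
    by (simp add: inner_add inner_commute power2_eq_square algebra_simps)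
  show ?thesis
  proof (cases "\<exists>t. x + of_real t * a = 0 \<and> y + of_real (\<theta> * t) * a = 0")
    case False
    have ny: "(norm (y + of_real (\<theta> * t) * a))\<^sup>2 = (norm y)\<^sup>2 + 2 * t * (\<theta> * (y \<bullet> a)) + t\<^sup>2 * (\<theta>\<^sup>2 * (norm a)\<^sup>2)" for t
      by (subst nx) (simp add: power_mult_distrib algebra_simps)
    have pos: "0 < (norm (x + of_real t * a))\<^sup>2 + (norm (y + of_real (\<theta> * t) * a))\<^sup>2" for t
      using False by (auto simp: sum_power2_gt_zero_iff)
    have cs: "(v \<bullet> a)\<^sup>2 \<le> (norm a)\<^sup>2 * (norm v)\<^sup>2" for v :: complex
      using Cauchy_Schwarz_ineq[of v a] by (simp add: power2_norm_eq_inner mult.commute)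
    have bell_t: "bell k (x + of_real t * a) (y + of_real (\<theta> * t) * a) =
        ((norm x)\<^sup>2 + 2 * t * (x \<bullet> a) + t\<^sup>2 * (norm a)\<^sup>2 + ((norm y)\<^sup>2 + 2 * t * (\<theta> * (y \<bullet> a)) + t\<^sup>2 * (\<theta>\<^sup>2 * (norm a)\<^sup>2))) powr k
        * ((norm y)\<^sup>2 + 2 * t * (\<theta> * (y \<bullet> a)) + t\<^sup>2 * (\<theta>\<^sup>2 * (norm a)\<^sup>2) - (4 * k + 4) * ((norm x)\<^sup>2 + 2 * t * (x \<bullet> a) + t\<^sup>2 * (norm a)\<^sup>2))" for t
      unfolding bell_def nx[where x = x] ny ..
    have "bell k (x + of_real 1 * a) (y + of_real (\<theta> * 1) * a) + bell k (x + of_real (-1) * a) (y + of_real (\<theta> * (-1)) * a)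
        \<le> 2 * bell k (x + of_real 0 * a) (y + of_real (\<theta> * 0) * a)"
      unfolding bell_t
      by (rule bell_line_concave[OF k \<theta> _ cs cs, where t = 1])
        (use pos in \<open>auto simp flip: nx ny\<close>)
    then show ?thesis by simp
  next
    case True
    then obtain s where s: "x + of_real s * a = 0" "y + of_real (\<theta> * s) * a = 0" by auto
    then have xy: "x = of_real (- s) * a" "y = of_real (- s) * (of_real \<theta> * a)"
      by (auto simp: add_eq_0_iff mult_ac)
    define c where "c = ((1 + \<theta>\<^sup>2) * (norm a)\<^sup>2) powr k * ((\<theta>\<^sup>2 - (4 * k + 4)) * (norm a)\<^sup>2)"
    have bell_u: "bell k (of_real u * a) (of_real u * (of_real \<theta> * a)) = c * (\<bar>u\<bar> powr (2 * k + 2))" for u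
    proof -
      have "(norm (of_real u * a))\<^sup>2 + (norm (of_real u * (of_real \<theta> * a)))\<^sup>2 = u\<^sup>2 * ((1 + \<theta>\<^sup>2) * (norm a)\<^sup>2)"
        "(norm (of_real u * (of_real \<theta> * a)))\<^sup>2 - (4 * k + 4) * (norm (of_real u * a))\<^sup>2 = u\<^sup>2 * ((\<theta>\<^sup>2 - (4 * k + 4)) * (norm a)\<^sup>2)"
        by (simp_all add: norm_mult power_mult_distrib algebra_simps)
      then have "bell k (of_real u * a) (of_real u * (of_real \<theta> * a)) = c * ((u\<^sup>2) powr k * u\<^sup>2)"
        unfolding bell_def by (simp add: powr_mult c_def)
      then show ?thesis by (simp only: square_powr)
    qed
    have c0: "c \<le> 0"
    proof -
      have "1 \<le> 1 + 40 * k + 40 * k\<^sup>2" using k by simp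
      then have "1 / (1 + 40 * k + 40 * k\<^sup>2) \<le> 1" by simp
      then have "\<bar>\<theta>\<bar> \<le> 1" using \<theta> by simp
      then have "\<theta>\<^sup>2 \<le> 1" by (simp add: abs_square_le_1)
      then show ?thesis unfolding c_def using k
        by (intro mult_nonneg_nonpos mult_nonpos_nonneg) auto
    qed
    have conv: "2 * \<bar>s\<bar> powr (2 * k + 2) \<le> \<bar>1 - s\<bar> powr (2 * k + 2) + \<bar>-1 - s\<bar> powr (2 * k + 2)"
    proof -
      have "(2 * \<bar>s\<bar>) powr (2 * k + 2) \<le> (\<bar>1 - s\<bar> + \<bar>-1 - s\<bar>) powr (2 * k + 2)"
        by (intro powr_mono2) (use k in auto)
      also have "\<dots> \<le> 2 powr (2 * k + 2) * (\<bar>1 - s\<bar> powr (2 * k + 2) / 2 + \<bar>-1 - s\<bar> powr (2 * k + 2) / 2)"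
        using powr_convex_combination[of "2 * k + 2" "\<bar>1 - s\<bar>" "\<bar>-1 - s\<bar>" 1 1] k by simp
      finally show ?thesis by (simp add: powr_mult)
    qed
    have "x + a = of_real (1 - s) * a" "x - a = of_real (-1 - s) * a"
      "y + of_real \<theta> * a = of_real (1 - s) * (of_real \<theta> * a)" "y - of_real \<theta> * a = of_real (-1 - s) * (of_real \<theta> * a)"
      unfolding xy by (simp_all add: algebra_simps)
    then have "bell k (x + a) (y + of_real \<theta> * a) + bell k (x - a) (y - of_real \<theta> * a)
        = c * (\<bar>1 - s\<bar> powr (2 * k + 2) + \<bar>-1 - s\<bar> powr (2 * k + 2))"
      by (simp only: bell_u distrib_left)
    also have "\<dots> \<le> c * (2 * \<bar>s\<bar> powr (2 * k + 2))"
      using conv c0 by (rule mult_left_mono_neg)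
    also have "\<dots> = 2 * bell k x y" unfolding xy bell_u by simp
    finally show ?thesis .
  qed
qed

text \<open>If |y|^2 \<ge> 2 \<beta> |x|^2, the second factor of \<open>bell\<close> is at least
  |y|^2 / 2 and \<open>bell\<close> alone suffices. Otherwise |y| is bounded by a multiple of |x|,
  and C pays for |y|^p as well as for the negative part of \<open>bell\<close>.\<close>

lemma bell_lower:
  assumes k: "0 \<le> k"
  obtains C where "0 \<le> C" "\<And>x y. norm y powr (2 * k + 2) \<le> C * norm x powr (2 * k + 2) + 2 * bell k x y"
proof -
  define \<beta> where "\<beta> = 4 * k + 4"
  have \<beta>: "0 < \<beta>" using k by (simp add: \<beta>_def)
  define C where "C = (2 * \<beta>) powr (k + 1) + 2 * (\<beta> * (1 + 2 * \<beta>) powr k)"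
  have "norm y powr (2 * k + 2) \<le> C * norm x powr (2 * k + 2) + 2 * bell k x y" for x y :: complex
  proof -
    define X Y where "X = (norm x)\<^sup>2" and "Y = (norm y)\<^sup>2"
    have X: "0 \<le> X" "X powr k * X = norm x powr (2 * k + 2)" and Y: "0 \<le> Y" "Y powr k * Y = norm y powr (2 * k + 2)"
      using square_powr[of "norm x" k] square_powr[of "norm y" k] by (auto simp: X_def Y_def)
    have b: "bell k x y = (X + Y) powr k * (Y - \<beta> * X)" by (simp add: bell_def X_def Y_def \<beta>_def)
    have "Y powr k * Y \<le> C * (X powr k * X) + 2 * bell k x y"
    proof (cases "2 * \<beta> * X \<le> Y")
      case True
      have "Y powr k * (Y / 2) \<le> (X + Y) powr k * (Y - \<beta> * X)"
        using True X Y k by (intro mult_mono powr_mono2) auto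
      moreover have "0 \<le> C * (X powr k * X)" using X \<beta> by (simp add: C_def)
      ultimately show ?thesis by (simp add: b)
    next
      case False
      have "(X + Y) powr k * (\<beta> * X) \<le> ((1 + 2 * \<beta>) * X) powr k * (\<beta> * X)"
        using False X Y k \<beta> by (intro mult_right_mono powr_mono2) (auto simp: algebra_simps)
      also have "\<dots> = \<beta> * (1 + 2 * \<beta>) powr k * (X powr k * X)"
        using X \<beta> by (simp add: powr_mult)
      finally have 1: "(X + Y) powr k * (\<beta> * X) \<le> \<beta> * (1 + 2 * \<beta>) powr k * (X powr k * X)" .
      have "Y powr k * Y \<le> (2 * \<beta> * X) powr k * (2 * \<beta> * X)"
        using False X Y k \<beta> by (intro mult_mono powr_mono2) auto
      also have "\<dots> = ((2 * \<beta>) powr k * (2 * \<beta>)) * (X powr k * X)"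
        using X \<beta> by (simp add: powr_mult)
      also have "(2 * \<beta>) powr k * (2 * \<beta>) = (2 * \<beta>) powr (k + 1)" using \<beta> by (simp add: powr_add)
      finally have 2: "Y powr k * Y \<le> (2 * \<beta>) powr (k + 1) * (X powr k * X)" .
      have "0 \<le> (X + Y) powr k * Y" using Y by simp
      then have 3: "- ((X + Y) powr k * (\<beta> * X)) \<le> bell k x y" by (simp add: b right_diff_distrib)
      have "C * (X powr k * X) = (2 * \<beta>) powr (k + 1) * (X powr k * X) + 2 * (\<beta> * (1 + 2 * \<beta>) powr k * (X powr k * X))"
        by (simp add: C_def distrib_right)
      then show ?thesis using 1 2 3 by linarith
    qed
    then show ?thesis using X Y by simp
  qed
  moreover have "0 \<le> C" using \<beta> by (simp add: C_def)
  ultimately show ?thesis by (intro that)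
qed

text \<open>For the root of the dyadic tree: there the multiplier sum starts at
  \<open>\<theta>\<close> times the mean and contributes nothing positive.\<close>

lemma bell_diagonal:
  assumes "0 \<le> k" "\<bar>\<theta>\<bar> \<le> 1"
  shows "bell k x (of_real \<theta> * x) \<le> 0"
proof -
  have "\<theta>\<^sup>2 \<le> 1" using assms by (simp add: abs_square_le_1)
  then have "\<theta>\<^sup>2 * (norm x)\<^sup>2 \<le> (4 * k + 4) * (norm x)\<^sup>2" using assms by (intro mult_right_mono) auto
  then show ?thesis unfolding bell_def by (intro mult_nonneg_nonpos) (auto simp: norm_mult power_mult_distrib)
qed

section \<open>The Haar system\<close>

definition avg :: "nat \<Rightarrow> int \<Rightarrow> (real \<Rightarrow> complex) \<Rightarrow> complex" where
  "avg l q h = 2 ^ l * (\<integral>x. indicator (dyadic l q) x * h x \<partial>lborel)"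

definition haar_coeff :: "nat \<Rightarrow> int \<Rightarrow> (real \<Rightarrow> complex) \<Rightarrow> complex" where
  "haar_coeff l q h = (avg (Suc l) (2 * q) h - avg (Suc l) (2 * q + 1) h) / 2"

text \<open>The index \<open>(0, q)\<close> stands for the indicator of \<open>[q, q + 1)\<close>, the index \<open>(l + 1, q)\<close> for the Haar function on
  the dyadic interval \<open>dyadic l q\<close>.\<close>

definition haar :: "nat \<times> int \<Rightarrow> real \<Rightarrow> complex" where
  "haar i = (case i of (0, q) \<Rightarrow> indicator (dyadic 0 q)
     | (Suc l, q) \<Rightarrow> (\<lambda>x. indicator (dyadic (Suc l) (2 * q)) x - indicator (dyadic (Suc l) (2 * q + 1)) x))"

definition haar_dual :: "nat \<times> int \<Rightarrow> (real \<Rightarrow> complex) \<Rightarrow> complex" where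
  "haar_dual i h = (case i of (0, q) \<Rightarrow> avg 0 q h | (Suc l, q) \<Rightarrow> haar_coeff l q h)"

lemma haar_simps [simp]:
  "haar (0, q) = indicator (dyadic 0 q)"
  "haar (Suc l, q) x = indicator (dyadic (Suc l) (2 * q)) x - indicator (dyadic (Suc l) (2 * q + 1)) x"
  by (auto simp: haar_def)

lemma haar_dual_simps [simp]: "haar_dual (0, q) h = avg 0 q h" "haar_dual (Suc l, q) h = haar_coeff l q h"
  by (auto simp: haar_dual_def)

lemma floor_double: "\<lfloor>y\<rfloor> = \<lfloor>2 * y\<rfloor> div 2" for y :: real
proof (rule floor_unique)
  have "2 * of_int (\<lfloor>2 * y\<rfloor> div 2) \<le> (of_int \<lfloor>2 * y\<rfloor> :: real)"
    using div_mult_mod_eq[of "\<lfloor>2 * y\<rfloor>" 2] pos_mod_sign[of 2 "\<lfloor>2 * y\<rfloor>"] by linarith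
  then show "of_int (\<lfloor>2 * y\<rfloor> div 2) \<le> y" by linarith
  have "\<lfloor>2 * y\<rfloor> + 1 \<le> 2 * (\<lfloor>2 * y\<rfloor> div 2) + 2"
    using div_mult_mod_eq[of "\<lfloor>2 * y\<rfloor>" 2] pos_mod_bound[of 2 "\<lfloor>2 * y\<rfloor>"] by linarith
  then have "of_int \<lfloor>2 * y\<rfloor> + 1 \<le> 2 * of_int (\<lfloor>2 * y\<rfloor> div 2) + (2::real)" by linarith
  then show "y < of_int (\<lfloor>2 * y\<rfloor> div 2) + 1" by linarith
qed

text \<open>Dyadic cells are handled through floors. The ancestor m levels up is integer division by
  2^m, also for negative indices, because \<open>div\<close> rounds down.\<close>

lemma floor_dyadic_div: "\<lfloor>2 ^ l * x\<rfloor> = \<lfloor>2 ^ (l + m) * x\<rfloor> div 2 ^ m" for x :: real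
proof (induction m)
  case (Suc m)
  have "\<lfloor>2 ^ (l + m) * x\<rfloor> = \<lfloor>2 ^ (l + Suc m) * x\<rfloor> div 2"
    using floor_double[of "2 ^ (l + m) * x"] by (simp add: mult.assoc)
  then show ?case
    using Suc by (simp add: zdiv_zmult2_eq mult.commute)
qed simp

lemma dyadic_children:
  "indicator (dyadic l q) x = (indicator (dyadic (Suc l) (2 * q)) x + indicator (dyadic (Suc l) (2 * q + 1)) x :: 'a :: ring_1)"
proof -
  have "\<lfloor>2 ^ l * x\<rfloor> = \<lfloor>2 ^ Suc l * x\<rfloor> div 2" using floor_dyadic_div[of l x 1] by simp
  then show ?thesis by (auto simp: indicator_def dyadic_iff)
qed

lemma haar_eq:
  "haar (0, q) x = (if \<lfloor>x\<rfloor> = q then 1 else 0)"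
  "haar (Suc l, q) x = (if \<lfloor>2 ^ l * x\<rfloor> = q then (if even \<lfloor>2 ^ Suc l * x\<rfloor> then 1 else -1) else 0)"
proof -
  have d: "\<lfloor>2 ^ l * x\<rfloor> = \<lfloor>2 ^ Suc l * x\<rfloor> div 2" using floor_dyadic_div[of l x 1] by simp
  show "haar (0, q) x = (if \<lfloor>x\<rfloor> = q then 1 else 0)" by (auto simp: indicator_def dyadic_iff)
  show "haar (Suc l, q) x = (if \<lfloor>2 ^ l * x\<rfloor> = q then (if even \<lfloor>2 ^ Suc l * x\<rfloor> then 1 else -1) else 0)"
    unfolding d by (auto simp: indicator_def dyadic_iff elim!: oddE evenE)
qed

lemma haar_measurable [measurable]: "haar i \<in> borel_measurable borel"
proof (cases i)
  case (Pair l q)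
  then show ?thesis by (cases l) (simp_all add: haar_def)
qed

lemma norm_haar_le: "norm (haar i x) \<le> 1"
proof (cases i)
  case (Pair l q)
  then show ?thesis by (cases l) (auto simp: haar_eq simp del: haar_simps)
qed

text \<open>The truncated subtraction is deliberate: index levels 0 and 1 both live on unit
  intervals.\<close>

lemma haar_support: "haar (l, q) x \<noteq> 0 \<Longrightarrow> x \<in> dyadic (l - 1) q"
  by (cases l) (auto simp: haar_eq dyadic_iff simp del: haar_simps split: if_splits)

lemma dyadic_subset_Icc: "dyadic l q \<subseteq> {of_int q / 2 ^ l..(of_int q + 1) / 2 ^ l}"
  by (auto simp: dyadic_def)

lemma emeasure_dyadic: "emeasure lborel (dyadic l q) = ennreal (1 / 2 ^ l)"
proof -
  have "of_int q / 2 ^ l \<le> (of_int q + 1) / (2 ^ l :: real)" by (intro divide_right_mono) auto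
  then show ?thesis unfolding dyadic_def by (simp add: diff_divide_distrib[symmetric])
qed

lemma measure_dyadic [simp]: "measure lborel (dyadic l q) = 1 / 2 ^ l"
  by (simp add: measure_def emeasure_dyadic)

lemma haar_Lp:
  assumes "1 \<le> p"
  shows "haar i \<in> Lp p" "lp_norm p (haar i) \<le> 1"
proof -
  obtain l q where i: "i = (l, q)" by (cases i)
  define c d where "c = of_int q / (2::real) ^ (l - 1)" and "d = (of_int q + 1) / (2::real) ^ (l - 1)"
  have dc: "d - c = 1 / 2 ^ (l - 1)" by (simp add: c_def d_def add_divide_distrib)
  have 0: "0 < d - c" "d - c \<le> 1" unfolding dc by (auto simp: field_simps)
  have z: "haar i x = 0" if "x \<notin> {c..d}" for x
  proof (rule ccontr)
    assume "haar i x \<noteq> 0"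
    then have "x \<in> dyadic (l - 1) q" using haar_support[of l q x] by (simp add: i)
    with dyadic_subset_Icc[of "l - 1" q] that show False unfolding c_def d_def by blast
  qed
  have B: "haar i \<in> Lp p" "c \<le> d \<Longrightarrow> lp_norm p (haar i) \<le> 1 * (d - c) powr (1/p)"
    using Lp_bounded_support[where c = c and d = d and B = 1, OF assms haar_measurable norm_haar_le z] by blast+
  have "(d - c) powr (1/p) \<le> 1" using 0 assms by (intro powr_le1) auto
  then show "haar i \<in> Lp p" "lp_norm p (haar i) \<le> 1" using B 0 by auto
qed

context
  fixes p :: real
  assumes p1: "1 \<le> p"
begin

lemma integrable_dyadic:
  assumes "h \<in> Lp p"
  shows "integrable lborel (\<lambda>x. indicator (dyadic l q) x * h x)"
  by (rule Bochner_Integration.integrable_bound[OF Lp_integrable_on_interval[OF p1 assms, of "of_int q / 2 ^ l" "(of_int q + 1) / 2 ^ l"]])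
    (use LpD(1)[OF assms] in \<open>auto simp: indicator_def dest: subsetD[OF dyadic_subset_Icc] intro!: AE_I2\<close>)

lemma integrable_dyadic_powr:
  assumes "h \<in> Lp p"
  shows "integrable lborel (\<lambda>x. indicator (dyadic l q) x * norm (h x) powr p)"
  by (rule Bochner_Integration.integrable_bound[OF LpD(2)[OF assms]])
    (use LpD(1)[OF assms] in \<open>auto simp: indicator_def\<close>)

lemma avg_add:
  assumes "f \<in> Lp p" "g \<in> Lp p"
  shows "avg l q (\<lambda>x. f x + g x) = avg l q f + avg l q g"
  unfolding avg_def by (simp add: distrib_left integrable_dyadic assms)

lemma avg_cmult: "avg l q (\<lambda>x. c * f x) = c * avg l q f"
proof -
  have "(\<lambda>x. indicator (dyadic l q) x * (c * f x)) = (\<lambda>x. c * (indicator (dyadic l q) x * f x))"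
    by (simp add: mult_ac)
  then show ?thesis unfolding avg_def by (simp only: integral_mult_right_zero mult_ac)
qed

lemma avg_bound:
  assumes "f \<in> Lp p"
  shows "norm (avg l q f) \<le> 2 ^ Suc l * lp_norm p f"
proof -
  let ?c = "of_int q / (2::real) ^ l" and ?d = "(of_int q + 1) / (2::real) ^ l"
  have cd: "?c \<le> ?d" by (intro divide_right_mono) auto
  have dc: "?d - ?c + 1 \<le> 2" by (simp add: field_simps)
  have "norm (\<integral>x. indicator (dyadic l q) x * f x \<partial>lborel) \<le> (\<integral>x. norm (indicator (dyadic l q) x * f x) \<partial>lborel)"
    by (rule integral_norm_bound)
  also have "\<dots> \<le> (\<integral>x. norm (indicator {?c..?d} x * f x) \<partial>lborel)"
    by (rule integral_mono[OF integrable_norm[OF integrable_dyadic[OF assms]] integrable_norm[OF Lp_integrable_on_interval[OF p1 assms]]])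
      (auto simp: indicator_def dest: subsetD[OF dyadic_subset_Icc])
  also have "\<dots> \<le> (?d - ?c + 1) * lp_norm p f" by (rule Lp_L1_bound[OF p1 assms cd])
  also have "\<dots> \<le> 2 * lp_norm p f" by (intro mult_right_mono dc) simp
  finally show ?thesis by (simp add: avg_def norm_mult norm_power)
qed

lemma haar_dual_add: "f \<in> Lp p \<Longrightarrow> g \<in> Lp p \<Longrightarrow> haar_dual i (\<lambda>x. f x + g x) = haar_dual i f + haar_dual i g"
  by (cases i; cases "fst i") (auto simp: haar_coeff_def avg_add add_divide_distrib diff_divide_distrib)

lemma haar_dual_cmult: "haar_dual i (\<lambda>x. c * f x) = c * haar_dual i f"
  by (cases i; cases "fst i") (auto simp: haar_coeff_def avg_cmult right_diff_distrib diff_divide_distrib)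

lemma haar_dual_diff: "f \<in> Lp p \<Longrightarrow> g \<in> Lp p \<Longrightarrow> haar_dual i (\<lambda>x. f x - g x) = haar_dual i f - haar_dual i g"
  using haar_dual_add[of f "\<lambda>x. (-1) * g x" i] haar_dual_cmult[of i "-1" g] Lp_cmult[OF p1, of g "-1"] by simp

text \<open>The growth with the level is harmless: it enters only through the constants
  \<open>Cc\<close>, which are compensated by the choice of \<open>\<eta>\<close>.\<close>

lemma haar_dual_bound:
  assumes "f \<in> Lp p"
  shows "norm (haar_dual i f) \<le> 2 ^ (fst i + 1) * lp_norm p f"
proof (cases i)
  case (Pair l q)
  show ?thesis
  proof (cases l)
    case 0
    then show ?thesis using avg_bound[OF assms, of 0 q] Pair by simp
  next
    case (Suc j)
    have "norm (haar_coeff j q f) \<le> (norm (avg (Suc j) (2 * q) f) + norm (avg (Suc j) (2 * q + 1) f)) / 2"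
      unfolding haar_coeff_def norm_divide using norm_triangle_ineq4 by (simp add: divide_right_mono)
    also have "\<dots> \<le> 2 ^ Suc (Suc j) * lp_norm p f"
      by (rule order.trans[OF divide_right_mono[OF add_mono[OF avg_bound[OF assms] avg_bound[OF assms]]]]) simp_all
    finally show ?thesis using Pair Suc by simp
  qed
qed

lemma avg_split:
  assumes "h \<in> Lp p"
  shows "avg (Suc l) (2 * q) h = avg l q h + haar_coeff l q h"
    "avg (Suc l) (2 * q + 1) h = avg l q h - haar_coeff l q h"
proof -
  have "avg l q h = (avg (Suc l) (2 * q) h + avg (Suc l) (2 * q + 1) h) / 2"
    unfolding avg_def dyadic_children[of l q] distrib_right
    by (subst Bochner_Integration.integral_add[OF integrable_dyadic[OF assms] integrable_dyadic[OF assms]])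
      (simp add: distrib_left)
  then show "avg (Suc l) (2 * q) h = avg l q h + haar_coeff l q h"
    "avg (Suc l) (2 * q + 1) h = avg l q h - haar_coeff l q h"
    unfolding haar_coeff_def by (simp_all add: field_simps)
qed

text \<open>Young's inequality with weights 1 - 1/p and 1/p, an equality at a = s. In
  \<open>avg_jensen\<close> s is the modulus of the mean, which makes this the tangent proving
  Jensen's inequality.\<close>

lemma tangent_powr:
  assumes "0 < s" "0 \<le> (a::real)"
  shows "a \<le> (1 - 1/p) * s + 1/p * (s powr (1 - p) * a powr p)"
proof (cases "a = 0")
  case True
  then show ?thesis using assms p1 by simp
next
  case False
  then have a: "0 < a" using assms by simp
  have "s powr (1 - 1/p) * (s powr (1 - p) * a powr p) powr (1/p) = a"
  proof -
    have "(s powr (1 - p) * a powr p) powr (1/p) = s powr ((1 - p) * (1/p)) * a"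
      using a assms p1 by (simp add: powr_mult powr_powr)
    also have "s powr (1 - 1/p) * (s powr ((1 - p) * (1/p)) * a) = s powr (1 - 1/p + (1 - p) * (1/p)) * a"
      by (simp only: powr_add mult.assoc)
    also have "1 - 1/p + (1 - p) * (1/p) = 0" using p1 by (simp add: field_simps)
    finally show ?thesis using assms by simp
  qed
  moreover have "s powr (1 - 1/p) * (s powr (1 - p) * a powr p) powr (1/p)
      \<le> (1 - 1/p) * s + 1/p * (s powr (1 - p) * a powr p)"
    by (rule Youngs_inequality_0) (use a assms p1 in auto)
  ultimately show ?thesis by simp
qed

lemma avg_jensen:
  assumes h: "h \<in> Lp p"
  shows "norm (avg l q h) powr p / 2 ^ l \<le> (\<integral>x. indicator (dyadic l q) x * norm (h x) powr p \<partial>lborel)"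
proof (cases "avg l q h = 0")
  case True
  then show ?thesis using p1 by (auto intro!: integral_nonneg_AE)
next
  case False
  define m where "m = norm (avg l q h)"
  define M where "M = (\<integral>x. indicator (dyadic l q) x * norm (h x) powr p \<partial>lborel)"
  have m: "0 < m" using False by (simp add: m_def)
  have "m / 2 ^ l = norm (\<integral>x. indicator (dyadic l q) x * h x \<partial>lborel)"
    by (simp add: m_def avg_def norm_mult norm_power)
  also have "\<dots> \<le> (\<integral>x. norm (indicator (dyadic l q) x * h x) \<partial>lborel)" by (rule integral_norm_bound)
  also have "\<dots> \<le> (\<integral>x. (1 - 1/p) * m * indicator (dyadic l q) x + 1/p * m powr (1 - p) * (indicator (dyadic l q) x * norm (h x) powr p) \<partial>lborel)"
  proof (rule integral_mono)
    show "integrable lborel (\<lambda>x. norm (indicator (dyadic l q) x * h x))"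
      by (rule integrable_norm[OF integrable_dyadic[OF h]])
    show "integrable lborel (\<lambda>x. (1 - 1/p) * m * indicator (dyadic l q) x + 1/p * m powr (1 - p) * (indicator (dyadic l q) x * norm (h x) powr p))"
      by (intro Bochner_Integration.integrable_add integrable_mult_right integrable_dyadic_powr h integrable_real_indicator)
        (auto simp: emeasure_dyadic)
    show "norm (indicator (dyadic l q) x * h x) \<le> (1 - 1/p) * m * indicator (dyadic l q) x + 1/p * m powr (1 - p) * (indicator (dyadic l q) x * norm (h x) powr p)" for x
      using tangent_powr[OF m, of "norm (h x)"] by (auto simp: indicator_def mult.assoc)
  qed
  also have "\<dots> = (1 - 1/p) * m * (1 / 2 ^ l) + 1/p * m powr (1 - p) * M"
  proof -
    have "integrable lborel (indicator (dyadic l q) :: real \<Rightarrow> real)"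
      by (rule integrable_real_indicator) (auto simp: emeasure_dyadic)
    then show ?thesis
      unfolding M_def by (subst Bochner_Integration.integral_add) (auto intro!: integrable_dyadic_powr h)
  qed
  finally have "m / 2 ^ l \<le> (1 - 1/p) * m * (1 / 2 ^ l) + 1/p * m powr (1 - p) * M" .
  also have "(1 - 1/p) * m * (1 / 2 ^ l) = m / 2 ^ l - 1/p * (m / 2 ^ l)"
    using p1 by (simp add: field_simps)
  finally have "1/p * (m / 2 ^ l) \<le> 1/p * (m powr (1 - p) * M)" by (simp add: mult.assoc)
  then have le: "m / 2 ^ l \<le> m powr (1 - p) * M" using p1 by (simp add: divide_right_mono field_simps)
  have "m powr p / 2 ^ l = m powr (p - 1) * (m / 2 ^ l)"
    using m by (simp add: powr_diff)
  also have "\<dots> \<le> m powr (p - 1) * (m powr (1 - p) * M)" using le by (intro mult_left_mono) auto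
  also have "\<dots> = M" using m by (simp flip: mult.assoc powr_add)
  finally show ?thesis by (simp add: m_def M_def)
qed

end

section \<open>Haar sums along branches of the dyadic tree\<close>

text \<open>At every level exactly one Haar function is nonzero at x, its sign given by a parity.
  Counting n levels from level l makes splitting off the top level a recursion into the
  children.\<close>

definition haar_part :: "(nat \<times> int \<Rightarrow> complex) \<Rightarrow> nat \<Rightarrow> nat \<Rightarrow> real \<Rightarrow> complex" where
  "haar_part c l n x = (\<Sum>j<n. c (Suc (l + j), \<lfloor>2 ^ (l + j) * x\<rfloor>) * (if even \<lfloor>2 ^ Suc (l + j) * x\<rfloor> then 1 else -1))"

lemma haar_part_0 [simp]: "haar_part c l 0 x = 0"
  by (simp add: haar_part_def)

lemma haar_part_Suc:
  "haar_part c l (Suc n) x = c (Suc l, \<lfloor>2 ^ l * x\<rfloor>) * (if even \<lfloor>2 ^ Suc l * x\<rfloor> then 1 else -1) + haar_part c (Suc l) n x"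
  unfolding haar_part_def by (subst sum.lessThan_Suc_shift) simp

lemma haar_part_measurable [measurable]: "haar_part c l n \<in> borel_measurable borel"
proof -
  have f: "(\<lambda>x. F \<lfloor>(2::real) ^ m * x\<rfloor>) \<in> borel_measurable borel" for F :: "int \<Rightarrow> complex" and m
    by (rule measurable_compose[where N = "count_space UNIV" and g = F]) measurable
  show ?thesis unfolding haar_part_def[abs_def] using f[of "\<lambda>j. if even j then 1 else -1"] f
    by (intro borel_measurable_sum borel_measurable_times) auto
qed

lemma sum_haar_eq_haar_part:
  assumes F: "finite F" and c: "\<And>i. i \<notin> F \<Longrightarrow> c i = 0" and n: "\<And>i. i \<in> F \<Longrightarrow> fst i \<le> n"
  shows "(\<Sum>i\<in>F. c i * haar i x) = c (0, \<lfloor>x\<rfloor>) + haar_part c 0 n x"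
proof -
  define \<iota> where "\<iota> l = (l, \<lfloor>2 ^ (l - 1) * x\<rfloor>)" for l :: nat
  have inj: "inj_on \<iota> {..n}" by (auto simp: \<iota>_def inj_on_def)
  have "(\<Sum>i\<in>F. c i * haar i x) = (\<Sum>i\<in>\<iota> ` {..n}. c i * haar i x)"
  proof (rule sum.mono_neutral_cong)
    show "c i * haar i x = 0" if "i \<in> \<iota> ` {..n} - F" for i using c that by auto
    show "c i * haar i x = 0" if i: "i \<in> F - \<iota> ` {..n}" for i
    proof (rule ccontr)
      assume "c i * haar i x \<noteq> 0"
      then have "haar (fst i, snd i) x \<noteq> 0" by simp
      from haar_support[OF this] have "i = \<iota> (fst i)" by (cases i) (auto simp: \<iota>_def dyadic_iff)
      then show False using i n[of i] by auto
    qed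
  qed (use F in auto)
  also have "\<dots> = (\<Sum>l\<le>n. c (\<iota> l) * haar (\<iota> l) x)" by (rule sum.reindex[OF inj, unfolded o_def])
  also have "\<dots> = (\<Sum>l<Suc n. c (\<iota> l) * haar (\<iota> l) x)" by (simp only: lessThan_Suc_atMost)
  also have "\<dots> = c (\<iota> 0) * haar (\<iota> 0) x + (\<Sum>l<n. c (\<iota> (Suc l)) * haar (\<iota> (Suc l)) x)"
    by (rule sum.lessThan_Suc_shift)
  finally show ?thesis by (simp add: \<iota>_def haar_part_def haar_eq del: haar_simps)
qed

subsection \<open>Unconditionality\<close>

text \<open>Induction on the number of levels with the cell and y arbitrary. Splitting a cell moves
  (mean, y) to (mean + a, y + \<theta> a) and (mean - a, y - \<theta> a); by concavity of
  \<open>bell\<close> the right sides of the children add up to at most that of the parent. At a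
  leaf, \<open>bell_lower\<close> and Jensen's inequality apply.\<close>

lemma haar_tree_bound:
  fixes \<theta> :: "nat \<times> int \<Rightarrow> real"
  assumes k: "0 \<le> k" and C: "0 \<le> C" "\<And>x y. norm y powr (2 * k + 2) \<le> C * norm x powr (2 * k + 2) + 2 * bell k x y"
    and \<theta>: "\<And>i. \<bar>\<theta> i\<bar> \<le> 1 / (1 + 40 * k + 40 * k\<^sup>2)" and h: "h \<in> Lp (2 * k + 2)"
  shows "(\<integral>\<^sup>+x. indicator (dyadic l q) x * ennreal (norm (y + haar_part (\<lambda>i. of_real (\<theta> i) * haar_dual i h) l n x) powr (2 * k + 2)) \<partial>lborel)
    \<le> ennreal (C * (\<integral>x. indicator (dyadic l q) x * norm (h x) powr (2 * k + 2) \<partial>lborel) + 2 / 2 ^ l * bell k (avg l q h) y)"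
proof -
  define p where "p = 2 * k + 2"
  have p1: "1 \<le> p" using k by (simp add: p_def)
  define R where "R l q y = C * (\<integral>x. indicator (dyadic l q) x * norm (h x) powr p \<partial>lborel) + 2 / 2 ^ l * bell k (avg l q h) y" for l q y
  have hp: "h \<in> Lp p" using h by (simp add: p_def)
  have base: "norm y powr p / 2 ^ l \<le> R l q y" for l q y
  proof -
    have "norm y powr p / 2 ^ l \<le> (C * norm (avg l q h) powr p + 2 * bell k (avg l q h) y) / 2 ^ l"
      using C(2)[of y "avg l q h"] by (intro divide_right_mono) (auto simp: p_def)
    also have "\<dots> = C * (norm (avg l q h) powr p / 2 ^ l) + 2 / 2 ^ l * bell k (avg l q h) y"
      by (simp add: add_divide_distrib)
    also have "\<dots> \<le> R l q y"
      unfolding R_def by (intro add_right_mono mult_left_mono avg_jensen[OF p1 hp] C)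
    finally show ?thesis .
  qed
  have R0: "0 \<le> R l q y" for l q y
    by (rule order.trans[OF _ base]) simp
  let ?T = "haar_part (\<lambda>i. of_real (\<theta> i) * haar_dual i h)"
  have "(\<integral>\<^sup>+x. indicator (dyadic l q) x * ennreal (norm (y + ?T l n x) powr p) \<partial>lborel) \<le> ennreal (R l q y)"
  proof (induction n arbitrary: l q y)
    case 0
    have "(\<integral>\<^sup>+x. indicator (dyadic l q) x * ennreal (norm (y + ?T l 0 x) powr p) \<partial>lborel)
        = ennreal (norm y powr p) * ennreal (1 / 2 ^ l)"
      by (simp add: nn_integral_cmult_indicator emeasure_dyadic mult.commute)
    also have "\<dots> = ennreal (norm y powr p / 2 ^ l)" by (simp flip: ennreal_mult)
    also have "\<dots> \<le> ennreal (R l q y)" by (rule ennreal_leI[OF base])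
    finally show ?case .
  next
    case (Suc n)
    define a where "a = haar_coeff l q h"
    define t where "t = of_real (\<theta> (Suc l, q)) * a"
    have eq: "indicator (dyadic l q) x * ennreal (norm (y + ?T l (Suc n) x) powr p)
      = indicator (dyadic (Suc l) (2 * q)) x * ennreal (norm ((y + t) + ?T (Suc l) n x) powr p)
      + indicator (dyadic (Suc l) (2 * q + 1)) x * ennreal (norm ((y - t) + ?T (Suc l) n x) powr p)" for x
    proof -
      have d: "\<lfloor>2 ^ l * x\<rfloor> = \<lfloor>2 ^ Suc l * x\<rfloor> div 2" using floor_dyadic_div[of l x 1] by simp
      consider "\<lfloor>2 ^ Suc l * x\<rfloor> = 2 * q" | "\<lfloor>2 ^ Suc l * x\<rfloor> = 2 * q + 1" | "\<lfloor>2 ^ l * x\<rfloor> \<noteq> q"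
        unfolding d by linarith
      then show ?thesis
      proof cases
        case 1
        then have "\<lfloor>2 ^ l * x\<rfloor> = q" unfolding d by simp
        then show ?thesis unfolding haar_part_Suc indicator_def dyadic_iff using 1 by (simp add: t_def a_def add.assoc)
      next
        case 2
        then have "\<lfloor>2 ^ l * x\<rfloor> = q" unfolding d by simp
        then show ?thesis unfolding haar_part_Suc indicator_def dyadic_iff using 2 by (simp add: t_def a_def algebra_simps)
      next
        case 3
        then have "\<lfloor>2 ^ Suc l * x\<rfloor> \<noteq> 2 * q" "\<lfloor>2 ^ Suc l * x\<rfloor> \<noteq> 2 * q + 1" unfolding d by auto
        then show ?thesis unfolding indicator_def dyadic_iff using 3 by simp
      qed
    qed
    have "(\<integral>\<^sup>+x. indicator (dyadic l q) x * ennreal (norm (y + ?T l (Suc n) x) powr p) \<partial>lborel)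
      = (\<integral>\<^sup>+x. indicator (dyadic (Suc l) (2 * q)) x * ennreal (norm ((y + t) + ?T (Suc l) n x) powr p) \<partial>lborel)
      + (\<integral>\<^sup>+x. indicator (dyadic (Suc l) (2 * q + 1)) x * ennreal (norm ((y - t) + ?T (Suc l) n x) powr p) \<partial>lborel)"
      unfolding eq by (rule nn_integral_add) measurable
    also have "\<dots> \<le> ennreal (R (Suc l) (2 * q) (y + t)) + ennreal (R (Suc l) (2 * q + 1) (y - t))"
      by (intro add_mono Suc.IH)
    also have "\<dots> = ennreal (R (Suc l) (2 * q) (y + t) + R (Suc l) (2 * q + 1) (y - t))"
      by (simp add: ennreal_plus R0)
    also have "\<dots> \<le> ennreal (R l q y)"
    proof (rule ennreal_leI)
      have I: "(\<integral>x. indicator (dyadic l q) x * norm (h x) powr p \<partial>lborel)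
        = (\<integral>x. indicator (dyadic (Suc l) (2 * q)) x * norm (h x) powr p \<partial>lborel)
          + (\<integral>x. indicator (dyadic (Suc l) (2 * q + 1)) x * norm (h x) powr p \<partial>lborel)"
        unfolding dyadic_children[of l q] distrib_right
        by (rule Bochner_Integration.integral_add) (intro integrable_dyadic_powr p1 hp)+
      have "bell k (avg l q h + a) (y + t) + bell k (avg l q h - a) (y - t) \<le> 2 * bell k (avg l q h) y"
        unfolding t_def by (rule bell_concave[OF k \<theta>])
      then have "2 / 2 ^ Suc l * (bell k (avg l q h + a) (y + t) + bell k (avg l q h - a) (y - t))
          \<le> 2 / 2 ^ Suc l * (2 * bell k (avg l q h) y)"
        by (intro mult_left_mono) auto
      then show "R (Suc l) (2 * q) (y + t) + R (Suc l) (2 * q + 1) (y - t) \<le> R l q y"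
        unfolding R_def avg_split[OF p1 hp] I a_def[symmetric] by (simp add: distrib_left)
    qed
    finally show ?case .
  qed
  then show ?thesis by (simp add: R_def p_def)
qed

text \<open>Multipliers are scaled by \<open>\<tau>\<close> to be small enough for
  \<open>bell\<close>, which costs 1 / \<open>\<tau>\<close> in the constant. On each unit interval
  the tree starts on the diagonal, where \<open>bell\<close> is nonpositive, so only C times the
  integral of |h|^p remains.\<close>

theorem haar_multiplier_bound:
  assumes p2: "2 \<le> p"
  shows "\<exists>C>0. \<forall>h\<in>Lp p. \<forall>F \<theta>. finite F \<longrightarrow> (\<forall>i\<in>F. \<bar>\<theta> i\<bar> \<le> (1::real)) \<longrightarrow>
    lp_norm p (\<lambda>x. \<Sum>i\<in>F. of_real (\<theta> i) * haar_dual i h * haar i x) \<le> C * lp_norm p h"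
proof -
  have p1: "1 \<le> p" using p2 by simp
  define k where "k = p / 2 - 1"
  have k: "0 \<le> k" and pk: "2 * k + 2 = p" using p2 by (auto simp: k_def)
  obtain C where C: "0 \<le> C" "\<And>x y. norm y powr (2 * k + 2) \<le> C * norm x powr (2 * k + 2) + 2 * bell k x y"
    by (rule bell_lower[OF k], rule that)
  define \<tau> where "\<tau> = 1 / (1 + 40 * k + 40 * k\<^sup>2)"
  have den: "1 \<le> 1 + 40 * k + 40 * k\<^sup>2" using k by simp
  then have \<tau>: "0 < \<tau>" "\<tau> \<le> 1" by (auto simp: \<tau>_def)
  define C' where "C' = (C + 1) powr (1/p) / \<tau>"
  have "0 < C'" using C \<tau> by (simp add: C'_def)
  moreover have "lp_norm p (\<lambda>x. \<Sum>i\<in>F. of_real (\<theta> i) * haar_dual i h * haar i x) \<le> C' * lp_norm p h"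
    if h: "h \<in> Lp p" and F: "finite F" and \<theta>: "\<And>i. i \<in> F \<Longrightarrow> \<bar>\<theta> i\<bar> \<le> (1::real)" for h F \<theta>
  proof -
    \<comment> \<open>Extension by 0 outside F lets the finite sum be read as a full sum along each
      branch.\<close>
    define \<theta>' where "\<theta>' i = (if i \<in> F then \<tau> * \<theta> i else 0)" for i
    have \<theta>': "\<bar>\<theta>' i\<bar> \<le> \<tau>" for i
      using \<theta>[of i] \<tau> by (auto simp: \<theta>'_def abs_mult mult_left_le)
    define c where "c i = of_real (\<theta>' i) * haar_dual i h" for i
    define n where "n = Max (insert 0 (fst ` F))"
    have n: "fst i \<le> n" if "i \<in> F" for i using F that by (auto simp: n_def)
    define S where "S x = (\<Sum>i\<in>F. c i * haar i x)" for x
    have S\<tau>: "S x = of_real \<tau> * (\<Sum>i\<in>F. of_real (\<theta> i) * haar_dual i h * haar i x)" for x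
      unfolding S_def sum_distrib_left by (intro sum.cong refl) (simp add: c_def \<theta>'_def)
    have SL: "S \<in> Lp p" unfolding S_def by (intro Lp_sum[OF p1] Lp_cmult[OF p1] haar_Lp[OF p1])
    have S_eq: "S x = c (0, \<lfloor>x\<rfloor>) + haar_part c 0 n x" for x
      unfolding S_def by (rule sum_haar_eq_haar_part[OF F _ n]) (simp add: c_def \<theta>'_def)
    define Q where "Q = (\<lambda>i. snd i div 2 ^ (fst i - 1)) ` F"
    have Q: "finite Q" using F by (simp add: Q_def)
    have SQ: "S x = 0" if "\<lfloor>x\<rfloor> \<notin> Q" for x
      unfolding S_def
    proof (rule sum.neutral, rule ballI)
      fix i assume i: "i \<in> F"
      show "c i * haar i x = 0"
      proof (rule ccontr)
        assume "c i * haar i x \<noteq> 0"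
        then have "haar (fst i, snd i) x \<noteq> 0" by simp
        from haar_support[OF this] have "\<lfloor>2 ^ (fst i - 1) * x\<rfloor> = snd i" by (simp add: dyadic_iff)
        then have "\<lfloor>x\<rfloor> = snd i div 2 ^ (fst i - 1)" using floor_dyadic_div[of 0 x "fst i - 1"] by simp
        then show False using that i by (auto simp: Q_def)
      qed
    qed
    have Sd: "norm (S x) powr p = (\<Sum>q\<in>Q. indicator (dyadic 0 q) x * norm (S x) powr p)" for x
    proof (cases "\<lfloor>x\<rfloor> \<in> Q")
      case True
      have "(\<Sum>q\<in>Q. indicator (dyadic 0 q) x * norm (S x) powr p) = (\<Sum>q\<in>Q. if q = \<lfloor>x\<rfloor> then norm (S x) powr p else 0)"
        by (rule sum.cong) (auto simp: indicator_def dyadic_iff)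
      then show ?thesis using True Q by simp
    next
      case False
      have "(\<Sum>q\<in>Q. indicator (dyadic 0 q) x * norm (S x) powr p) = 0"
        by (simp only: SQ[OF False] norm_zero powr_0 mult_zero_right sum.neutral_const)
      then show ?thesis using SQ[OF False] p1 by simp
    qed
    have one: "(\<integral>x. indicator (dyadic 0 q) x * norm (S x) powr p \<partial>lborel)
        \<le> C * (\<integral>x. indicator (dyadic 0 q) x * norm (h x) powr p \<partial>lborel)" for q
    proof -
      have "ennreal (\<integral>x. indicator (dyadic 0 q) x * norm (S x) powr p \<partial>lborel)
          = (\<integral>\<^sup>+x. ennreal (indicator (dyadic 0 q) x * norm (S x) powr p) \<partial>lborel)"
        by (rule nn_integral_eq_integral[symmetric, OF integrable_dyadic_powr[OF p1 SL]]) simp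
      also have "\<dots> = (\<integral>\<^sup>+x. indicator (dyadic 0 q) x * ennreal (norm (of_real (\<theta>' (0, q)) * avg 0 q h + haar_part c 0 n x) powr p) \<partial>lborel)"
        by (intro nn_integral_cong) (auto simp: S_eq c_def indicator_def dyadic_iff)
      also have "\<dots> \<le> ennreal (C * (\<integral>x. indicator (dyadic 0 q) x * norm (h x) powr p \<partial>lborel)
          + 2 / 2 ^ 0 * bell k (avg 0 q h) (of_real (\<theta>' (0, q)) * avg 0 q h))"
        unfolding c_def
        by (rule haar_tree_bound[OF k C, unfolded pk, OF _ h]) (use \<theta>' in \<open>simp add: \<tau>_def\<close>)
      also have "\<dots> \<le> ennreal (C * (\<integral>x. indicator (dyadic 0 q) x * norm (h x) powr p \<partial>lborel))"
      proof (rule ennreal_leI)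
        have "\<bar>\<theta>' (0, q)\<bar> \<le> 1" using \<theta>'[of "(0, q)"] \<tau> by simp
        from bell_diagonal[OF k this, of "avg 0 q h"]
        show "C * (\<integral>x. indicator (dyadic 0 q) x * norm (h x) powr p \<partial>lborel)
          + 2 / 2 ^ 0 * bell k (avg 0 q h) (of_real (\<theta>' (0, q)) * avg 0 q h)
          \<le> C * (\<integral>x. indicator (dyadic 0 q) x * norm (h x) powr p \<partial>lborel)" by simp
      qed
      finally show ?thesis
        using C(1) by (subst (asm) ennreal_le_iff) (auto intro!: mult_nonneg_nonneg integral_nonneg_AE)
    qed
    have "(\<integral>x. norm (S x) powr p \<partial>lborel) = (\<Sum>q\<in>Q. \<integral>x. indicator (dyadic 0 q) x * norm (S x) powr p \<partial>lborel)"
      by (subst Sd) (rule Bochner_Integration.integral_sum[OF integrable_dyadic_powr[OF p1 SL]])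
    also have "\<dots> \<le> (\<Sum>q\<in>Q. C * (\<integral>x. indicator (dyadic 0 q) x * norm (h x) powr p \<partial>lborel))"
      by (intro sum_mono one)
    also have "\<dots> = C * (\<integral>x. (\<Sum>q\<in>Q. indicator (dyadic 0 q) x * norm (h x) powr p) \<partial>lborel)"
      by (subst Bochner_Integration.integral_sum[OF integrable_dyadic_powr[OF p1 h]]) (simp add: sum_distrib_left)
    also have "\<dots> \<le> (C + 1) * (\<integral>x. norm (h x) powr p \<partial>lborel)"
    proof (intro mult_mono integral_mono)
      show "(\<Sum>q\<in>Q. indicator (dyadic 0 q) x * norm (h x) powr p) \<le> norm (h x) powr p" for x
      proof -
        have "(\<Sum>q\<in>Q. indicator (dyadic 0 q) x * norm (h x) powr p) = (\<Sum>q\<in>Q. if q = \<lfloor>x\<rfloor> then norm (h x) powr p else 0)"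
          by (rule sum.cong) (auto simp: indicator_def dyadic_iff)
        then show ?thesis using Q by simp
      qed
      show "integrable lborel (\<lambda>x. \<Sum>q\<in>Q. indicator (dyadic 0 q) x * norm (h x) powr p)"
        by (intro Bochner_Integration.integrable_sum integrable_dyadic_powr[OF p1 h])
      show "0 \<le> (\<integral>x. (\<Sum>q\<in>Q. indicator (dyadic 0 q) x * norm (h x) powr p) \<partial>lborel)"
        by (intro integral_nonneg_AE AE_I2 sum_nonneg) auto
    qed (use C LpD(2)[OF h] in auto)
    also have "\<dots> = ((C + 1) powr (1/p) * lp_norm p h) powr p"
      using C p1 by (simp add: powr_mult powr_powr lp_norm_powr[OF p1])
    finally have "lp_norm p S \<le> (C + 1) powr (1/p) * lp_norm p h"
      by (rule lp_norm_leI[OF p1]) simp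
    moreover have "lp_norm p S = \<tau> * lp_norm p (\<lambda>x. \<Sum>i\<in>F. of_real (\<theta> i) * haar_dual i h * haar i x)"
      unfolding S\<tau>[abs_def] lp_norm_cmult[OF p1] using \<tau> by simp
    ultimately show ?thesis using \<tau> by (simp add: C'_def field_simps)
  qed
  ultimately show ?thesis by (intro exI[of _ C'] conjI ballI allI impI) blast+
qed

lemma avg_telescope:
  assumes "1 \<le> p" "h \<in> Lp p"
  shows "avg 0 \<lfloor>x\<rfloor> h + haar_part (\<lambda>i. haar_dual i h) 0 n x = avg n \<lfloor>2 ^ n * x\<rfloor> h"
proof (induction n)
  case (Suc n)
  have d: "\<lfloor>2 ^ n * x\<rfloor> = \<lfloor>2 ^ Suc n * x\<rfloor> div 2" using floor_dyadic_div[of n x 1] by simp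
  have "avg 0 \<lfloor>x\<rfloor> h + haar_part (\<lambda>i. haar_dual i h) 0 (Suc n) x
    = avg n \<lfloor>2 ^ n * x\<rfloor> h + haar_coeff n \<lfloor>2 ^ n * x\<rfloor> h * (if even \<lfloor>2 ^ Suc n * x\<rfloor> then 1 else -1)"
    using Suc by (simp add: haar_part_def add.assoc[symmetric])
  also have "\<dots> = avg (Suc n) \<lfloor>2 ^ Suc n * x\<rfloor> h"
  proof (cases "even \<lfloor>2 ^ Suc n * x\<rfloor>")
    case True
    then have "\<lfloor>2 ^ Suc n * x\<rfloor> = 2 * \<lfloor>2 ^ n * x\<rfloor>" unfolding d by simp
    then show ?thesis using avg_split(1)[OF assms, of n "\<lfloor>2 ^ n * x\<rfloor>"] True by simp
  next
    case False
    then have "\<lfloor>2 ^ Suc n * x\<rfloor> = 2 * \<lfloor>2 ^ n * x\<rfloor> + 1" unfolding d by (simp add: odd_two_times_div_two_succ)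
    then show ?thesis using avg_split(2)[OF assms, of n "\<lfloor>2 ^ n * x\<rfloor>"] False by simp
  qed
  finally show ?case .
qed simp

lemma avg_const:
  assumes "\<And>x. x \<in> dyadic l q \<Longrightarrow> h x = v"
  shows "avg l q h = v"
proof -
  have i: "integrable lborel (indicator (dyadic l q) :: real \<Rightarrow> real)"
    by (rule integrable_real_indicator) (auto simp: emeasure_dyadic)
  have "(\<lambda>x. indicator (dyadic l q) x * h x) = (\<lambda>x. of_real (indicator (dyadic l q) x) * v)"
    using assms by (auto simp: indicator_def fun_eq_iff)
  then have "(\<integral>x. indicator (dyadic l q) x * h x \<partial>lborel) = of_real (1 / 2 ^ l) * v"
    using i by (simp add: integral_complex_of_real)
  then show ?thesis by (simp add: avg_def)
qed

text \<open>A dyadic step function has finitely many nonzero Haar coefficients, and multipliers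
  equal to 1 on them reproduce it exactly; the remainder passes through the multiplier bound.
  Fractional \<open>\<theta>\<close> will describe blocks of which only a part has been
  summed.\<close>

theorem haar_unconditional:
  assumes p2: "2 \<le> p" and h: "h \<in> Lp p" and e: "0 < e"
  obtains F0 where "finite F0" "\<And>F \<theta>. finite F \<Longrightarrow> F0 \<subseteq> F \<Longrightarrow> (\<And>i. i \<in> F \<Longrightarrow> \<bar>\<theta> i\<bar> \<le> (1::real)) \<Longrightarrow>
    (\<And>i. i \<in> F0 \<Longrightarrow> \<theta> i = 1) \<Longrightarrow> lp_norm p (\<lambda>x. h x - (\<Sum>i\<in>F. of_real (\<theta> i) * haar_dual i h * haar i x)) < e"
proof -
  have p1: "1 \<le> p" using p2 by simp
  obtain C where C: "0 < C" "\<forall>h\<in>Lp p. \<forall>F \<theta>. finite F \<longrightarrow> (\<forall>i\<in>F. \<bar>\<theta> i\<bar> \<le> (1::real)) \<longrightarrow>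
    lp_norm p (\<lambda>x. \<Sum>i\<in>F. of_real (\<theta> i) * haar_dual i h * haar i x) \<le> C * lp_norm p h"
    using haar_multiplier_bound[OF p2] by (elim exE conjE)
  have e': "0 < e / (1 + C)" using e C by simp
  obtain n Q b where Q: "finite Q"
    and app: "lp_norm p (\<lambda>x. h x - (\<Sum>q\<in>Q. b q * indicator (dyadic n q) x)) < e / (1 + C)"
    using dyadic_step_dense[OF p1 h e'] by (elim exE conjE)
  define s where "s x = (\<Sum>q\<in>Q. b q * indicator (dyadic n q) x)" for x
  have sL: "s \<in> Lp p"
    unfolding s_def
  proof (intro Lp_sum[OF p1] Lp_cmult[OF p1])
    show "indicator (dyadic n q) \<in> Lp p" for q
      by (rule Lp_bounded_support(1)[OF p1, where B = 1 and c = "of_int q / 2 ^ n" and d = "(of_int q + 1) / 2 ^ n"])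
        (auto simp: dyadic_def indicator_def)
  qed
  have s_floor: "s x = s y" if "\<lfloor>2 ^ n * x\<rfloor> = \<lfloor>2 ^ n * y\<rfloor>" for x y
    unfolding s_def using that by (auto simp: indicator_def dyadic_iff)
  have s_const: "s x = s y" if "\<lfloor>2 ^ m * x\<rfloor> = \<lfloor>2 ^ m * y\<rfloor>" "n \<le> m" for x y m
  proof (rule s_floor)
    have "m = n + (m - n)" using that by simp
    then show "\<lfloor>2 ^ n * x\<rfloor> = \<lfloor>2 ^ n * y\<rfloor>"
      using floor_dyadic_div[of n x "m - n"] floor_dyadic_div[of n y "m - n"] that by simp
  qed
  have dy: "of_int q / 2 ^ m \<in> dyadic m q" for m q by (simp add: dyadic_iff)
  have avg_s: "avg m q s = s x" if "n \<le> m" "x \<in> dyadic m q" for m q x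
    by (rule avg_const) (use s_const[OF _ that(1)] that(2) in \<open>auto simp: dyadic_iff\<close>)
  have high: "haar_dual i s = 0" if i: "n < fst i" for i
  proof -
    obtain j q where ij: "i = (Suc j, q)" and j: "n \<le> j" using i by (cases i; cases "fst i") auto
    define y z where "y = of_int (2 * q) / (2::real) ^ Suc j" and "z = of_int (2 * q + 1) / (2::real) ^ Suc j"
    have yz: "y \<in> dyadic (Suc j) (2 * q)" "z \<in> dyadic (Suc j) (2 * q + 1)" unfolding y_def z_def by (rule dy)+
    then have "\<lfloor>2 ^ j * y\<rfloor> = \<lfloor>2 ^ j * z\<rfloor>"
      using floor_dyadic_div[of j y 1] floor_dyadic_div[of j z 1] by (simp add: dyadic_iff)
    then have "s y = s z" using s_const j by blast
    moreover have "avg (Suc j) (2 * q) s = s y" "avg (Suc j) (2 * q + 1) s = s z"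
      using j by (intro avg_s yz; simp)+
    ultimately show ?thesis by (simp add: ij haar_coeff_def)
  qed
  define F0 where "F0 = {i. fst i \<le> n \<and> haar_dual i s \<noteq> 0}"
  have F0: "finite F0"
  proof (rule finite_subset)
    \<comment> \<open>A nonzero coefficient forces s to be nonzero somewhere on its cell, so the
      cell is an ancestor of one of the finitely many cells in Q.\<close>
    show "F0 \<subseteq> (\<lambda>(l, q). (l, q div 2 ^ (n - (l - 1)))) ` ({..n} \<times> Q)"
    proof
      fix i assume i: "i \<in> F0"
      obtain l q where lq: "i = (l, q)" by (cases i)
      have l: "l \<le> n" "haar_dual (l, q) s \<noteq> 0" using i by (auto simp: F0_def lq)
      have "\<exists>x. x \<in> dyadic (l - 1) q \<and> s x \<noteq> 0"
      proof (rule ccontr)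
        assume no: "\<not> ?thesis"
        have z: "avg m r s = 0" if "dyadic m r \<subseteq> dyadic (l - 1) q" for m r
          by (rule avg_const) (use no that in blast)
        show False
        proof (cases l)
          case 0
          then show ?thesis using z[of 0 q] l by simp
        next
          case (Suc j)
          have "dyadic (Suc j) (2 * q) \<subseteq> dyadic j q" "dyadic (Suc j) (2 * q + 1) \<subseteq> dyadic j q"
            using floor_dyadic_div[of j _ 1] by (auto simp: dyadic_iff)
          then show ?thesis using z[of "Suc j"] l Suc by (simp add: haar_coeff_def)
        qed
      qed
      then obtain x where x: "x \<in> dyadic (l - 1) q" "s x \<noteq> 0" by blast
      have "\<lfloor>2 ^ n * x\<rfloor> \<in> Q" using x(2) sum_dyadic_steps_outside[of n x Q b] by (auto simp: s_def)
      moreover have "q = \<lfloor>2 ^ n * x\<rfloor> div 2 ^ (n - (l - 1))"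
        using x(1) l floor_dyadic_div[of "l - 1" x "n - (l - 1)"] by (simp add: dyadic_iff)
      ultimately show "i \<in> (\<lambda>(l, q). (l, q div 2 ^ (n - (l - 1)))) ` ({..n} \<times> Q)"
        using l by (force simp: lq)
    qed
  qed (use Q in simp)
  show ?thesis
  proof (rule that[OF F0])
    fix F and \<theta> :: "nat \<times> int \<Rightarrow> real"
    assume F: "finite F" "F0 \<subseteq> F" and \<theta>: "\<And>i. i \<in> F \<Longrightarrow> \<bar>\<theta> i\<bar> \<le> 1" "\<And>i. i \<in> F0 \<Longrightarrow> \<theta> i = 1"
    let ?S = "\<lambda>h x. \<Sum>i\<in>F. of_real (\<theta> i) * haar_dual i h * haar i x"
    have c: "of_real (\<theta> i) * haar_dual i s = haar_dual i s" for i
    proof (cases "haar_dual i s = 0")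
      case False
      then have "fst i \<le> n" using high by (meson not_less)
      then show ?thesis using False \<theta>(2)[of i] by (simp add: F0_def)
    qed simp
    define m where "m = Max (insert n (fst ` F))"
    have m: "n \<le> m" "\<And>i. i \<in> F \<Longrightarrow> fst i \<le> m" using F by (auto simp: m_def)
    have Ss: "?S s x = s x" for x
    proof -
      have "?S s x = (\<Sum>i\<in>F. haar_dual i s * haar i x)" by (simp only: c)
      also have "\<dots> = haar_dual (0, \<lfloor>x\<rfloor>) s + haar_part (\<lambda>i. haar_dual i s) 0 m x"
      proof (rule sum_haar_eq_haar_part[OF F(1) _ m(2)])
        fix i assume "i \<notin> F"
        then have "i \<notin> F0" using F by blast
        then show "haar_dual i s = 0" using high[of i] by (auto simp: F0_def)
      qed
      also have "\<dots> = avg m \<lfloor>2 ^ m * x\<rfloor> s" using avg_telescope[OF p1 sL] by simp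
      also have "\<dots> = s x" by (rule avg_s[OF m(1)]) (simp add: dyadic_iff)
      finally show ?thesis .
    qed
    define d where "d x = h x - s x" for x
    have dL: "d \<in> Lp p" unfolding d_def by (intro Lp_diff[OF p1] h sL)
    have hd: "haar_dual i h = haar_dual i s + haar_dual i d" for i
      using haar_dual_diff[OF p1 h sL, of i] by (simp add: d_def[abs_def])
    have "h x - ?S h x = d x - ?S d x" for x
    proof -
      have "?S h x = ?S s x + ?S d x" unfolding hd by (simp add: algebra_simps sum.distrib)
      then show ?thesis by (simp add: Ss d_def)
    qed
    then have "lp_norm p (\<lambda>x. h x - ?S h x) = lp_norm p (\<lambda>x. d x - ?S d x)" by presburger
    also have "\<dots> \<le> lp_norm p d + lp_norm p (?S d)"
      by (intro lp_norm_triangle_diff[OF p1] dL Lp_sum[OF p1] Lp_cmult[OF p1] haar_Lp[OF p1])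
    also have "\<dots> \<le> lp_norm p d + C * lp_norm p d"
      using C(2)[THEN bspec, OF dL, THEN spec, THEN spec, THEN mp, OF F(1), THEN mp] \<theta>(1) by (intro add_left_mono) blast
    also have "\<dots> < e"
    proof -
      have "lp_norm p d < e / (1 + C)" using app by (simp only: d_def[abs_def] s_def)
      then have "(1 + C) * lp_norm p d < e" using C(1) by (simp add: pos_less_divide_eq mult.commute)
      then show ?thesis by (simp add: distrib_right)
    qed
    finally show "lp_norm p (\<lambda>x. h x - ?S h x) < e" .
  qed
qed

section \<open>Gabor frames along a scattered sequence\<close>

text \<open>\<open>R i\<close> bounds both the support of \<open>e i\<close> and the region on which
  \<open>es i\<close> depends. Monotone radii let a later index control all earlier ones, so that
  errors vanishing on its interval are invisible to earlier functionals.\<close>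

locale unconditional_system =
  fixes p :: real and e :: "nat \<Rightarrow> real \<Rightarrow> complex" and es :: "nat \<Rightarrow> (real \<Rightarrow> complex) \<Rightarrow> complex"
    and Cc R :: "nat \<Rightarrow> real"
  assumes p2: "2 < p"
    and e_Lp: "e i \<in> Lp p" and e_norm: "lp_norm p (e i) \<le> 1"
    and es_add: "f \<in> Lp p \<Longrightarrow> f' \<in> Lp p \<Longrightarrow> es i (\<lambda>x. f x + f' x) = es i f + es i f'"
    and es_cmult: "f \<in> Lp p \<Longrightarrow> es i (\<lambda>x. c * f x) = c * es i f"
    and es_bound: "f \<in> Lp p \<Longrightarrow> norm (es i f) \<le> Cc i * lp_norm p f" and Cc: "1 \<le> Cc i"
    and R_mono: "i \<le> j \<Longrightarrow> R i \<le> R j" and R_nonneg: "0 \<le> R i"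
    and e_supp: "e i x \<noteq> 0 \<Longrightarrow> \<bar>x\<bar> \<le> R i"
    and es_local: "(\<And>x. \<bar>x\<bar> \<le> R i \<Longrightarrow> f x = f' x) \<Longrightarrow> es i f = es i f'"
    and unconditional: "h \<in> Lp p \<Longrightarrow> 0 < \<epsilon> \<Longrightarrow> \<exists>n0. \<forall>F \<theta>. finite F \<longrightarrow> {..<n0} \<subseteq> F \<longrightarrow> (\<forall>i\<in>F. \<bar>\<theta> i\<bar> \<le> (1::real)) \<longrightarrow>
      (\<forall>i<n0. \<theta> i = 1) \<longrightarrow> lp_norm p (\<lambda>x. h x - (\<Sum>i\<in>F. of_real (\<theta> i) * es i h * e i x)) < \<epsilon>"
begin

lemma p1: "1 \<le> p" using p2 by simp

text \<open>The error permitted to block j: multiplied by the coefficient bound \<open>Cc j\<close>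
  it is 2^-(j + 2), summable even after the factor 2 lost in \<open>D_eta\<close>.\<close>

definition \<eta> :: "nat \<Rightarrow> real" where "\<eta> j = 1 / (2 ^ (j + 2) * Cc j)"

lemma \<eta>: "0 < \<eta> j" "\<eta> j \<le> 1" "\<eta> j * Cc j = 1 / 2 ^ (j + 2)"
proof -
  have c: "0 < Cc j" using Cc[of j] by simp
  then show "0 < \<eta> j" "\<eta> j * Cc j = 1 / 2 ^ (j + 2)" by (simp_all add: \<eta>_def)
  have "1 * 1 \<le> 2 ^ (j + 2) * Cc j" using Cc[of j] by (intro mult_mono one_le_power) auto
  then show "\<eta> j \<le> 1" unfolding \<eta>_def by (subst divide_le_eq_1_pos) (use c in auto)
qed

text \<open>Candidate block length for the budget \<open>\<epsilon>\<close>. The exponent 2/p - 1 is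
  what remains of K^(1/p) after division by K times \<epsilon> K^(-1/p); it is negative because p >
  2, so suitable K exist.\<close>

definition Kf :: "nat \<Rightarrow> real \<Rightarrow> nat" where
  "Kf j \<epsilon> = (SOME K. 1 \<le> K \<and> real K powr (2 / p - 1) \<le> \<epsilon> * \<eta> j / 2)"

lemma Kf:
  assumes "0 < \<epsilon>"
  shows "1 \<le> Kf j \<epsilon>" "real (Kf j \<epsilon>) powr (2 / p - 1) \<le> \<epsilon> * \<eta> j / 2"
proof -
  have "((\<lambda>x. x powr (2 / p - 1)) \<longlongrightarrow> 0) at_top"
    using p2 by (intro tendsto_neg_powr filterlim_ident) (simp add: field_simps)
  then have "((\<lambda>K. real K powr (2 / p - 1)) \<longlongrightarrow> 0) sequentially"
    by (rule filterlim_compose[OF _ filterlim_real_sequentially])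
  moreover have "0 < \<epsilon> * \<eta> j / 2" using assms \<eta> by simp
  ultimately have "\<forall>\<^sub>F K in sequentially. real K powr (2 / p - 1) < \<epsilon> * \<eta> j / 2" by (rule order_tendstoD)
  with eventually_ge_at_top[of 1] have "\<forall>\<^sub>F K in sequentially. 1 \<le> K \<and> real K powr (2 / p - 1) \<le> \<epsilon> * \<eta> j / 2"
    by eventually_elim simp
  then have "\<exists>K. 1 \<le> K \<and> real K powr (2 / p - 1) \<le> \<epsilon> * \<eta> j / 2"
    by (auto simp: eventually_sequentially)
  from someI_ex[OF this] show "1 \<le> Kf j \<epsilon>" "real (Kf j \<epsilon>) powr (2 / p - 1) \<le> \<epsilon> * \<eta> j / 2"
    by (simp_all add: Kf_def)
qed

text \<open>The norm allotted to block j of the generator. The factor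
  \<open>\<alpha> j * \<eta> j / 4\<close>, written out through \<open>Kf\<close> because
  \<open>K\<close> is defined from \<open>eps\<close>, keeps all later blocks within a third of the
  error permitted to block j after division by \<open>\<alpha> j\<close>. The start 1/4 keeps the
  total at most 1/3.\<close>

primrec eps :: "nat \<Rightarrow> real" where
  "eps 0 = 1 / 4"
| "eps (Suc j) = eps j * real (Kf j (eps j)) powr (- 1 / p) * \<eta> j / 4"

definition K :: "nat \<Rightarrow> nat" where "K j = Kf j (eps j)"
definition \<alpha> :: "nat \<Rightarrow> real" where "\<alpha> j = eps j * real (K j) powr (- 1 / p)"

lemma eps_pos: "0 < eps j"
proof (induction j)
  case (Suc j)
  then show ?case using Kf(1)[OF Suc, of j] \<eta>(1)[of j] by simp
qed simp

lemma K: "1 \<le> K j" "real (K j) powr (2 / p - 1) \<le> eps j * \<eta> j / 2"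
  using Kf[OF eps_pos] by (simp_all add: K_def)

lemma eps_Suc: "eps (Suc j) = \<alpha> j * \<eta> j / 4"
  by (simp add: \<alpha>_def K_def)

declare eps.simps(2) [simp del]

lemma \<alpha>: "0 < \<alpha> j" "\<alpha> j \<le> eps j"
proof -
  show "0 < \<alpha> j" using K(1)[of j] eps_pos[of j] by (simp add: \<alpha>_def)
  have "real (K j) powr (- 1 / p) \<le> real (K j) powr 0"
    using K(1)[of j] p2 by (intro powr_mono) auto
  then have "real (K j) powr (- 1 / p) \<le> 1" using K(1)[of j] by simp
  then show "\<alpha> j \<le> eps j" using eps_pos[of j] by (simp add: \<alpha>_def mult_left_le)
qed

lemma eps_quarter: "eps (Suc j) \<le> eps j / 4"
proof -
  have "\<alpha> j * \<eta> j \<le> eps j * 1" using \<alpha>[of j] \<eta>[of j] eps_pos[of j] by (intro mult_mono) auto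
  then show ?thesis by (simp add: eps_Suc)
qed

lemma eps_tail: "(\<Sum>i<n. eps (i + j)) \<le> 4 / 3 * eps j"
proof (induction n arbitrary: j)
  case (Suc n)
  have "(\<Sum>i<Suc n. eps (i + j)) = eps j + (\<Sum>i<n. eps (i + Suc j))"
    by (subst sum.lessThan_Suc_shift) simp
  also have "\<dots> \<le> eps j + 4 / 3 * eps (Suc j)" by (intro add_left_mono Suc)
  also have "\<dots> \<le> 4 / 3 * eps j" using eps_quarter[of j] by simp
  finally show ?case .
qed (simp add: less_imp_le[OF eps_pos])

lemma \<alpha>_K: "real (K j) powr (1 / p) * \<alpha> j = eps j"
  using K(1)[of j] by (simp add: \<alpha>_def flip: powr_add)

definition B :: "nat \<Rightarrow> nat" where "B j = (\<Sum>i<j. K i)"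
definition N :: "nat \<Rightarrow> nat set" where "N j = {B j..<B (Suc j)}"

lemma B_Suc: "B (Suc j) = B j + K j" by (simp add: B_def)

lemma card_N: "card (N j) = K j" "finite (N j)" by (auto simp: N_def B_Suc)

lemma B_mono: "i \<le> j \<Longrightarrow> B i \<le> B j"
  unfolding B_def by (rule sum_mono2) auto

lemma B_ge: "j \<le> B j"
proof (induction j)
  case (Suc j)
  then show ?case using K(1)[of j] by (simp add: B_Suc)
qed simp

lemma N_ge: "n \<in> N j \<Longrightarrow> j \<le> n" using B_ge[of j] by (auto simp: N_def)

lemma N_unique: "n \<in> N i \<Longrightarrow> n \<in> N j \<Longrightarrow> i = j"
proof (rule ccontr)
  assume n: "n \<in> N i" "n \<in> N j" and "i \<noteq> j"
  then consider "Suc i \<le> j" | "Suc j \<le> i" by linarith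
  then show False
  proof cases
    case 1 from B_mono[OF 1] n show ?thesis by (simp add: N_def)
  next
    case 2 from B_mono[OF 2] n show ?thesis by (simp add: N_def)
  qed
qed

lemma N_cover: "{..<B J} = (\<Union>j<J. N j)"
proof (induction J)
  case (Suc J)
  have "{..<B (Suc J)} = {..<B J} \<union> N J" using B_mono[of J "Suc J"] by (auto simp: N_def)
  then show ?case using Suc by (auto simp: lessThan_Suc)
qed (simp add: B_def)

end

text \<open>The term 2 R n separates supports, \<open>real n\<close> pushes block j off [-j, j] and
  makes the series of the generator locally finite, and the fourfold sum leaves room for
  combinations of several earlier translations.\<close>

locale scattered_system = unconditional_system +
  fixes lam :: "nat \<Rightarrow> real \<times> real"
  assumes scattered: "4 * (\<Sum>k<n. \<bar>fst (lam k)\<bar>) + 2 * R n + real n < \<bar>fst (lam n)\<bar>"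
begin

abbreviation t :: "nat \<Rightarrow> real" where "t n \<equiv> fst (lam n)"
abbreviation s :: "nat \<Rightarrow> real" where "s n \<equiv> snd (lam n)"

lemma t_le: "k < n \<Longrightarrow> \<bar>t k\<bar> \<le> (\<Sum>k<n. \<bar>t k\<bar>)"
  by (rule member_le_sum) auto

lemma t_sep2:
  assumes "a \<noteq> b"
  shows "2 * R (max a b) + real (max a b) < \<bar>t a - t b\<bar>"
proof -
  have *: "2 * R a + real a < \<bar>t a - t b\<bar>" if "b < a" for a b
    using scattered[of a] t_le[OF that] by linarith
  from assms consider "b < a" | "a < b" by linarith
  then show ?thesis
  proof cases
    case 1 then show ?thesis using *[OF 1] by (simp add: max_def)
  next
    case 2 then show ?thesis using *[OF 2] by (simp add: max_def abs_minus_commute)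
  qed
qed

lemma t_sep4_aux:
  assumes "b \<le> a" "c < a" "d < a"
  shows "2 * R a < \<bar>t a + t b - t c - t d\<bar>"
proof (cases "a = b")
  case True
  then have "t b = t a" by simp
  then show ?thesis using scattered[of a] t_le[OF assms(2)] t_le[OF assms(3)] R_nonneg[of a] by linarith
next
  case False
  then have "b < a" using assms by simp
  then show ?thesis using scattered[of a] t_le[of b a] t_le[OF assms(2)] t_le[OF assms(3)] by linarith
qed

text \<open>The largest index occurs on one side only, so nothing cancels it. This separates the
  errors of two points n, n' of a block caused by different points m, m', where t n' + t m is
  compared with t n + t m'.\<close>

lemma t_sep4:
  assumes "a \<noteq> c" "a \<noteq> d" "b \<noteq> c" "b \<noteq> d"
  shows "2 * R a < \<bar>t a + t b - t c - t d\<bar>"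
proof -
  define m where "m = max (max a b) (max c d)"
  have m: "a \<le> m" "b \<le> m" "c \<le> m" "d \<le> m" "m \<in> {a, b, c, d}"
    unfolding m_def by (auto simp: max_def)
  have "2 * R m < \<bar>t a + t b - t c - t d\<bar>"
  proof -
    from m(5) consider "m = a" | "m = b" | "m = c" | "m = d" by auto
    then show ?thesis
    proof cases
      case 1 then show ?thesis using t_sep4_aux[of b a c d] assms m by simp
    next
      case 2 then show ?thesis using t_sep4_aux[of a b c d] assms m by (simp add: add.commute)
    next
      case 3
      have "\<bar>t c + t d - t a - t b\<bar> = \<bar>t a + t b - t c - t d\<bar>" by linarith
      then show ?thesis using 3 t_sep4_aux[of d c a b] assms m by simp
    next
      case 4
      have "\<bar>t d + t c - t a - t b\<bar> = \<bar>t a + t b - t c - t d\<bar>" by linarith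
      then show ?thesis using 4 t_sep4_aux[of c d a b] assms m by simp
    qed
  qed
  then show ?thesis using R_mono[OF m(1)] by linarith
qed

lemma lam_inj: "inj lam"
proof (rule injI, rule ccontr)
  fix a b assume ab: "lam a = lam b" "a \<noteq> b"
  then have "\<bar>t a - t b\<bar> = 0" by simp
  with t_sep2[OF ab(2)] R_nonneg[of "max a b"] show False by linarith
qed

definition y :: "nat \<Rightarrow> nat \<Rightarrow> real \<Rightarrow> complex" where
  "y j m x = of_real (\<alpha> j) * (modul (- s m) (x + t m) * e j (x + t m))"

definition G :: "nat \<Rightarrow> real \<Rightarrow> complex" where
  "G j x = (\<Sum>m\<in>N j. y j m x)"

definition g :: "real \<Rightarrow> complex" where
  "g x = (\<Sum>j. G j x)"

definition u :: "nat \<Rightarrow> real \<Rightarrow> complex" where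
  "u n = gabor g (lam n)"

lemma y_Lp: "y j m \<in> Lp p" "lp_norm p (y j m) \<le> \<alpha> j"
proof -
  note E = gabor_Lp[OF p1 e_Lp[of j], of 0 "- t m"]
  have m: "(\<lambda>x. modul (- s m) (x + t m)) \<in> borel_measurable borel" unfolding modul_def by measurable
  have z: "(\<lambda>x. e j (x + t m)) \<in> Lp p" "lp_norm p (\<lambda>x. e j (x + t m)) \<le> 1"
    using E e_norm[of j] by (simp_all add: transl_def)
  have w: "(\<lambda>x. modul (- s m) (x + t m) * e j (x + t m)) \<in> Lp p" "lp_norm p (\<lambda>x. modul (- s m) (x + t m) * e j (x + t m)) \<le> 1"
    using Lp_dominated[OF borel_measurable_times[OF m LpD(1)[OF z(1)]] z(1)] p1 z(2) by (auto simp: norm_mult)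
  show "y j m \<in> Lp p" unfolding y_def by (rule Lp_cmult[OF p1 w(1)])
  have "\<alpha> j * lp_norm p (\<lambda>x. modul (- s m) (x + t m) * e j (x + t m)) \<le> \<alpha> j * 1"
    using w(2) \<alpha>(1)[of j] by (intro mult_left_mono) auto
  then show "lp_norm p (y j m) \<le> \<alpha> j"
    unfolding y_def[abs_def] lp_norm_cmult[OF p1] using \<alpha>(1)[of j] by simp
qed

lemma y_supp: "y j m x \<noteq> 0 \<Longrightarrow> \<bar>x + t m\<bar> \<le> R j"
  by (rule e_supp) (auto simp: y_def)

lemma G_Lp: "G j \<in> Lp p"
  unfolding G_def by (intro Lp_sum[OF p1] y_Lp)

text \<open>The \<open>K j\<close> translates in a block have disjoint supports, hence the bound
  K^(1/p) \<alpha> = \<open>eps j\<close>.\<close>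

lemma G_norm: "lp_norm p (G j) \<le> eps j"
proof -
  have "lp_norm p (\<lambda>x. \<Sum>m\<in>N j. y j m x) \<le> real (card (N j)) powr (1/p) * \<alpha> j"
  proof (rule lp_norm_disjoint_sum[OF p1 card_N(2) y_Lp(1)])
    fix m m' x assume m: "m \<in> N j" "m' \<in> N j" "m \<noteq> m'" and "y j m x \<noteq> 0"
    then have "\<bar>x + t m\<bar> \<le> R j" by (intro y_supp)
    moreover have "R j \<le> R (max m m')" by (rule R_mono) (use N_ge[OF m(1)] in simp)
    then have "2 * R j < \<bar>t m - t m'\<bar>"
      using t_sep2[OF m(3)] of_nat_0_le_iff[of "max m m'", where 'a = real] by linarith
    ultimately have "\<not> \<bar>x + t m'\<bar> \<le> R j" by linarith
    then show "y j m' x = 0" using y_supp by blast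
  qed (use y_Lp(2) \<alpha>(1)[of j] in auto)
  then show ?thesis by (simp add: G_def[abs_def] card_N \<alpha>_K)
qed

lemma G_zero: "\<bar>x\<bar> \<le> real j \<Longrightarrow> G j x = 0"
  unfolding G_def
proof (rule sum.neutral, rule ballI, rule ccontr)
  fix m assume x: "\<bar>x\<bar> \<le> real j" and m: "m \<in> N j" "y j m x \<noteq> 0"
  have "0 \<le> (\<Sum>k<m. \<bar>t k\<bar>)" by (intro sum_nonneg) auto
  moreover have "R j \<le> R m" "real j \<le> real m" using N_ge[OF m(1)] R_mono by auto
  ultimately show False using y_supp[OF m(2)] scattered[of m] x R_nonneg[of j] by linarith
qed

lemma summable_G: "summable (\<lambda>j. G j x)"
proof -
  obtain n :: nat where n: "\<bar>x\<bar> \<le> real n" using real_arch_simple by blast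
  show ?thesis
    by (rule summable_finite[of "{..<n}"], simp, rule G_zero) (use n in auto)
qed

lemma G_tail:
  "(\<lambda>x. \<Sum>i. G (i + j) x) \<in> Lp p" "lp_norm p (\<lambda>x. \<Sum>i. G (i + j) x) \<le> 4 / 3 * eps j"
proof -
  have "(\<Sum>i<n. lp_norm p (G (i + j))) \<le> 4 / 3 * eps j" for n
    by (rule order.trans[OF sum_mono[OF G_norm] eps_tail])
  moreover have "summable (\<lambda>i. G (i + j) x)" for x
    using summable_G by (subst summable_iff_shift)
  ultimately show "(\<lambda>x. \<Sum>i. G (i + j) x) \<in> Lp p" "lp_norm p (\<lambda>x. \<Sum>i. G (i + j) x) \<le> 4 / 3 * eps j"
    by (rule Lp_suminf[OF p1 G_Lp, rotated])+
qed

lemma g_Lp: "g \<in> Lp p"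
  using G_tail(1)[of 0] by (simp add: g_def[abs_def])

lemma u_Lp: "u n \<in> Lp p"
  unfolding u_def using gabor_Lp(1)[OF p1 g_Lp] by (simp add: case_prod_beta)

lemma u_eq: "u n x = modul (s n) x * g (x - t n)"
  by (simp add: u_def case_prod_beta transl_def)

lemma gabor_y: "modul (s n) x * y j n (x - t n) = of_real (\<alpha> j) * e j x"
proof -
  have 1: "modul (s n) x * modul (- s n) x = 1" by (simp flip: modul_add)
  have "modul (s n) x * (of_real (\<alpha> j) * (modul (- s n) x * e j x)) = (modul (s n) x * modul (- s n) x) * (of_real (\<alpha> j) * e j x)"
    by (simp only: mult_ac)
  then have "modul (s n) x * (of_real (\<alpha> j) * (modul (- s n) x * e j x)) = of_real (\<alpha> j) * e j x"
    unfolding 1 by simp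
  then show ?thesis by (simp add: y_def)
qed

lemma cross_term_far:
  assumes "n \<in> N j" "m \<in> N i" "m \<noteq> n" "\<bar>x - t n + t m\<bar> \<le> R i"
  shows "R j + real j < \<bar>x\<bar>"
proof -
  have "2 * R (max m n) + real (max m n) < \<bar>t m - t n\<bar>" by (rule t_sep2[OF assms(3)])
  moreover have "R i \<le> R (max m n)" "R j \<le> R (max m n)" "real j \<le> real (max m n)"
    using N_ge[OF assms(1)] N_ge[OF assms(2)] R_mono by auto
  ultimately show ?thesis using assms(4) by linarith
qed

text \<open>Every other term of \<open>g\<close>, shifted by \<open>lam n\<close>, lives beyond R j
  + j because distinct points are far apart. Hence the functionals \<open>es i\<close> with i \<le>
  j do not see the error of block j.\<close>

lemma u_near:
  assumes n: "n \<in> N j" and x: "\<bar>x\<bar> \<le> R j + real j"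
  shows "u n x = of_real (\<alpha> j) * e j x"
proof -
  have z: "y i m (x - t n) = 0" if "m \<in> N i" "m \<noteq> n" for i m
    using cross_term_far[OF n that] y_supp[of i m "x - t n"] x by force
  have "G i (x - t n) = (if i = j then y j n (x - t n) else 0)" for i
  proof (cases "i = j")
    case True
    have "(\<Sum>m\<in>N j. y j m (x - t n)) = (\<Sum>m\<in>{n}. y j m (x - t n))"
      by (rule sum.mono_neutral_right) (use n z card_N in auto)
    then show ?thesis using True by (simp add: G_def)
  next
    case False
    then have "n \<notin> N i" using N_unique n by blast
    then have "G i (x - t n) = 0" unfolding G_def by (intro sum.neutral ballI z) auto
    then show ?thesis using False by simp
  qed
  then have "g (x - t n) = (\<Sum>i. if i = j then y j n (x - t n) else 0)" by (simp add: g_def)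
  also have "\<dots> = y j n (x - t n)" using sums_unique[OF sums_single[of j "\<lambda>_. y j n (x - t n)"]] by simp
  finally show ?thesis by (simp add: u_eq gabor_y)
qed

end

section \<open>Errors of the blocks and the perturbed coefficients\<close>

context scattered_system
begin

text \<open>Normalised by the full length \<open>K j\<close> even when A is only part of the block:
  the normalised sum of the shifts over A is then \<open>card A / K j\<close> times
  \<open>e j\<close> plus \<open>err A j\<close>.\<close>

definition err :: "nat set \<Rightarrow> nat \<Rightarrow> real \<Rightarrow> complex" where
  "err A j x = of_real (1 / (\<alpha> j * real (K j))) * (\<Sum>n\<in>A. u n x - of_real (\<alpha> j) * e j x)"

lemma err_Lp: "err A j \<in> Lp p"
  unfolding err_def by (intro Lp_cmult[OF p1] Lp_sum[OF p1] Lp_diff[OF p1] u_Lp e_Lp)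

lemma err_zero: "A \<subseteq> N j \<Longrightarrow> \<bar>x\<bar> \<le> R j + real j \<Longrightarrow> err A j x = 0"
  unfolding err_def by (subst sum.neutral) (use u_near in auto)

text \<open>The terms of \<open>g\<close> up to the \<open>j\<close>-th block produce essentially disjoint errors, so that the errors
  of block \<open>j\<close> add up to about \<open>K\<^sup>1\<^sup>/\<^sup>p\<close>; this beats the normalising factor \<open>\<alpha> K\<close> because \<open>p > 2\<close>.\<close>

lemma err_norm:
  assumes A: "A \<subseteq> N j"
  shows "lp_norm p (err A j) \<le> \<eta> j"
proof -
  have fA: "finite A" using A card_N(2) finite_subset by blast
  have cA: "card A \<le> K j" using A card_N card_mono by metis
  \<comment> \<open>The later blocks in Q have norm at most \<alpha> \<eta> / 3, so the triangle
    inequality suffices for them. The blocks up to j in P are not that small and need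
    disjointness.\<close>
  define P where "P z = (\<Sum>i<Suc j. G i z)" for z
  define Q where "Q z = (\<Sum>i. G (i + Suc j) z)" for z
  have gPQ: "g z = Q z + P z" for z
    unfolding g_def P_def Q_def by (rule suminf_split_initial_segment[OF summable_G])
  have PL: "P \<in> Lp p" unfolding P_def by (intro Lp_sum[OF p1] G_Lp)
  have QL: "Q \<in> Lp p" "lp_norm p Q \<le> 4 / 3 * eps (Suc j)"
    unfolding Q_def[abs_def] using G_tail[of "Suc j"] by simp_all
  have eps_sum: "(\<Sum>i<Suc j. eps i) \<le> 1 / 3" using eps_tail[where n = "Suc j" and j = 0] by simp
  have Pn: "lp_norm p P \<le> 1 / 3"
    unfolding P_def[abs_def]
    by (rule order.trans[OF lp_norm_sum[OF p1 G_Lp] order.trans[OF sum_mono[OF G_norm] eps_sum]])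
  have "eps j \<le> (\<Sum>i<Suc j. eps i)" by (rule member_le_sum) (auto intro: less_imp_le[OF eps_pos])
  then have a13: "\<alpha> j \<le> 1 / 3" using \<alpha>(2)[of j] eps_sum by linarith
  define v where "v n x = modul (s n) x * transl (t n) P x - of_real (\<alpha> j) * e j x" for n x
  define w where "w n x = modul (s n) x * transl (t n) Q x" for n x
  have uvw: "u n x - of_real (\<alpha> j) * e j x = v n x + w n x" for n x
    by (simp add: u_eq gPQ v_def w_def transl_def algebra_simps)
  have vL: "v n \<in> Lp p" for n
    unfolding v_def by (intro Lp_diff[OF p1] gabor_Lp[OF p1] Lp_cmult[OF p1] PL e_Lp)
  have vn: "lp_norm p (v n) \<le> 1" for n
  proof -
    have "lp_norm p (v n) \<le> lp_norm p (\<lambda>x. modul (s n) x * transl (t n) P x) + lp_norm p (\<lambda>x. of_real (\<alpha> j) * e j x)"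
      unfolding v_def[abs_def] by (intro lp_norm_triangle_diff[OF p1] gabor_Lp[OF p1] Lp_cmult[OF p1] PL e_Lp)
    also have "\<dots> \<le> 1 / 3 + \<alpha> j * 1"
      unfolding gabor_Lp(2)[OF p1 PL] lp_norm_cmult[OF p1]
      using Pn e_norm[of j] \<alpha>(1)[of j] by (intro add_mono) auto
    finally show ?thesis using a13 by simp
  qed
  have wL: "w n \<in> Lp p" "lp_norm p (w n) \<le> \<alpha> j * \<eta> j / 3" for n
    unfolding w_def[abs_def] using gabor_Lp[OF p1 QL(1), of "s n" "t n"] QL(2) by (simp_all add: eps_Suc mult.commute)
  \<comment> \<open>What survives in \<open>v n\<close> comes from a point m other than n in some
    block up to j, hence from a support of radius at most R j.\<close>
  have v_far: "\<exists>m. m \<noteq> n \<and> \<bar>x - t n + t m\<bar> \<le> R j" if n: "n \<in> N j" and "v n x \<noteq> 0" for n x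
  proof (rule ccontr)
    assume no: "\<not> ?thesis"
    have z: "y i m (x - t n) = 0" if "m \<noteq> n" "i \<le> j" for i m
      using no y_supp[of i m "x - t n"] R_mono[OF that(2)] that(1) by force
    have "G i (x - t n) = (if i = j then y j n (x - t n) else 0)" if "i < Suc j" for i
    proof (cases "i = j")
      case True
      have "(\<Sum>m\<in>N j. y j m (x - t n)) = (\<Sum>m\<in>{n}. y j m (x - t n))"
        by (rule sum.mono_neutral_right) (use n z card_N in auto)
      then show ?thesis using True by (simp add: G_def)
    next
      case False
      then have "n \<notin> N i" using N_unique n by blast
      then have "G i (x - t n) = 0" unfolding G_def using that by (intro sum.neutral ballI z) auto
      then show ?thesis using False by simp
    qed
    then have "P (x - t n) = (\<Sum>i<Suc j. if i = j then y j n (x - t n) else 0)"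
      unfolding P_def by (intro sum.cong) auto
    also have "\<dots> = y j n (x - t n)" by simp
    finally have "v n x = 0" by (simp add: v_def transl_def gabor_y)
    then show False using that by simp
  qed
  have V: "lp_norm p (\<lambda>x. \<Sum>n\<in>A. v n x) \<le> real (K j) powr (1/p)"
  proof -
    have "lp_norm p (\<lambda>x. \<Sum>n\<in>A. v n x) \<le> real (card A) powr (1/p) * 1"
    proof (rule lp_norm_disjoint_sum[OF p1 fA vL _ vn])
      fix n n' x assume n: "n \<in> A" "n' \<in> A" "n \<noteq> n'" and v: "v n x \<noteq> 0"
      have N: "n \<in> N j" "n' \<in> N j" using n A by auto
      show "v n' x = 0"
      proof (rule ccontr)
        assume v': "v n' x \<noteq> 0"
        obtain m where m: "m \<noteq> n" "\<bar>x - t n + t m\<bar> \<le> R j" using v_far[OF N(1) v] by blast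
        obtain m' where m': "m' \<noteq> n'" "\<bar>x - t n' + t m'\<bar> \<le> R j" using v_far[OF N(2) v'] by blast
        have Rj: "R j \<le> R n'" "R j \<le> R (max n' n)" using N_ge[OF N(2)] R_mono by auto
        show False
        \<comment> \<open>Two errors at the same x: if m = m', then t n and t n' are too close for
          \<open>t_sep2\<close>; otherwise t n' + t m and t n + t m' are too close for
          \<open>t_sep4\<close>.\<close>
        proof (cases "m = m'")
          case True
          have "\<bar>t n' - t n\<bar> \<le> 2 * R j" using m(2) m'(2) True by (simp add: abs_le_iff)
          moreover have "0 \<le> real (max n' n)" by simp
          ultimately show False using t_sep2[OF n(3)[symmetric]] Rj by linarith
        next
          case False
          have "2 * R n' < \<bar>t n' + t m - t n - t m'\<bar>"
            by (rule t_sep4) (use n m m' False in auto)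
          then show False using m(2) m'(2) Rj by linarith
        qed
      qed
    qed simp
    also have "\<dots> \<le> real (K j) powr (1/p)" using cA p1 by (simp add: powr_mono2)
    finally show ?thesis .
  qed
  have W: "lp_norm p (\<lambda>x. \<Sum>n\<in>A. w n x) \<le> real (K j) * (\<alpha> j * \<eta> j / 3)"
  proof -
    have "lp_norm p (\<lambda>x. \<Sum>n\<in>A. w n x) \<le> (\<Sum>n\<in>A. \<alpha> j * \<eta> j / 3)"
      by (rule order.trans[OF lp_norm_sum[OF p1 wL(1)] sum_mono[OF wL(2)]])
    also have "\<dots> = real (card A) * (\<alpha> j * \<eta> j / 3)" by simp
    also have "\<dots> \<le> real (K j) * (\<alpha> j * \<eta> j / 3)"
      using cA \<alpha>(1)[of j] \<eta>(1)[of j] by (intro mult_right_mono) auto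
    finally show ?thesis .
  qed
  have aK: "0 < \<alpha> j * real (K j)" using \<alpha>(1)[of j] K(1)[of j] by simp
  have "lp_norm p (err A j) = 1 / (\<alpha> j * real (K j)) * lp_norm p (\<lambda>x. (\<Sum>n\<in>A. v n x) + (\<Sum>n\<in>A. w n x))"
    unfolding err_def[abs_def] lp_norm_cmult[OF p1] uvw sum.distrib norm_of_real using aK by simp
  also have "\<dots> \<le> 1 / (\<alpha> j * real (K j)) * (real (K j) powr (1/p) + real (K j) * (\<alpha> j * \<eta> j / 3))"
  proof (rule mult_left_mono)
    have "lp_norm p (\<lambda>x. (\<Sum>n\<in>A. v n x) + (\<Sum>n\<in>A. w n x)) \<le> lp_norm p (\<lambda>x. \<Sum>n\<in>A. v n x) + lp_norm p (\<lambda>x. \<Sum>n\<in>A. w n x)"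
      by (intro lp_norm_triangle[OF p1] Lp_sum[OF p1] vL wL)
    then show "lp_norm p (\<lambda>x. (\<Sum>n\<in>A. v n x) + (\<Sum>n\<in>A. w n x)) \<le> real (K j) powr (1/p) + real (K j) * (\<alpha> j * \<eta> j / 3)"
      using V W by linarith
  qed (use aK in simp)
  \<comment> \<open>Since \<alpha> = eps K^(-1/p), the first quotient has exponent 1/p - 1 + 1/p.
    The choice of \<open>K j\<close> makes it at most \<eta> / 2, and 1/2 + 1/3 < 1.\<close>
  also have "\<dots> = real (K j) powr (2 / p - 1) / eps j + \<eta> j / 3"
  proof -
    have K0: "0 < real (K j)" using K(1)[of j] by simp
    have "real (K j) powr (1/p) = real (K j) powr (2 / p - 1) * (real (K j) powr (- 1 / p) * real (K j))"
    proof -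
      have "real (K j) powr (2 / p - 1) * (real (K j) powr (- 1 / p) * real (K j) powr 1)
          = real (K j) powr ((2 / p - 1) + ((- 1 / p) + 1))"
        by (simp only: powr_add)
      also have "(2 / p - 1) + ((- 1 / p) + 1) = 1 / p" by (simp add: field_simps)
      finally show ?thesis using K0 by simp
    qed
    then show ?thesis using K0 eps_pos[of j] \<alpha>(1)[of j]
      by (simp add: distrib_left) (simp add: \<alpha>_def)
  qed
  also have "real (K j) powr (2 / p - 1) / eps j \<le> \<eta> j / 2"
    using K(2)[of j] eps_pos[of j] by (simp add: pos_divide_le_eq mult.commute)
  finally show ?thesis using \<eta>(1)[of j] by simp
qed

text \<open>Forward substitution for h in f = h + sum of \<open>es j h\<close> times
  \<open>err (N j) j\<close>. \<open>V i f\<close> is the part of the correction known when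
  coefficient i is computed, and \<open>D i f\<close> below is that coefficient of h.\<close>

primrec V :: "nat \<Rightarrow> (real \<Rightarrow> complex) \<Rightarrow> real \<Rightarrow> complex" where
  "V 0 f = (\<lambda>x. 0)"
| "V (Suc i) f = (\<lambda>x. V i f x + es i (\<lambda>x. f x - V i f x) * err (N i) i x)"

definition D :: "nat \<Rightarrow> (real \<Rightarrow> complex) \<Rightarrow> complex" where
  "D i f = es i (\<lambda>x. f x - V i f x)"

lemma V_sum: "V i f x = (\<Sum>j<i. D j f * err (N j) j x)"
  by (induction i) (auto simp: D_def)

lemma V_Lp: "V i f \<in> Lp p"
  unfolding V_sum[abs_def] by (intro Lp_sum[OF p1] Lp_cmult[OF p1] err_Lp)

lemma V_linear:
  assumes "f \<in> Lp p" "f' \<in> Lp p"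
  shows "V i (\<lambda>x. f x + f' x) = (\<lambda>x. V i f x + V i f' x)" "V i (\<lambda>x. c * f x) = (\<lambda>x. c * V i f x)"
proof (induction i)
  case (Suc i)
  case 1
  have "es i (\<lambda>x. f x + f' x - V i (\<lambda>x. f x + f' x) x) = es i (\<lambda>x. (f x - V i f x) + (f' x - V i f' x))"
    unfolding Suc(1) by (simp add: algebra_simps)
  also have "\<dots> = es i (\<lambda>x. f x - V i f x) + es i (\<lambda>x. f' x - V i f' x)"
    by (intro es_add Lp_diff[OF p1] assms V_Lp)
  finally show ?case by (simp add: Suc(1) algebra_simps)
next
  case (Suc i)
  case 2
  have "es i (\<lambda>x. c * f x - V i (\<lambda>x. c * f x) x) = es i (\<lambda>x. c * (f x - V i f x))"
    unfolding Suc(2) by (simp add: algebra_simps)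
  also have "\<dots> = c * es i (\<lambda>x. f x - V i f x)"
    by (intro es_cmult Lp_diff[OF p1] assms V_Lp)
  finally show ?case by (simp add: Suc(2) algebra_simps)
qed auto

lemma D_linear:
  assumes "f \<in> Lp p" "f' \<in> Lp p"
  shows "D i (\<lambda>x. f x + f' x) = D i f + D i f'" "D i (\<lambda>x. c * f x) = c * D i f"
proof -
  have "(\<lambda>x. f x + f' x - (V i f x + V i f' x)) = (\<lambda>x. (f x - V i f x) + (f' x - V i f' x))"
    "(\<lambda>x. c * f x - c * V i f x) = (\<lambda>x. c * (f x - V i f x))"
    by (simp_all add: algebra_simps)
  then show "D i (\<lambda>x. f x + f' x) = D i f + D i f'" "D i (\<lambda>x. c * f x) = c * D i f"
    unfolding D_def V_linear(1)[OF assms] V_linear(2)[OF assms]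
    by (simp_all only: es_add[OF Lp_diff[OF p1 assms(1) V_Lp] Lp_diff[OF p1 assms(2) V_Lp]]
        es_cmult[OF Lp_diff[OF p1 assms(1) V_Lp]])
qed

lemma half_sum: "(\<Sum>i<n. 1 / 2 ^ (i + J + 1) :: real) \<le> 1 / 2 ^ J"
proof (induction n arbitrary: J)
  case (Suc n)
  have "(\<Sum>i<Suc n. 1 / 2 ^ (i + J + 1) :: real) = 1 / 2 ^ (J + 1) + (\<Sum>i<n. 1 / 2 ^ (i + Suc J + 1))"
    by (subst sum.lessThan_Suc_shift) simp
  also have "\<dots> \<le> 1 / 2 ^ (J + 1) + 1 / 2 ^ Suc J" by (intro add_left_mono Suc)
  finally show ?case by simp
qed simp

text \<open>Strong induction: the earlier bounds sum to at most the norm of f, so f - V i f has at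
  most twice that norm, and \<open>\<eta> i * Cc i\<close> = 2^-(i + 2) turns the factor 2 into
  2^-(i + 1).\<close>

lemma D_eta:
  assumes f: "f \<in> Lp p"
  shows "norm (D i f) * \<eta> i \<le> lp_norm p f / 2 ^ (i + 1)"
proof (induction i rule: less_induct)
  case (less i)
  have "lp_norm p (V i f) \<le> (\<Sum>j<i. lp_norm p (\<lambda>x. D j f * err (N j) j x))"
    unfolding V_sum[abs_def] by (intro lp_norm_sum[OF p1] Lp_cmult[OF p1] err_Lp)
  also have "\<dots> \<le> (\<Sum>j<i. lp_norm p f / 2 ^ (j + 1))"
  proof (rule sum_mono)
    fix j assume "j \<in> {..<i}"
    have "lp_norm p (\<lambda>x. D j f * err (N j) j x) \<le> norm (D j f) * \<eta> j"
      unfolding lp_norm_cmult[OF p1] by (intro mult_left_mono err_norm) auto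
    then show "lp_norm p (\<lambda>x. D j f * err (N j) j x) \<le> lp_norm p f / 2 ^ (j + 1)"
      using less[of j] \<open>j \<in> {..<i}\<close> by simp
  qed
  also have "\<dots> = lp_norm p f * (\<Sum>j<i. 1 / 2 ^ (j + 0 + 1))" by (simp add: sum_distrib_left)
  also have "\<dots> \<le> lp_norm p f * (1 / 2 ^ 0)" by (intro mult_left_mono half_sum) simp
  finally have Vn: "lp_norm p (V i f) \<le> lp_norm p f" by simp
  have "norm (D i f) \<le> Cc i * lp_norm p (\<lambda>x. f x - V i f x)"
    unfolding D_def by (intro es_bound Lp_diff[OF p1] f V_Lp)
  also have "\<dots> \<le> Cc i * (2 * lp_norm p f)"
    using lp_norm_triangle_diff[OF p1 f V_Lp, of i f] Vn Cc[of i] by (intro mult_left_mono) auto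
  finally have "norm (D i f) * \<eta> i \<le> Cc i * (2 * lp_norm p f) * \<eta> i"
    using \<eta>(1)[of i] by (intro mult_right_mono) auto
  also have "\<dots> = (\<eta> i * Cc i) * (2 * lp_norm p f)" by simp
  also have "\<dots> = lp_norm p f / 2 ^ (i + 1)" unfolding \<eta>(3) by simp
  finally show ?case .
qed

lemma D_err_norm:
  assumes "f \<in> Lp p" "A \<subseteq> N j"
  shows "lp_norm p (\<lambda>x. D j f * err A j x) \<le> lp_norm p f / 2 ^ (j + 1)"
proof -
  have "lp_norm p (\<lambda>x. D j f * err A j x) \<le> norm (D j f) * \<eta> j"
    unfolding lp_norm_cmult[OF p1] by (intro mult_left_mono err_norm assms) auto
  then show ?thesis using D_eta[OF assms(1), of j] by simp
qed

definition corr :: "(real \<Rightarrow> complex) \<Rightarrow> real \<Rightarrow> complex" where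
  "corr f x = (\<Sum>j. D j f * err (N j) j x)"

lemma summable_corr: "summable (\<lambda>j. D j f * err (N j) j x)"
proof -
  obtain n :: nat where n: "\<bar>x\<bar> \<le> real n" using real_arch_simple by blast
  have "err (N j) j x = 0" if "j \<notin> {..<n}" for j
    by (rule err_zero) (use n that R_nonneg[of j] in auto)
  then show ?thesis by (intro summable_finite[of "{..<n}"]) auto
qed

lemma corr_split: "corr f x = (\<Sum>i. D (i + J) f * err (N (i + J)) (i + J) x) + V J f x"
  unfolding corr_def V_sum by (rule suminf_split_initial_segment[OF summable_corr])

lemma corr_tail:
  assumes f: "f \<in> Lp p"
  shows "(\<lambda>x. corr f x - V J f x) \<in> Lp p" "lp_norm p (\<lambda>x. corr f x - V J f x) \<le> lp_norm p f / 2 ^ J"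
proof -
  have eq: "corr f x - V J f x = (\<Sum>i. D (i + J) f * err (N (i + J)) (i + J) x)" for x
    using corr_split[of f x J] by simp
  have "(\<Sum>i<n. lp_norm p (\<lambda>x. D (i + J) f * err (N (i + J)) (i + J) x)) \<le> (\<Sum>i<n. lp_norm p f / 2 ^ (i + J + 1))" for n
    by (intro sum_mono D_err_norm f order_refl)
  also have "(\<Sum>i<n. lp_norm p f / 2 ^ (i + J + 1)) = lp_norm p f * (\<Sum>i<n. 1 / 2 ^ (i + J + 1))" for n
    by (simp add: sum_distrib_left)
  also have "lp_norm p f * (\<Sum>i<n. 1 / 2 ^ (i + J + 1)) \<le> lp_norm p f * (1 / 2 ^ J)" for n
    by (intro mult_left_mono half_sum) simp
  finally have bd: "(\<Sum>i<n. lp_norm p (\<lambda>x. D (i + J) f * err (N (i + J)) (i + J) x)) \<le> lp_norm p f / 2 ^ J" for n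
    by simp
  have sm: "summable (\<lambda>i. D (i + J) f * err (N (i + J)) (i + J) x)" for x
    using summable_corr by (subst summable_iff_shift[of "\<lambda>j. D j f * err (N j) j x"])
  show "(\<lambda>x. corr f x - V J f x) \<in> Lp p" "lp_norm p (\<lambda>x. corr f x - V J f x) \<le> lp_norm p f / 2 ^ J"
    unfolding eq by (rule Lp_suminf[OF p1 Lp_cmult[OF p1 err_Lp] sm bd])+
qed

lemma corr_Lp: "f \<in> Lp p \<Longrightarrow> corr f \<in> Lp p"
  using corr_tail(1)[of f 0] by simp

text \<open>The error of block \<open>j\<close> vanishes on \<open>[-R j, R j]\<close>, so the errors do not disturb earlier coefficients
  and the perturbed system is inverted by a finite recursion.\<close>

lemma es_corr: "es i (\<lambda>x. f x - corr f x) = D i f"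
  unfolding D_def
proof (rule es_local)
  fix x assume x: "\<bar>x\<bar> \<le> R i"
  have "err (N (k + i)) (k + i) x = 0" for k
    by (rule err_zero) (use x R_mono[of i "k + i"] in auto)
  then have "corr f x = V i f x" unfolding corr_split[of f x i] by simp
  then show "f x - corr f x = f x - V i f x" by simp
qed

section \<open>The dual functionals and the frame property\<close>

definition blk :: "nat \<Rightarrow> nat" where "blk n = (THE j. n \<in> N j)"

lemma blk_eq: "n \<in> N j \<Longrightarrow> blk n = j"
  unfolding blk_def using N_unique by blast

text \<open>All points of block j share one coefficient, so a full block contributes
  \<open>D j f\<close> times the normalised average of its shifts, that is
  \<open>D j f * (e j + err (N j) j)\<close>.\<close>

definition gs :: "real \<times> real \<Rightarrow> (real \<Rightarrow> complex) \<Rightarrow> complex" where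
  "gs l f = (if l \<in> range lam then let j = blk (inv lam l) in of_real (1 / (\<alpha> j * real (K j))) * D j f else 0)"

lemma gs_dual: "gs l \<in> Lp_dual p"
proof -
  define j where "j = blk (inv lam l)"
  have b: "norm (D j f) \<le> lp_norm p f / 2 ^ (j + 1) / \<eta> j" if "f \<in> Lp p" for f
    using D_eta[OF that, of j] \<eta>(1)[of j] by (simp add: pos_le_divide_eq mult_ac)
  have "\<exists>C. \<forall>f\<in>Lp p. norm (gs l f) \<le> C * lp_norm p f"
  proof (intro exI ballI)
    fix f assume f: "f \<in> Lp p"
    have c: "0 \<le> 1 / (\<alpha> j * real (K j))" using \<alpha>(1)[of j] by simp
    have "norm (gs l f) \<le> 1 / (\<alpha> j * real (K j)) * norm (D j f)"
    proof (cases "l \<in> range lam")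
      case True
      then have "gs l f = of_real (1 / (\<alpha> j * real (K j))) * D j f"
        unfolding gs_def j_def Let_def by (simp only: if_True)
      then show ?thesis by (simp only: norm_mult norm_of_real abs_of_nonneg[OF c] order_refl)
    next
      case False
      then show ?thesis using c by (simp add: gs_def)
    qed
    also have "\<dots> \<le> 1 / (\<alpha> j * real (K j)) * (lp_norm p f / 2 ^ (j + 1) / \<eta> j)"
      by (rule mult_left_mono[OF b[OF f] c])
    also have "\<dots> = (1 / (\<alpha> j * real (K j)) * (1 / 2 ^ (j + 1) / \<eta> j)) * lp_norm p f" by simp
    finally show "norm (gs l f) \<le> (1 / (\<alpha> j * real (K j)) * (1 / 2 ^ (j + 1) / \<eta> j)) * lp_norm p f" .
  qed
  then show ?thesis
    unfolding Lp_dual_def by (auto simp: gs_def Let_def D_linear distrib_left)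
qed

text \<open>Write f = h + corr f. A finite set containing the first J blocks meets each later block
  in some fraction \<open>\<theta> j\<close>: its main part is a multiplier expansion of h, and its
  error part deviates from \<open>corr f\<close> only from block J on.\<close>

theorem gabor_frame:
  assumes c: "countable \<Lambda>" and lam: "range lam \<subseteq> \<Lambda>"
  shows "uncond_schauder_frame p \<Lambda> (gabor g) gs"
  unfolding uncond_schauder_frame_def
proof (intro conjI ballI allI impI c)
  show "gabor g n \<in> Lp p" for n using gabor_Lp(1)[OF p1 g_Lp] by (simp add: case_prod_beta)
  show "gs n \<in> Lp_dual p" for n by (rule gs_dual)
  fix f and \<epsilon> :: real assume f: "f \<in> Lp p" and \<epsilon>: "0 < \<epsilon>"
  define h where "h x = f x - corr f x" for x
  have hL: "h \<in> Lp p" unfolding h_def by (intro Lp_diff[OF p1] f corr_Lp)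
  have esh: "es i h = D i f" for i unfolding h_def[abs_def] by (rule es_corr)
  obtain n0 where n0: "\<forall>F \<theta>. finite F \<longrightarrow> {..<n0} \<subseteq> F \<longrightarrow> (\<forall>i\<in>F. \<bar>\<theta> i\<bar> \<le> (1::real)) \<longrightarrow>
      (\<forall>i<n0. \<theta> i = 1) \<longrightarrow> lp_norm p (\<lambda>x. h x - (\<Sum>i\<in>F. of_real (\<theta> i) * es i h * e i x)) < \<epsilon> / 2"
    using unconditional[OF hL, of "\<epsilon> / 2"] \<epsilon> by auto
  \<comment> \<open>The factor 3 provides for the remainders \<open>r2\<close>, \<open>r3\<close>
    and \<open>r4\<close>, each at most the norm of f divided by 2^J.\<close>
  obtain J0 where J0: "3 * lp_norm p f * (1/2) ^ J0 < \<epsilon> / 2"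
  proof -
    have "(\<lambda>J. 3 * lp_norm p f * (1/2::real) ^ J) \<longlonglongrightarrow> 3 * lp_norm p f * 0"
      by (intro tendsto_mult tendsto_const LIMSEQ_realpow_zero) auto
    then have "\<forall>\<^sub>F J in sequentially. 3 * lp_norm p f * (1/2::real) ^ J < \<epsilon> / 2"
      by (rule order_tendstoD) (use \<epsilon> in simp)
    then show ?thesis using that by (auto simp: eventually_sequentially)
  qed
  define J where "J = max n0 J0"
  have J: "n0 \<le> J" "3 * lp_norm p f / 2 ^ J < \<epsilon> / 2"
  proof -
    have "(1/2::real) ^ J \<le> (1/2) ^ J0" by (rule power_decreasing) (auto simp: J_def)
    then have "3 * lp_norm p f * (1/2) ^ J \<le> 3 * lp_norm p f * (1/2) ^ J0" by (intro mult_left_mono) auto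
    moreover have "3 * lp_norm p f / 2 ^ J = 3 * lp_norm p f * (1/2) ^ J" by (simp add: power_one_over)
    ultimately show "3 * lp_norm p f / 2 ^ J < \<epsilon> / 2" using J0 by linarith
  qed (simp add: J_def)
  show "\<exists>F0. finite F0 \<and> F0 \<subseteq> \<Lambda> \<and> (\<forall>F. finite F \<and> F0 \<subseteq> F \<and> F \<subseteq> \<Lambda> \<longrightarrow>
      lp_norm p (\<lambda>y. f y - (\<Sum>n\<in>F. gs n f * gabor g n y)) < \<epsilon>)"
  proof (intro exI[of _ "lam ` {..<B J}"] conjI allI impI)
    show "lam ` {..<B J} \<subseteq> \<Lambda>" using lam by auto
    fix F assume F: "finite F \<and> lam ` {..<B J} \<subseteq> F \<and> F \<subseteq> \<Lambda>"
    define M where "M = lam -` F"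
    have M: "finite M" "{..<B J} \<subseteq> M" using F finite_vimageI[OF _ lam_inj] by (auto simp: M_def)
    define J' where "J' = max J (Suc (Max (insert 0 M)))"
    have J': "J \<le> J'" "M \<subseteq> {..<B J'}"
    proof -
      have "m < B J'" if "m \<in> M" for m
      proof -
        have "m \<le> Max (insert 0 M)" using M that by (intro Max_ge) auto
        also have "\<dots> < J'" by (simp add: J'_def)
        also have "\<dots> \<le> B J'" by (rule B_ge)
        finally show ?thesis .
      qed
      then show "M \<subseteq> {..<B J'}" by blast
    qed (simp add: J'_def)
    define A where "A j = M \<inter> N j" for j
    have A: "A j \<subseteq> N j" "finite (A j)" for j using M by (auto simp: A_def)
    have A_full: "A j = N j" if "j < J" for j
    proof -
      have "N j \<subseteq> {..<B J}" using N_cover[of J] that by blast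
      then show ?thesis using M by (auto simp: A_def)
    qed
    define \<theta> where "\<theta> j = real (card (A j)) / real (K j)" for j
    have K0: "0 < real (K j)" for j using K(1)[of j] by simp
    have \<theta>: "\<bar>\<theta> j\<bar> \<le> 1" "j < J \<Longrightarrow> \<theta> j = 1" for j
    proof -
      have "card (A j) \<le> K j" using card_mono[OF card_N(2) A(1)] card_N(1) by simp
      then show "\<bar>\<theta> j\<bar> \<le> 1" using K0[of j] by (simp add: \<theta>_def)
      show "\<theta> j = 1" if "j < J" using K0[of j] A_full[OF that] card_N(1) by (simp add: \<theta>_def)
    qed
    have block: "(\<Sum>n\<in>A j. of_real (1 / (\<alpha> j * real (K j))) * D j f * u n x)
      = of_real (\<theta> j) * D j f * e j x + D j f * err (A j) j x" for j x
    proof -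
      have "(\<Sum>n\<in>A j. u n x) = (\<Sum>n\<in>A j. u n x - of_real (\<alpha> j) * e j x) + of_real (real (card (A j)) * \<alpha> j) * e j x"
        by (simp add: sum_subtractf)
      then have "(\<Sum>n\<in>A j. of_real (1 / (\<alpha> j * real (K j))) * D j f * u n x)
        = of_real (1 / (\<alpha> j * real (K j))) * D j f * ((\<Sum>n\<in>A j. u n x - of_real (\<alpha> j) * e j x) + of_real (real (card (A j)) * \<alpha> j) * e j x)"
        by (simp only: flip: sum_distrib_left)
      also have "\<dots> = D j f * err (A j) j x + of_real (1 / (\<alpha> j * real (K j)) * (real (card (A j)) * \<alpha> j)) * D j f * e j x"
        unfolding err_def of_real_mult by (simp only: distrib_left mult_ac)
      also have "1 / (\<alpha> j * real (K j)) * (real (card (A j)) * \<alpha> j) = \<theta> j"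
        using \<alpha>(1)[of j] by (simp add: \<theta>_def)
      finally show ?thesis by simp
    qed
    have sumF: "(\<Sum>l\<in>F. gs l f * gabor g l x)
      = (\<Sum>j<J'. of_real (\<theta> j) * D j f * e j x) + (\<Sum>j<J'. D j f * err (A j) j x)" for x
    proof -
      have "(\<Sum>l\<in>F. gs l f * gabor g l x) = (\<Sum>l\<in>lam ` M. gs l f * gabor g l x)"
        by (rule sum.mono_neutral_right) (use F in \<open>auto simp: M_def gs_def\<close>)
      also have "\<dots> = (\<Sum>n\<in>M. gs (lam n) f * u n x)"
        by (subst sum.reindex) (auto simp: u_def intro: inj_on_subset[OF lam_inj])
      also have "\<dots> = (\<Sum>n\<in>(\<Union>j<J'. A j). gs (lam n) f * u n x)"
      proof -
        have "M = (\<Union>j<J'. A j)" using J'(2) unfolding N_cover A_def by blast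
        then show ?thesis by simp
      qed
      also have "\<dots> = (\<Sum>j<J'. \<Sum>n\<in>A j. gs (lam n) f * u n x)"
        by (rule sum.UNION_disjoint) (use A N_unique in \<open>auto simp: A_def\<close>)
      also have "\<dots> = (\<Sum>j<J'. \<Sum>n\<in>A j. of_real (1 / (\<alpha> j * real (K j))) * D j f * u n x)"
      proof (intro sum.cong refl)
        fix j n assume "n \<in> A j"
        then have "blk n = j" using A blk_eq by blast
        then show "gs (lam n) f * u n x = of_real (1 / (\<alpha> j * real (K j))) * D j f * u n x"
          using lam_inj by (simp add: gs_def Let_def)
      qed
      also have "\<dots> = (\<Sum>j<J'. of_real (\<theta> j) * D j f * e j x) + (\<Sum>j<J'. D j f * err (A j) j x)"
        unfolding block by (rule sum.distrib)
      finally show ?thesis .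
    qed
    \<comment> \<open>\<open>r1\<close> is the remainder of the multiplier expansion of h,
      \<open>r2\<close> the tail of the correction beyond every block touched by F, and
      \<open>r3 - r4\<close> exchanges full for partial errors on the blocks in between.\<close>
    define r1 where "r1 x = h x - (\<Sum>j<J'. of_real (\<theta> j) * D j f * e j x)" for x
    define r2 where "r2 x = corr f x - V J' f x" for x
    define r3 where "r3 x = (\<Sum>j\<in>{J..<J'}. D j f * err (N j) j x)" for x
    define r4 where "r4 x = (\<Sum>j\<in>{J..<J'}. D j f * err (A j) j x)" for x
    have "f x - (\<Sum>l\<in>F. gs l f * gabor g l x) = r1 x + (r2 x + (r3 x - r4 x))" for x
    proof -
      have split: "(\<Sum>j<J'. c j) = (\<Sum>j<J. c j) + (\<Sum>j\<in>{J..<J'}. c j)" for c :: "nat \<Rightarrow> complex"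
        using sum.atLeastLessThan_concat[of 0 J J' c] J' by (simp add: atLeast0LessThan)
      have "(\<Sum>j<J. D j f * err (A j) j x) = (\<Sum>j<J. D j f * err (N j) j x)"
        by (intro sum.cong refl) (simp add: A_full)
      then have "(\<Sum>j<J'. D j f * err (A j) j x) = V J' f x - r3 x + r4 x"
        unfolding V_sum split r3_def r4_def by simp
      then show ?thesis unfolding sumF r1_def r2_def h_def by simp
    qed
    then have "lp_norm p (\<lambda>x. f x - (\<Sum>l\<in>F. gs l f * gabor g l x)) = lp_norm p (\<lambda>x. r1 x + (r2 x + (r3 x - r4 x)))"
      by presburger
    also have "\<dots> \<le> lp_norm p r1 + (lp_norm p r2 + (lp_norm p r3 + lp_norm p r4))"
    proof -
      have L: "r1 \<in> Lp p" "r2 \<in> Lp p" "r3 \<in> Lp p" "r4 \<in> Lp p"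
        unfolding r1_def r2_def r3_def r4_def
        by (intro Lp_diff[OF p1] Lp_sum[OF p1] Lp_cmult[OF p1] hL e_Lp corr_tail(1)[OF f] err_Lp)+
      show ?thesis
        using lp_norm_triangle[OF p1 L(1) Lp_add[OF p1 L(2) Lp_diff[OF p1 L(3,4)]]]
          lp_norm_triangle[OF p1 L(2) Lp_diff[OF p1 L(3,4)]] lp_norm_triangle_diff[OF p1 L(3,4)]
        by linarith
    qed
    finally have le: "lp_norm p (\<lambda>x. f x - (\<Sum>l\<in>F. gs l f * gabor g l x)) \<le> lp_norm p r1 + (lp_norm p r2 + (lp_norm p r3 + lp_norm p r4))" .
    have r1: "lp_norm p r1 < \<epsilon> / 2"
      using n0[THEN spec, THEN spec, of "{..<J'}" \<theta>] \<theta> J J' unfolding r1_def[abs_def] esh by auto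
    have r2: "lp_norm p r2 \<le> lp_norm p f / 2 ^ J"
    proof -
      have "lp_norm p r2 \<le> lp_norm p f / 2 ^ J'" unfolding r2_def[abs_def] by (rule corr_tail(2)[OF f])
      also have "\<dots> \<le> lp_norm p f / 2 ^ J" using J' by (intro divide_left_mono) auto
      finally show ?thesis .
    qed
    have r34: "lp_norm p r3 \<le> lp_norm p f / 2 ^ J" "lp_norm p r4 \<le> lp_norm p f / 2 ^ J"
    proof -
      have *: "lp_norm p (\<lambda>x. \<Sum>j\<in>{J..<J'}. D j f * err (X j) j x) \<le> lp_norm p f / 2 ^ J" if "\<And>j. X j \<subseteq> N j" for X
      proof -
        have "lp_norm p (\<lambda>x. \<Sum>j\<in>{J..<J'}. D j f * err (X j) j x) \<le> (\<Sum>j\<in>{J..<J'}. lp_norm p (\<lambda>x. D j f * err (X j) j x))"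
          by (intro lp_norm_sum[OF p1] Lp_cmult[OF p1] err_Lp)
        also have "\<dots> \<le> (\<Sum>j\<in>{J..<J'}. lp_norm p f / 2 ^ (j + 1))"
          by (intro sum_mono D_err_norm f that)
        also have "\<dots> = (\<Sum>i<J' - J. lp_norm p f / 2 ^ (i + J + 1))"
          using J' sum.shift_bounds_nat_ivl[of "\<lambda>j. lp_norm p f / 2 ^ (j + 1)" 0 J "J' - J"] by (simp add: atLeast0LessThan)
        also have "\<dots> = lp_norm p f * (\<Sum>i<J' - J. 1 / 2 ^ (i + J + 1))" by (simp add: sum_distrib_left)
        also have "\<dots> \<le> lp_norm p f * (1 / 2 ^ J)" by (intro mult_left_mono half_sum) simp
        finally show ?thesis by simp
      qed
      show "lp_norm p r3 \<le> lp_norm p f / 2 ^ J" unfolding r3_def[abs_def] by (rule *) simp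
      show "lp_norm p r4 \<le> lp_norm p f / 2 ^ J" unfolding r4_def[abs_def] by (rule *) (rule A(1))
    qed
    have "3 * lp_norm p f / 2 ^ J = lp_norm p f / 2 ^ J + (lp_norm p f / 2 ^ J + lp_norm p f / 2 ^ J)" by simp
    then show "lp_norm p (\<lambda>x. f x - (\<Sum>l\<in>F. gs l f * gabor g l x)) < \<epsilon>"
      using le r1 r2 r34 J(2) by linarith
  qed simp
qed

end

section \<open>Existence of Gabor frames\<close>

lemma exists_scattered_sequence:
  fixes \<Lambda> :: "(real \<times> real) set" and R :: "nat \<Rightarrow> real"
  assumes "\<And>b. \<exists>l\<in>\<Lambda>. b < \<bar>fst l\<bar>"
  shows "\<exists>lam. range lam \<subseteq> \<Lambda> \<and> (\<forall>n. 4 * (\<Sum>k<n. \<bar>fst (lam k)\<bar>) + 2 * R n + real n < \<bar>fst (lam n)\<bar>)"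
proof -
  have "\<forall>b. \<exists>l. l \<in> \<Lambda> \<and> b < \<bar>fst l\<bar>" using assms by blast
  from choice[OF this] obtain pick where pick: "\<And>b. pick b \<in> \<Lambda>" "\<And>b. b < \<bar>fst (pick b)\<bar>" by blast
  \<comment> \<open>The recursion runs on the accumulated sum of |t k|, which is all that the next
    choice has to know about earlier points.\<close>
  define S where "S = rec_nat (0::real) (\<lambda>n s. s + \<bar>fst (pick (4 * s + 2 * R n + real n))\<bar>)"
  define lam where "lam n = pick (4 * S n + 2 * R n + real n)" for n
  have "S n = (\<Sum>k<n. \<bar>fst (lam k)\<bar>)" for n
    by (induction n) (simp_all add: S_def lam_def)
  moreover have "4 * S n + 2 * R n + real n < \<bar>fst (lam n)\<bar>" for n unfolding lam_def by (rule pick)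
  ultimately have "4 * (\<Sum>k<n. \<bar>fst (lam k)\<bar>) + 2 * R n + real n < \<bar>fst (lam n)\<bar>" for n by simp
  moreover have "range lam \<subseteq> \<Lambda>" using pick by (auto simp: lam_def)
  ultimately show ?thesis by blast
qed

text \<open>Since |x| \<le> 2^m |x|, the position q alone gives a radius, uniformly in the level m;
  it therefore also serves the children of a cell.\<close>

lemma dyadic_abs_le:
  assumes "x \<in> dyadic m q"
  shows "\<bar>x\<bar> \<le> of_int \<bar>q\<bar> + 1"
proof -
  have x: "of_int q \<le> 2 ^ m * x" "2 ^ m * x < of_int q + 1"
    using assms by (auto simp: dyadic_iff floor_eq_iff)
  have "\<bar>x\<bar> \<le> 2 ^ m * \<bar>x\<bar>" by (simp add: mult_le_cancel_right1)
  also have "\<dots> = \<bar>2 ^ m * x\<bar>" by (simp add: abs_mult)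
  also have "\<dots> \<le> of_int \<bar>q\<bar> + 1" using x by (simp add: abs_if split: if_splits)
  finally show ?thesis .
qed

lemma haar_dual_cong:
  assumes "\<And>x. \<bar>x\<bar> \<le> of_int \<bar>q\<bar> + 1 \<Longrightarrow> f x = f' x"
  shows "haar_dual (l, q) f = haar_dual (l, q) f'"
proof -
  have avg: "avg m r f = avg m r f'" if "dyadic m r \<subseteq> dyadic j q" for m r j
  proof -
    have "indicator (dyadic m r) x * f x = indicator (dyadic m r) x * f' x" for x
      using that dyadic_abs_le[of x j q] assms[of x] by (auto simp: indicator_def)
    then show ?thesis by (simp only: avg_def)
  qed
  show ?thesis
  proof (cases l)
    case 0
    then show ?thesis using avg[of 0 q 0] by simp
  next
    case (Suc j)
    have "dyadic (Suc j) (2 * q) \<subseteq> dyadic j q" "dyadic (Suc j) (2 * q + 1) \<subseteq> dyadic j q"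
      using floor_dyadic_div[of j _ 1] by (auto simp: dyadic_iff)
    then show ?thesis using avg[of "Suc j" _ j] Suc by (simp add: haar_coeff_def)
  qed
qed

definition haar_index :: "nat \<Rightarrow> nat \<times> int" where
  "haar_index i = map_prod id int_decode (prod_decode i)"

lemma bij_haar_index: "bij haar_index"
proof -
  have "bij (map_prod id int_decode :: nat \<times> nat \<Rightarrow> nat \<times> int)"
    using bij_betw_map_prod[OF bij_id bij_int_decode] by simp
  from bij_comp[OF bij_prod_decode this] show ?thesis by (simp add: haar_index_def[abs_def] comp_def)
qed

text \<open>A running sum in place of the radius of the cell itself, because
  \<open>unconditional_system\<close> asks for radii that increase with the index.\<close>

definition haar_radius :: "nat \<Rightarrow> real" where
  "haar_radius i = (\<Sum>k\<le>i. of_int \<bar>snd (haar_index k)\<bar> + 1)"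

lemma haar_radius_ge: "of_int \<bar>snd (haar_index i)\<bar> + 1 \<le> haar_radius i"
  unfolding haar_radius_def by (rule member_le_sum) auto

lemma haar_unconditional_system:
  assumes p: "2 < p"
  shows "unconditional_system p (\<lambda>i. haar (haar_index i)) (\<lambda>i. haar_dual (haar_index i))
    (\<lambda>i. 2 ^ (fst (haar_index i) + 1)) haar_radius"
proof
  have p1: "1 \<le> p" and p2: "2 \<le> p" using p by simp_all
  show "2 < p" by (rule p)
  show "haar (haar_index i) \<in> Lp p" "lp_norm p (haar (haar_index i)) \<le> 1" for i by (rule haar_Lp[OF p1])+
  show "haar_dual (haar_index i) (\<lambda>x. f x + f' x) = haar_dual (haar_index i) f + haar_dual (haar_index i) f'" if "f \<in> Lp p" "f' \<in> Lp p" for f f' i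
    by (rule haar_dual_add[OF p1 that])
  show "haar_dual (haar_index i) (\<lambda>x. c * f x) = c * haar_dual (haar_index i) f" for f c i by (rule haar_dual_cmult[OF p1])
  show "norm (haar_dual (haar_index i) f) \<le> 2 ^ (fst (haar_index i) + 1) * lp_norm p f" if "f \<in> Lp p" for f i
    by (rule haar_dual_bound[OF p1 that])
  show "1 \<le> (2::real) ^ (fst (haar_index i) + 1)" for i by (rule one_le_power) simp
  show "haar_radius i \<le> haar_radius j" if "i \<le> j" for i j
    unfolding haar_radius_def by (rule sum_mono2) (use that in auto)
  show "0 \<le> haar_radius i" for i unfolding haar_radius_def by (intro sum_nonneg) auto
  show "\<bar>x\<bar> \<le> haar_radius i" if "haar (haar_index i) x \<noteq> 0" for i x
  proof -
    have "haar (fst (haar_index i), snd (haar_index i)) x \<noteq> 0" using that by simp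
    from dyadic_abs_le[OF haar_support[OF this]] haar_radius_ge[of i] show ?thesis by linarith
  qed
  show "haar_dual (haar_index i) f = haar_dual (haar_index i) f'" if eq: "\<And>x. \<bar>x\<bar> \<le> haar_radius i \<Longrightarrow> f x = f' x" for f f' i
  proof -
    have "haar_dual (fst (haar_index i), snd (haar_index i)) f = haar_dual (fst (haar_index i), snd (haar_index i)) f'"
      by (rule haar_dual_cong, rule eq) (use haar_radius_ge[of i] in linarith)
    then show ?thesis by simp
  qed
  fix h \<epsilon> assume h: "h \<in> Lp p" and \<epsilon>: "(0::real) < \<epsilon>"
  show "\<exists>n0. \<forall>F \<theta>. finite F \<longrightarrow> {..<n0} \<subseteq> F \<longrightarrow> (\<forall>i\<in>F. \<bar>\<theta> i\<bar> \<le> 1) \<longrightarrow> (\<forall>i<n0. \<theta> i = 1) \<longrightarrow>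
    lp_norm p (\<lambda>x. h x - (\<Sum>i\<in>F. complex_of_real (\<theta> i) * haar_dual (haar_index i) h * haar (haar_index i) x)) < \<epsilon>"
  proof (rule haar_unconditional[OF p2 h \<epsilon>])
    fix F0 :: "(nat \<times> int) set"
    assume F0: "finite F0" and conv: "\<And>F \<theta>. finite F \<Longrightarrow> F0 \<subseteq> F \<Longrightarrow> (\<And>i. i \<in> F \<Longrightarrow> \<bar>\<theta> i\<bar> \<le> (1::real)) \<Longrightarrow>
      (\<And>i. i \<in> F0 \<Longrightarrow> \<theta> i = 1) \<Longrightarrow> lp_norm p (\<lambda>x. h x - (\<Sum>i\<in>F. of_real (\<theta> i) * haar_dual i h * haar i x)) < \<epsilon>"
    have inj: "inj haar_index" and surj: "surj haar_index" using bij_haar_index by (auto simp: bij_def)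
    have inv: "inv haar_index (haar_index i) = i" for i by (rule inv_f_f[OF inj])
    have fin: "finite (haar_index -` F0)" by (rule finite_vimageI[OF F0 inj])
    define n0 where "n0 = Suc (Max (insert 0 (haar_index -` F0)))"
    have n0: "\<exists>k<n0. i = haar_index k" if "i \<in> F0" for i
    proof -
      obtain k where k: "i = haar_index k" using surj by (metis surjD)
      then have "k \<le> Max (insert 0 (haar_index -` F0))" using that fin by (intro Max_ge) auto
      then show ?thesis using k by (intro exI[of _ k]) (simp add: n0_def)
    qed
    show ?thesis
    proof (intro exI[of _ n0] allI impI)
      fix F and \<theta> :: "nat \<Rightarrow> real"
      assume F: "finite F" "{..<n0} \<subseteq> F" and \<theta>: "\<forall>i\<in>F. \<bar>\<theta> i\<bar> \<le> 1" "\<forall>i<n0. \<theta> i = 1"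
      have "(\<Sum>i\<in>haar_index ` F. complex_of_real (\<theta> (inv haar_index i)) * haar_dual i h * haar i x)
          = (\<Sum>i\<in>F. complex_of_real (\<theta> i) * haar_dual (haar_index i) h * haar (haar_index i) x)" for x
        by (subst sum.reindex[OF inj_on_subset[OF inj subset_UNIV]]) (simp add: inv)
      moreover have "lp_norm p (\<lambda>x. h x - (\<Sum>i\<in>haar_index ` F. complex_of_real (\<theta> (inv haar_index i)) * haar_dual i h * haar i x)) < \<epsilon>"
      proof (rule conv)
        show "F0 \<subseteq> haar_index ` F" using n0 F(2) by blast
        show "\<bar>\<theta> (inv haar_index i)\<bar> \<le> 1" if "i \<in> haar_index ` F" for i using that \<theta>(1) by (auto simp: inv)
        show "\<theta> (inv haar_index i) = 1" if "i \<in> F0" for i using n0[OF that] \<theta>(2) by (auto simp: inv)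
      qed (use F in simp)
      ultimately show "lp_norm p (\<lambda>x. h x - (\<Sum>i\<in>F. complex_of_real (\<theta> i) * haar_dual (haar_index i) h * haar (haar_index i) x)) < \<epsilon>"
        by simp
    qed
  qed
qed

theorem exists_gabor_frame:
  assumes p: "2 < p" and c: "countable \<Lambda>" and wide: "\<And>a. 0 < a \<Longrightarrow> \<not> \<Lambda> \<subseteq> {-a..a} \<times> UNIV"
  shows "\<exists>g\<in>Lp p. \<exists>gs. uncond_schauder_frame p \<Lambda> (gabor g) gs"
proof -
  have "\<exists>l\<in>\<Lambda>. b < \<bar>fst l\<bar>" for b
  proof -
    \<comment> \<open>\<open>wide\<close> speaks of positive half-widths, hence the maximum with
      1.\<close>
    have "\<not> \<Lambda> \<subseteq> {- max b 1..max b 1} \<times> UNIV" by (rule wide) simp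
    then obtain l where "l \<in> \<Lambda>" "fst l \<notin> {- max b 1..max b 1}" by (auto simp: subset_iff)
    then show ?thesis by (intro bexI[of _ l]) auto
  qed
  from exists_scattered_sequence[OF this, of haar_radius] obtain lam where lam: "range lam \<subseteq> \<Lambda>"
    "\<And>n. 4 * (\<Sum>k<n. \<bar>fst (lam k)\<bar>) + 2 * haar_radius n + real n < \<bar>fst (lam n)\<bar>" by blast
  interpret scattered_system p "\<lambda>i. haar (haar_index i)" "\<lambda>i. haar_dual (haar_index i)" "\<lambda>i. 2 ^ (fst (haar_index i) + 1)" haar_radius lam
    by (intro scattered_system.intro haar_unconditional_system p scattered_system_axioms.intro lam(2))
  show ?thesis using g_Lp gabor_frame[OF c lam(1)] by blast
qed

theorem theorem2p2:
  shows "(\<forall>(p::real) (\<Lambda>::(real \<times> real) set).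
            2 < p \<and> countable \<Lambda> \<and> (\<forall>a>0. \<not> \<Lambda> \<subseteq> {-a..a} \<times> UNIV) \<longrightarrow>
            (\<exists>g\<in>Lp p. \<exists>gs. uncond_schauder_frame p \<Lambda>
                (\<lambda>(t, s) x. modul s x * transl t g x) gs))
       \<and> (\<forall>(p::real) (a::real) (\<Lambda>::(real \<times> real) set).
            2 \<le> p \<and> 0 < a \<and> countable \<Lambda> \<and> \<Lambda> \<subseteq> {-a..a} \<times> UNIV \<longrightarrow>
            \<not> (\<exists>g\<in>Lp p. \<exists>gs. uncond_schauder_frame p \<Lambda>
                (\<lambda>(t, s) x. modul s x * transl t g x) gs))"
proof (intro conjI allI impI)
  fix p :: real and \<Lambda> :: "(real \<times> real) set"
  assume "2 < p \<and> countable \<Lambda> \<and> (\<forall>a>0. \<not> \<Lambda> \<subseteq> {-a..a} \<times> UNIV)"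
  then show "\<exists>g\<in>Lp p. \<exists>gs. uncond_schauder_frame p \<Lambda> (\<lambda>(t, s) x. modul s x * transl t g x) gs"
    by (intro exists_gabor_frame) auto
next
  fix p a :: real and \<Lambda> :: "(real \<times> real) set"
  assume "2 \<le> p \<and> 0 < a \<and> countable \<Lambda> \<and> \<Lambda> \<subseteq> {-a..a} \<times> UNIV"
  then show "\<not> (\<exists>g\<in>Lp p. \<exists>gs. uncond_schauder_frame p \<Lambda> (\<lambda>(t, s) x. modul s x * transl t g x) gs)"
    using strip_no_gabor_frame by blast
qed

end
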